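(* Let $m>0$ and let $L_m=\mathfrak D\oplus W$ be a regular decomposition. Define $I_+\subseteq x\mathfrak g[x^{-1}]$ and $I_-\subseteq\mathfrak g[x]/x^m\mathfrak g[x]$ by $$I_+\times\{0\}=W\cap\big(x\mathfrak g[x^{-1}]\times\{0\}\big),\qquad \{0\}\times I_-=W\cap\big(\{0\}\times\mathfrak g[x]/x^m\mathfrak g[x]\big).$$ Then there is a subspace $W_{\mathfrak h}\subseteq\mathfrak h[x^{-1}]\times\mathfrak h[x]/x^m\mathfrak h[x]$ such that $$W=W_{\mathfrak h}\oplus(I_+\times\{0\})\oplus(\{0\}\times I_-).$$
   Context: $F$ is an algebraically closed field of characteristic $0$; $\mathfrak g$ is a finite-dimensional simple Lie algebra over $F$ with Cartan subalgebra $\mathfrak h$, root system $\Delta$, simple roots $\alpha_1,\dots,\alpha_n$ and maximal root $\sum_jk_j\alpha_j$. For $m\ge0$, $L_m=\mathfrak g(\!(x)\!)\times\mathfrak g[x]/x^m\mathfrak g[x]$ and $\mathfrak D=\{(f,[f])\mid f\in\mathfrak g[\![x]\!]\}\subseteq L_m$, where $[f]$ is the class of $f$ modulo $x^m$. Put $\mathfrak P_0=\mathfrak g[x^{-1}]$ and, for $1\le i\le n$, $\mathfrak P_i=\mathfrak h[x^{-1}]\oplus\bigoplus_{\alpha\in\Delta}x^{\lfloor\alpha(h_i)\rfloor}\mathfrak g_\alpha[x^{-1}]$, where $h_i\in\mathfrak h$ is defined by $\alpha_j(h_i)=\delta_{ij}/k_i$. A decomposition $L_m=\mathfrak D\oplus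 W$ is regular if $W\subseteq L_m$ is a Lie subalgebra complementary to $\mathfrak D$ such that: $[(h,h),W]\subseteq W$ for all $h\in\mathfrak h$; $W$ is stable under multiplication by $(x^{-1},0)$ and by $(0,[x])$, i.e. under $(a,b)\mapsto(x^{-1}a,0)$ and $(a,b)\mapsto(0,[x]b)$; and $W\subseteq\mathfrak P_i\times\mathfrak g[x]/x^m\mathfrak g[x]$ for some $0\le i\le n$. *)

theory Defs
  imports
    "HOL-Computational_Algebra.Computational_Algebra"
    "HOL-Library.Product_Plus"
begin

section \<open>Lie algebras\<close>

text \<open>The underlying space of the Lie algebra is the whole type \<open>'g\<close>.\<close>

locale lie_algebra = vector_space scale
  for scale :: "'f::field \<Rightarrow> 'g::ab_group_add \<Rightarrow> 'g" (infixr "*s" 75) +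
  fixes lie :: "'g \<Rightarrow> 'g \<Rightarrow> 'g"
  assumes lie_add_left: "lie (x + y) z = lie x z + lie y z"
    and lie_add_right: "lie x (y + z) = lie x y + lie x z"
    and lie_scale_left: "lie (c *s x) y = c *s lie x y"
    and lie_scale_right: "lie x (c *s y) = c *s lie x y"
    and lie_self: "lie x x = 0"
    and jacobi: "lie x (lie y z) + lie y (lie z x) + lie z (lie x y) = 0"
begin

lemma lie_0_left [simp]: "lie 0 y = 0"
  using lie_add_left[of 0 0 y] by simp

lemma lie_0_right [simp]: "lie x 0 = 0"
  using lie_add_right[of x 0 0] by simp

definition lie_subalgebra :: "'g set \<Rightarrow> bool" where
  "lie_subalgebra S \<longleftrightarrow> subspace S \<and> (\<forall>x\<in>S. \<forall>y\<in>S. lie x y \<in> S)"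

definition lie_ideal :: "'g set \<Rightarrow> bool" where
  "lie_ideal S \<longleftrightarrow> subspace S \<and> (\<forall>x. \<forall>y\<in>S. lie x y \<in> S)"

primrec lower_central :: "'g set \<Rightarrow> nat \<Rightarrow> 'g set" where
  "lower_central S 0 = S"
| "lower_central S (Suc n) = span {lie x y | x y. x \<in> S \<and> y \<in> lower_central S n}"

definition nilpotent_subalgebra :: "'g set \<Rightarrow> bool" where
  "nilpotent_subalgebra S \<longleftrightarrow> lie_subalgebra S \<and> (\<exists>n. lower_central S n = {0})"

definition normalizer :: "'g set \<Rightarrow> 'g set" where
  "normalizer S = {x. \<forall>y\<in>S. lie x y \<in> S}"

definition cartan_subalgebra :: "'g set \<Rightarrow> bool" where
  "cartan_subalgebra H \<longleftrightarrow> nilpotent_subalgebra H \<and> normalizer H = H"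

end

locale simple_lie_algebra = lie_algebra scale lie
  for scale :: "'f::{alg_closed_field, field_char_0} \<Rightarrow> 'g::ab_group_add \<Rightarrow> 'g" (infixr "*s" 75)
    and lie :: "'g \<Rightarrow> 'g \<Rightarrow> 'g" +
  assumes finite_dim: "\<exists>B. finite B \<and> span B = UNIV"
    and non_abelian: "\<exists>x y. lie x y \<noteq> 0"
    and no_proper_ideal: "lie_ideal I \<Longrightarrow> I = {0} \<or> I = UNIV"


section \<open>Roots\<close>

context lie_algebra
begin

text \<open>A linear functional on a subspace \<open>H\<close> is represented by a function on \<open>'g\<close> that vanishes
  outside \<open>H\<close>. This makes the representation unique and compatible with pointwise linear
  combinations.\<close>

definition dual_space :: "'g set \<Rightarrow> ('g \<Rightarrow> 'f) set" where
  "dual_space H = {\<phi>. (\<forall>x\<in>H. \<forall>y\<in>H. \<phi> (x + y) = \<phi> x + \<phi> y) \<and>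
                      (\<forall>c. \<forall>x\<in>H. \<phi> (c *s x) = c * \<phi> x) \<and>
                      (\<forall>x. x \<notin> H \<longrightarrow> \<phi> x = 0)}"

definition root_space :: "'g set \<Rightarrow> ('g \<Rightarrow> 'f) \<Rightarrow> 'g set" where
  "root_space H \<phi> = {x. \<forall>h\<in>H. lie h x = \<phi> h *s x}"

definition roots :: "'g set \<Rightarrow> ('g \<Rightarrow> 'f) set" where
  "roots H = {\<phi> \<in> dual_space H. \<phi> \<noteq> (\<lambda>_. 0) \<and> root_space H \<phi> \<noteq> {0}}"

text \<open>The simple roots are indexed by \<open>1, \<dots>, n\<close>.\<close>

definition simple_roots :: "'g set \<Rightarrow> nat \<Rightarrow> (nat \<Rightarrow> 'g \<Rightarrow> 'f) \<Rightarrow> bool" where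
  "simple_roots H n \<alpha> \<longleftrightarrow>
     (\<forall>j\<in>{1..n}. \<alpha> j \<in> roots H) \<and>
     (\<forall>c. (\<forall>x. (\<Sum>j=1..n. c j * \<alpha> j x) = 0) \<longrightarrow> (\<forall>j\<in>{1..n}. c j = 0)) \<and>
     (\<forall>\<beta>\<in>roots H. \<exists>c :: nat \<Rightarrow> nat.
        \<beta> = (\<lambda>x. \<Sum>j=1..n. of_nat (c j) * \<alpha> j x) \<or>
        \<beta> = (\<lambda>x. - (\<Sum>j=1..n. of_nat (c j) * \<alpha> j x)))"

text \<open>The maximal root is the greatest root for the order in which \<open>\<beta> \<le> \<gamma>\<close> means that
  \<open>\<gamma> - \<beta>\<close> is a combination of simple roots with coefficients in the natural numbers.\<close>

definition maximal_root :: "'g set \<Rightarrow> nat \<Rightarrow> (nat \<Rightarrow> 'g \<Rightarrow> 'f) \<Rightarrow> ('g \<Rightarrow> 'f) \<Rightarrow> bool" where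
  "maximal_root H n \<alpha> \<theta> \<longleftrightarrow>
     \<theta> \<in> roots H \<and>
     (\<forall>\<beta>\<in>roots H. \<exists>c :: nat \<Rightarrow> nat. \<forall>x. \<theta> x - \<beta> x = (\<Sum>j=1..n. of_nat (c j) * \<alpha> j x))"

end

text \<open>The element \<open>hh i\<close> is the vector \<open>h\<^sub>i\<close> of \<open>H\<close> determined by
  \<open>\<alpha>\<^sub>j (h\<^sub>i) = \<delta>\<^sub>i\<^sub>j / k\<^sub>i\<close>.\<close>

locale simple_lie_algebra_with_roots = simple_lie_algebra scale lie
  for scale :: "'f::{alg_closed_field, field_char_0} \<Rightarrow> 'g::ab_group_add \<Rightarrow> 'g" (infixr "*s" 75)
    and lie :: "'g \<Rightarrow> 'g \<Rightarrow> 'g" +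
  fixes H :: "'g set"
    and n :: nat
    and \<alpha> :: "nat \<Rightarrow> 'g \<Rightarrow> 'f"
    and k :: "nat \<Rightarrow> nat"
    and hh :: "nat \<Rightarrow> 'g"
  assumes cartan: "cartan_subalgebra H"
    and simple: "simple_roots H n \<alpha>"
    and maximal: "maximal_root H n \<alpha> (\<lambda>x. \<Sum>j=1..n. of_nat (k j) * \<alpha> j x)"
    and hh_in: "i \<in> {1..n} \<Longrightarrow> hh i \<in> H"
    and hh_eq: "i \<in> {1..n} \<Longrightarrow> j \<in> {1..n} \<Longrightarrow>
                  \<alpha> j (hh i) = (if i = j then 1 / of_nat (k i) else 0)"


section \<open>Laurent series and truncated polynomials with coefficients in the Lie algebra\<close>

text \<open>\<open>inv_poly V\<close> is \<open>V[x\<^sup>-\<^sup>1]\<close>, and \<open>x_inv_poly V\<close> is \<open>x V[x\<^sup>-\<^sup>1]\<close>: a Laurent series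
  has only finitely many terms of negative degree. Multiplication by \<open>x\<close> to the power \<open>d\<close> is
  \<open>fls_shift (- d)\<close>.\<close>

definition inv_poly :: "'g::zero set \<Rightarrow> 'g fls set" where
  "inv_poly V = {a. (\<forall>d. fls_nth a d \<in> V) \<and> (\<forall>d>0. fls_nth a d = 0)}"

definition x_inv_poly :: "'g::zero set \<Rightarrow> 'g fls set" where
  "x_inv_poly V = fls_shift (- 1) ` inv_poly V"

text \<open>A class in \<open>\<gg>[x] / x\<^sup>m \<gg>[x]\<close> is represented by its unique member with
  no terms of degree \<open>\<ge> m\<close>; the class of a polynomial \<open>p\<close> is \<open>poly_cutoff m p\<close>.\<close>

definition trunc_poly :: "nat \<Rightarrow> 'g::zero set \<Rightarrow> 'g poly set" where
  "trunc_poly m V = poly_cutoff m ` {p. \<forall>i. coeff p i \<in> V}"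

definition fps_class :: "nat \<Rightarrow> 'g::comm_monoid_add fps \<Rightarrow> 'g poly" where
  "fps_class m f = (\<Sum>i<m. monom (fps_nth f i) i)"

lemma poly_cutoff_eq_iff:
  fixes p q :: "'g::ab_group_add poly"
  shows "poly_cutoff m p = poly_cutoff m q \<longleftrightarrow> (\<forall>i<m. coeff (p - q) i = 0)"
  by (auto simp: poly_eq_iff coeff_poly_cutoff)

lemma coeff_fps_class: "coeff (fps_class m f) i = (if i < m then fps_nth f i else 0)"
  by (simp add: fps_class_def coeff_sum)

text \<open>The rational number that \<open>c\<close> represents is rounded down; only used for rational \<open>c\<close>.\<close>

definition rat_floor :: "'f::field_char_0 \<Rightarrow> int" where
  "rat_floor c = \<lfloor>THE q::rat. of_rat q = c\<rfloor>"

lemma rat_floor_of_rat [simp]: "rat_floor (of_rat q) = \<lfloor>q\<rfloor>"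
  by (simp add: rat_floor_def)

context lie_algebra
begin

definition fls_scale :: "'f \<Rightarrow> 'g fls \<Rightarrow> 'g fls" where
  "fls_scale c a = Abs_fls (\<lambda>d. c *s fls_nth a d)"

lemma fls_scale_nth [simp]: "fls_nth (fls_scale c a) d = c *s fls_nth a d"
  unfolding fls_scale_def
  by (rule nth_Abs_fls_lower_bound[of "fls_subdegree a"]) simp

definition poly_scale :: "'f \<Rightarrow> 'g poly \<Rightarrow> 'g poly" where
  "poly_scale c p = map_poly ((*s) c) p"

lemma coeff_poly_scale [simp]: "coeff (poly_scale c p) i = c *s coeff p i"
  by (simp add: poly_scale_def coeff_map_poly)

definition fls_lie :: "'g fls \<Rightarrow> 'g fls \<Rightarrow> 'g fls" where
  "fls_lie a b =
     Abs_fls (\<lambda>d. \<Sum>i=fls_subdegree a..d - fls_subdegree b. lie (fls_nth a i) (fls_nth b (d - i)))"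

lemma fls_lie_nth:
  "fls_nth (fls_lie a b) d = (\<Sum>i=fls_subdegree a..d - fls_subdegree b. lie (fls_nth a i) (fls_nth b (d - i)))"
  unfolding fls_lie_def
  by (rule nth_Abs_fls_lower_bound[of "fls_subdegree a + fls_subdegree b"]) auto

definition poly_lie :: "'g poly \<Rightarrow> 'g poly \<Rightarrow> 'g poly" where
  "poly_lie p q = (\<Sum>i\<le>degree p. \<Sum>j\<le>degree q. monom (lie (coeff p i) (coeff q j)) (i + j))"

lemma coeff_poly_lie: "coeff (poly_lie p q) d = (\<Sum>i\<le>d. lie (coeff p i) (coeff q (d - i)))"
proof -
  have inner: "(\<Sum>j\<le>degree q. if i + j = d then lie (coeff p i) (coeff q j) else 0) =
      (if i \<le> d then lie (coeff p i) (coeff q (d - i)) else 0)" for i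
  proof (cases "i \<le> d")
    case True
    then have "(i + j = d) = (j = d - i)" for j by auto
    with True show ?thesis by (simp add: coeff_eq_0)
  qed auto
  have "coeff (poly_lie p q) d =
      (\<Sum>i\<le>degree p. if i \<le> d then lie (coeff p i) (coeff q (d - i)) else 0)"
    by (simp add: poly_lie_def coeff_sum inner)
  also have "\<dots> = (\<Sum>i\<in>{..degree p} \<inter> {..d}. lie (coeff p i) (coeff q (d - i)))"
    by (subst sum.inter_restrict) auto
  also have "\<dots> = (\<Sum>i\<le>d. lie (coeff p i) (coeff q (d - i)))"
    by (rule sum.mono_neutral_left) (auto, metis coeff_eq_0 lie_0_left not_le)
  finally show ?thesis .
qed

text \<open>The bracket of classes does not depend on the chosen members.\<close>

lemma poly_cutoff_poly_lie:
  "poly_cutoff m (poly_lie (poly_cutoff m p) (poly_cutoff m q)) = poly_cutoff m (poly_lie p q)"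
  by (auto simp: poly_eq_iff coeff_poly_cutoff coeff_poly_lie intro!: sum.cong)


section \<open>The Lie algebra of pairs and regular decompositions\<close>

definition L_space :: "nat \<Rightarrow> ('g fls \<times> 'g poly) set" where
  "L_space m = UNIV \<times> trunc_poly m UNIV"

definition L_scale :: "'f \<Rightarrow> 'g fls \<times> 'g poly \<Rightarrow> 'g fls \<times> 'g poly" where
  "L_scale c u = (fls_scale c (fst u), poly_scale c (snd u))"

definition L_lie :: "nat \<Rightarrow> 'g fls \<times> 'g poly \<Rightarrow> 'g fls \<times> 'g poly \<Rightarrow> 'g fls \<times> 'g poly" where
  "L_lie m u v = (fls_lie (fst u) (fst v), poly_cutoff m (poly_lie (snd u) (snd v)))"

sublocale L: vector_space L_scale
  by unfold_locales
    (auto simp: L_scale_def prod_eq_iff fls_eq_iff poly_eq_iff scale_right_distrib scale_left_distrib)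

text \<open>Internal direct sum of the subspaces in the list \<open>Us\<close>: each is a subspace, and the addition
  map from their product to \<open>V\<close> is a bijection.\<close>

definition direct_sum :: "('g fls \<times> 'g poly) set \<Rightarrow> ('g fls \<times> 'g poly) set list \<Rightarrow> bool" where
  "direct_sum V Us \<longleftrightarrow> (\<forall>U\<in>set Us. L.subspace U) \<and> bij_betw sum_list (listset Us) V"

definition diag :: "nat \<Rightarrow> ('g fls \<times> 'g poly) set" where
  "diag m = {(fps_to_fls f, fps_class m f) | f. True}"

end

context simple_lie_algebra_with_roots
begin

text \<open>The sum over \<open>roots H\<close> is a genuine one: \<open>\<gg>\<close> is finite-dimensional, so there are only
  finitely many roots.\<close>

definition P_space :: "nat \<Rightarrow> 'g fls set" where
  "P_space i =
     (if i = 0 then inv_poly UNIV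
      else {a + (\<Sum>\<phi>\<in>roots H. fls_shift (- rat_floor (\<phi> (hh i))) (b \<phi>)) | a b.
              a \<in> inv_poly H \<and> (\<forall>\<phi>\<in>roots H. b \<phi> \<in> inv_poly (root_space H \<phi>))})"

definition regular_decomposition :: "nat \<Rightarrow> ('g fls \<times> 'g poly) set \<Rightarrow> bool" where
  "regular_decomposition m W \<longleftrightarrow>
     W \<subseteq> L_space m \<and> L.subspace W \<and> (\<forall>u\<in>W. \<forall>v\<in>W. L_lie m u v \<in> W) \<and>
     direct_sum (L_space m) [diag m, W] \<and>
     (\<forall>h\<in>H. \<forall>w\<in>W. L_lie m (fls_const h, poly_cutoff m [:h:]) w \<in> W) \<and>
     (\<forall>(a, b)\<in>W. (fls_shift 1 a, 0) \<in> W) \<and>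
     (\<forall>(a, b)\<in>W. (0, poly_cutoff m (pCons 0 b)) \<in> W) \<and>
     (\<exists>i\<le>n. W \<subseteq> P_space i \<times> trunc_poly m UNIV)"

end

end

theory Submission
  imports Defs "HOL-Library.Disjoint_Sets"
begin

text \<open>
  Since \<open>W\<close> is stable under \<open>\<hh>\<close>, it is the sum of its weight components, so it suffices to show that
  every \<open>(a, b) \<in> W\<close> with coefficients in a root space \<open>\<gg>\<^sub>\<beta>\<close> has \<open>(a, 0) \<in> W\<close>; the part of \<open>W\<close> with
  coefficients in \<open>\<hh>\<close> only has to be cut down to a complement of its intersection with
  \<open>I\<^sub>+ \<times> I\<^sub>-\<close>. If \<open>(a, 0) \<notin> W\<close>, then comparing \<open>W\<close> with the diagonal, and using that \<open>\<gg>\<^sub>\<beta>\<close> is a line,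
  leaves few possibilities for the components of \<open>W\<close> at \<open>\<beta>\<close> and \<open>-\<beta>\<close>, as \<open>\<bar>\<beta>(h\<^sub>i)\<bar> \<le> 1\<close>. In each of
  them, bracketing \<open>(a, b)\<close> with an element at \<open>-\<beta>\<close> and again with \<open>(a, b)\<close> produces \<open>(a, 0)\<close>, or a
  nonzero element of \<open>W\<close> on the diagonal.

  This uses that \<open>\<hh>\<close> acts diagonalizably with one-dimensional root spaces. The simple roots provide
  an element \<open>sep\<close> of \<open>\<hh>\<close> at which distinct weights take distinct integral values. Hence the Killing
  form is nonzero at \<open>sep\<close>, and nondegenerate by simplicity, and the generalized root spaces are the
  generalized eigenspaces of the single operator \<open>ad sep\<close>. They are lines by a trace computation, so
  no separate argument for diagonalizability is needed.
\<close>

section \<open>Generalized eigenspaces\<close>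

text \<open>The Cartan subalgebra is only assumed nilpotent and self-normalizing, so commutativity
  has to be proved as well, and until then every argument runs through traces on invariant
  subspaces. The field has no order: a sum of squares in it may vanish, which is why integral values
  at \<open>sep\<close> matter. The vectors \<open>k i *s hh i\<close> are dual to the simple roots,
  so integral combinations of them are at hand before the roots are known to be finite in number.

  The floors \<open>F\<close> of \<beta> and \<open>F'\<close> of -\<beta> satisfy
  \<open>F \<le> 1\<close> and \<open>F + F' \<le> 0\<close>. The second entries of \<open>W\<close>
  at \<beta> have a lowest order \<open>d\<close>, and a failure to split forces
  \<open>d \<le> F\<close>. This leaves \<open>d = 0\<close> with \<open>F' < 0\<close>,
  \<open>d = F = 1\<close>, and \<open>d = F = F' = 0\<close>. On \<open>H\<close> the brackets
  vanish and the argument says nothing: there \<open>W_h\<close> may mix the two factors, and it is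
  not canonical.\<close>

locale alg_closed_vector_space = finite_dimensional_vector_space scale Basis
  for scale :: "'f::{alg_closed_field, field_char_0} \<Rightarrow> 'v::ab_group_add \<Rightarrow> 'v" (infixr "*s" 75)
    and Basis :: "'v set"
begin

abbreviation endo :: "('v \<Rightarrow> 'v) \<Rightarrow> bool" where
  "endo \<equiv> Vector_Spaces.linear scale scale"

lemma endoI:
  assumes "\<And>x y. A (x + y) = A x + A y" "\<And>c x. A (c *s x) = c *s A x"
  shows "endo A"
  unfolding Vector_Spaces.linear_iff using assms vector_space_axioms by blast

context
  fixes A assumes A: "endo A"
begin

interpretation A: Vector_Spaces.linear scale scale A by (rule A)

lemma endo_zero: "A 0 = 0" by (rule A.zero)
lemma endo_add: "A (x + y) = A x + A y" by (rule A.add)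
lemma endo_scale: "A (c *s x) = c *s A x" by (rule A.scale)
lemma endo_diff: "A (x - y) = A x - A y" by (rule A.diff)
lemma endo_sum: "A (sum f S) = (\<Sum>i\<in>S. A (f i))" by (rule A.sum)

lemma endo_diff_scale: "endo (\<lambda>x. A x - c *s x)"
  by (rule endoI) (simp_all add: A.add A.scale algebra_simps)

lemma endo_funpow: "endo (A ^^ n)"
proof (induction n)
  case (Suc n)
  interpret An: Vector_Spaces.linear scale scale "A ^^ n" by (rule Suc)
  show ?case by (rule endoI) (simp_all add: An.add An.scale A.add A.scale)
qed (simp add: id_def linear_ident)

lemma endo_span_mono:
  assumes "\<And>x. x \<in> S \<Longrightarrow> A x \<in> T" "subspace T" "x \<in> span S"
  shows "A x \<in> T"
  using assms(3)
proof (induction rule: span_induct_alt)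
  case base
  then show ?case using assms(2) by (simp add: endo_zero subspace_0)
next
  case (step c x y)
  then show ?case using assms by (simp add: endo_add endo_scale subspace_add subspace_scale)
qed

end

lemma endo_comp: "endo A \<Longrightarrow> endo C \<Longrightarrow> endo (\<lambda>x. A (C x))"
  by (rule endoI) (simp_all add: endo_add endo_scale)

lemma funpow_in: "(\<And>x. x \<in> U \<Longrightarrow> A x \<in> U) \<Longrightarrow> x \<in> U \<Longrightarrow> (A ^^ n) x \<in> U"
  by (induction n) auto

definition gen_eigenspace :: "('v \<Rightarrow> 'v) \<Rightarrow> 'f \<Rightarrow> 'v set" where
  "gen_eigenspace A c = {x. \<exists>N. ((\<lambda>y. A y - c *s y) ^^ N) x = 0}"

lemma gen_eigenspaceI: "((\<lambda>y. A y - c *s y) ^^ N) x = 0 \<Longrightarrow> x \<in> gen_eigenspace A c"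
  by (auto simp: gen_eigenspace_def)

lemma eigenvector_in_gen_eigenspace: "A x = c *s x \<Longrightarrow> x \<in> gen_eigenspace A c"
  by (rule gen_eigenspaceI[where N = 1]) simp

text \<open>The exponent is existentially quantified, so one more factor A - c costs nothing.
  Several proofs below conclude membership from it after one application of A - c.\<close>

lemma gen_eigenspace_step_iff: "A x - c *s x \<in> gen_eigenspace A c \<longleftrightarrow> x \<in> gen_eigenspace A c"
  if "endo A"
proof
  assume "A x - c *s x \<in> gen_eigenspace A c"
  then obtain N where "((\<lambda>y. A y - c *s y) ^^ N) (A x - c *s x) = 0"
    by (auto simp: gen_eigenspace_def)
  then show "x \<in> gen_eigenspace A c"
    by (intro gen_eigenspaceI[where N = "Suc N"]) (simp add: funpow_Suc_right del: funpow.simps)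
next
  assume "x \<in> gen_eigenspace A c"
  then obtain N where N: "((\<lambda>y. A y - c *s y) ^^ N) x = 0"
    by (auto simp: gen_eigenspace_def)
  have "((\<lambda>y. A y - c *s y) ^^ N) (A x - c *s x) = 0"
    unfolding funpow_swap1[of "\<lambda>y. A y - c *s y", symmetric] N
    by (rule endo_zero[OF endo_diff_scale[OF that]])
  then show "A x - c *s x \<in> gen_eigenspace A c" by (rule gen_eigenspaceI)
qed

lemma subspace_gen_eigenspace:
  assumes "endo A"
  shows "subspace (gen_eigenspace A c)"
proof (rule subspaceI)
  let ?B = "\<lambda>y. A y - c *s y"
  note B = endo_diff_scale[OF assms, of c]
  have up: "(?B ^^ (N + M)) x = 0" if "(?B ^^ N) x = 0" for N M x
    using that endo_zero[OF endo_funpow[OF B]] by (simp add: funpow_add add.commute[of N])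
  show "0 \<in> gen_eigenspace A c" by (rule gen_eigenspaceI[where N = 0]) simp
  fix x y assume "x \<in> gen_eigenspace A c" "y \<in> gen_eigenspace A c"
  then obtain N M where "(?B ^^ N) x = 0" "(?B ^^ M) y = 0" by (auto simp: gen_eigenspace_def)
  then have "(?B ^^ (N + M)) (x + y) = 0"
    using up[of N x M] up[of M y N] by (simp add: endo_add[OF endo_funpow[OF B]] add.commute)
  then show "x + y \<in> gen_eigenspace A c" by (rule gen_eigenspaceI)
next
  fix d x assume "x \<in> gen_eigenspace A c"
  then show "d *s x \<in> gen_eigenspace A c"
    by (auto simp: gen_eigenspace_def endo_scale[OF endo_funpow[OF endo_diff_scale[OF assms]]])
qed

lemma gen_eigenspace_commuting:
  assumes "endo A" "endo C" "\<And>x. A (C x) = C (A x)" "x \<in> gen_eigenspace A c"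
  shows "C x \<in> gen_eigenspace A c"
proof -
  let ?B = "\<lambda>y. A y - c *s y"
  have "(?B ^^ N) (C x) = C ((?B ^^ N) x)" for N
    by (induction N) (simp_all add: assms endo_diff endo_scale)
  moreover from assms(4) obtain N where "(?B ^^ N) x = 0" by (auto simp: gen_eigenspace_def)
  ultimately have "(?B ^^ N) (C x) = 0" using endo_zero[OF assms(2)] by simp
  then show ?thesis by (rule gen_eigenspaceI)
qed

lemma gen_eigenspace_invariant: "endo A \<Longrightarrow> x \<in> gen_eigenspace A c \<Longrightarrow> A x \<in> gen_eigenspace A c"
  by (rule gen_eigenspace_commuting) auto

lemma gen_eigenspace_inj:
  assumes "endo A" "c \<noteq> d" "x \<in> gen_eigenspace A c" "A x = d *s x"
  shows "x = 0"
proof -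
  from assms(3) obtain N where N: "((\<lambda>y. A y - c *s y) ^^ N) x = 0" by (auto simp: gen_eigenspace_def)
  have "((\<lambda>y. A y - c *s y) ^^ N) x = (d - c) ^ N *s x"
  proof (induction N)
    case (Suc N)
    then show ?case
      by (simp add: endo_scale[OF assms(1)] assms(4)) (simp add: algebra_simps)
  qed simp
  with N assms(2) show ?thesis by simp
qed

text \<open>On the generalized eigenspace at c, A - d is a nilpotent operator plus the nonzero
  scalar c - d, hence invertible. The preimage is found inside \<open>U\<close>, as the
  decomposition below is relative to an invariant subspace.\<close>

lemma gen_eigenspace_surj:
  assumes A: "endo A" and "c \<noteq> d" and U: "subspace U" "\<And>x. x \<in> U \<Longrightarrow> A x \<in> U"
    and "w \<in> gen_eigenspace A c \<inter> U"
  obtains u where "u \<in> gen_eigenspace A c \<inter> U" "A u - d *s u = w"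
proof -
  let ?B = "\<lambda>y. A y - c *s y"
  have "\<exists>u. u \<in> gen_eigenspace A c \<inter> U \<and> A u - d *s u = w" if "(?B ^^ N) w = 0" "w \<in> gen_eigenspace A c \<inter> U"
    for N using that
  proof (induction N arbitrary: w)
    case 0
    then show ?case by (intro exI[of _ 0]) (simp add: endo_zero[OF A] subspace_0 U)
  next
    case (Suc N)
    have "?B w \<in> gen_eigenspace A c \<inter> U"
      using Suc.prems(2) U by (simp add: gen_eigenspace_step_iff[OF A] subspace_diff subspace_scale)
    then obtain u' where u': "u' \<in> gen_eigenspace A c \<inter> U" "A u' - d *s u' = ?B w"
      using Suc.IH[of "?B w"] Suc.prems by (auto simp: funpow_Suc_right simp del: funpow.simps)
    \<comment> \<open>(A - d) w is \<open>?B w + (c - d) *s w\<close> and (A - d) u' is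
      \<open>?B w\<close>, so the difference is a multiple of w.\<close>
    define u where "u = (1 / (c - d)) *s (w - u')"
    have "A u - d *s u = (1 / (c - d)) *s ((A w - d *s w) - (A u' - d *s u'))"
      by (simp add: u_def endo_scale[OF A] endo_diff[OF A] algebra_simps)
    also have "\<dots> = (1 / (c - d)) *s ((c - d) *s w)"
      unfolding u' by (simp add: algebra_simps)
    also have "\<dots> = w" using \<open>c \<noteq> d\<close> by simp
    finally have "A u - d *s u = w" .
    moreover have "u \<in> gen_eigenspace A c \<inter> U"
      using u' Suc.prems(2) subspace_gen_eigenspace[OF A, of c] U
      by (simp add: u_def subspace_diff subspace_scale)
    ultimately show ?case by blast
  qed
  then show ?thesis using assms(5) that by (auto simp: gen_eigenspace_def)
qed

text \<open>By induction (A - d) x vanishes, so x is a genuine eigenvector for d inside the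
  generalized eigenspace at c, and \<open>gen_eigenspace_inj\<close> applies.\<close>

lemma gen_eigenspace_Int:
  assumes A: "endo A" and "c \<noteq> d" and "x \<in> gen_eigenspace A c" "x \<in> gen_eigenspace A d"
  shows "x = 0"
proof -
  let ?B = "\<lambda>y. A y - d *s y"
  from assms(4) obtain N where "(?B ^^ N) x = 0" by (auto simp: gen_eigenspace_def)
  then show ?thesis using assms(3)
  proof (induction N arbitrary: x)
    case (Suc N)
    have "?B x \<in> gen_eigenspace A c"
      using Suc.prems(2) subspace_gen_eigenspace[OF A]
      by (simp add: gen_eigenspace_invariant[OF A] subspace_diff subspace_scale)
    moreover have "(?B ^^ N) (?B x) = 0" using Suc.prems(1) by (simp only: funpow_Suc_right o_apply)
    ultimately have "?B x = 0" using Suc.IH by blast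
    then show ?case using gen_eigenspace_inj[OF A \<open>c \<noteq> d\<close> Suc.prems(2)] by simp
  qed simp
qed

text \<open>The power of A - d that kills the summand at d preserves the other generalized
  eigenspaces and, by \<open>gen_eigenspace_Int\<close>, is injective on each of them.\<close>

lemma gen_eigenspace_independent:
  assumes A: "endo A" and "finite S" "\<And>c. c \<in> S \<Longrightarrow> x c \<in> gen_eigenspace A c" "(\<Sum>c\<in>S. x c) = 0" "c \<in> S"
  shows "x c = 0"
  using assms(2-5)
proof (induction S arbitrary: x c rule: finite_induct)
  case (insert d S)
  let ?B = "\<lambda>y. A y - d *s y"
  note B = endo_funpow[OF endo_diff_scale[OF A, of d]]
  from insert.prems(1)[of d] obtain N where N: "(?B ^^ N) (x d) = 0" by (auto simp: gen_eigenspace_def)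
  have "(\<Sum>c\<in>S. (?B ^^ N) (x c)) = (?B ^^ N) (\<Sum>c\<in>insert d S. x c)"
    using N insert.hyps by (simp add: endo_add[OF B] endo_sum[OF B])
  also have "\<dots> = 0" using insert.prems by (simp add: endo_zero[OF B])
  finally have sum0: "(\<Sum>c\<in>S. (?B ^^ N) (x c)) = 0" .
  have "?B y \<in> gen_eigenspace A c" if "y \<in> gen_eigenspace A c" for y c
    using that subspace_gen_eigenspace[OF A, of c]
    by (intro subspace_diff subspace_scale) (auto simp: gen_eigenspace_invariant[OF A])
  then have "(?B ^^ N) (x c) \<in> gen_eigenspace A c" if "c \<in> S" for c
    using that insert.prems(1)[of c] funpow_in[of "gen_eigenspace A c" ?B] by blast
  from insert.IH[OF this sum0] have "(?B ^^ N) (x c) = 0" if "c \<in> S" for c using that by simp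
  then have S0: "x c = 0" if "c \<in> S" for c
    using gen_eigenspace_Int[OF A, of c d "x c"] insert that
    by (metis gen_eigenspaceI insertI2)
  with insert have "x d = 0" by simp
  with S0 insert.prems show ?case by auto
qed simp

text \<open>A^2 - c^2 = (A + c)(A - c), and A + c preserves the generalized eigenspaces of A^2. This
  is what gives the trace of the square of ad \<open>sep\<close>.\<close>

lemma gen_eigenspace_square:
  assumes A: "endo A" and x: "x \<in> gen_eigenspace A c"
  shows "x \<in> gen_eigenspace (\<lambda>y. A (A y)) (c * c)"
proof -
  note A2 = endo_comp[OF A A]
  note sub = subspace_gen_eigenspace[OF A2, of "c * c"]
  from x obtain N where "((\<lambda>y. A y - c *s y) ^^ N) x = 0" by (auto simp: gen_eigenspace_def)
  then show ?thesis
  proof (induction N arbitrary: x)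
    case 0
    then show ?case using subspace_0[OF sub] by simp
  next
    case (Suc N)
    let ?y = "A x - c *s x"
    have y: "?y \<in> gen_eigenspace (\<lambda>y. A (A y)) (c * c)"
      using Suc by (simp add: funpow_Suc_right del: funpow.simps)
    then have "A ?y + c *s ?y \<in> gen_eigenspace (\<lambda>y. A (A y)) (c * c)"
      by (intro subspace_add[OF sub] subspace_scale[OF sub] gen_eigenspace_commuting[OF A2 A]) auto
    also have "A ?y + c *s ?y = A (A x) - (c * c) *s x"
      by (simp add: endo_diff[OF A] endo_scale[OF A] algebra_simps)
    finally show ?case using gen_eigenspace_step_iff[OF A2] by blast
  qed
qed

section \<open>Eigenvectors on quotients and the generalized eigenspace decomposition\<close>

lemma iterate_dependent:
  obtains n c where "(A ^^ n) v = (\<Sum>i<n. c i *s (A ^^ i) v)"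
proof -
  \<comment> \<open>Iterates that are always new would give independent families of every length.
    The relation found is monic, so the polynomial built from it in \<open>endo_induct\<close> is
    nonzero.\<close>
  have "\<exists>n. (A ^^ n) v \<in> span ((\<lambda>i. (A ^^ i) v) ` {..<n})"
  proof (rule ccontr)
    assume "\<not> ?thesis"
    then have new: "(A ^^ n) v \<notin> span ((\<lambda>i. (A ^^ i) v) ` {..<n})" for n by blast
    have "independent ((\<lambda>i. (A ^^ i) v) ` {..<n}) \<and> card ((\<lambda>i. (A ^^ i) v) ` {..<n}) = n" for n
    proof (induction n)
      case (Suc n)
      have "(A ^^ n) v \<notin> (\<lambda>i. (A ^^ i) v) ` {..<n}"
        using new[of n] by (metis span_base)
      then show ?case
        unfolding lessThan_Suc image_insert using Suc new[of n]
        by (metis card_insert_disjoint finite_imageI finite_lessThan independent_insertI)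
    qed (simp add: independent_empty)
    from this[of "Suc dimension"] show False
      using independent_card_le_dim[OF subset_UNIV] by (metis Suc_n_not_le_n dimension_def dim_UNIV)
  qed
  then obtain n where n: "(A ^^ n) v \<in> span ((\<lambda>i. (A ^^ i) v) ` {..<n})" ..
  have "\<exists>c. x = (\<Sum>i<n. c i *s f i)" if "x \<in> span (f ` {..<n})" for x and f :: "nat \<Rightarrow> 'v"
    using that
  proof (induction rule: span_induct_alt)
    case base
    show ?case by (rule exI[of _ "\<lambda>_. 0"]) simp
  next
    case (step a x y)
    then obtain c j where c: "y = (\<Sum>i<n. c i *s f i)" and j: "j < n" "x = f j" by auto
    have "(\<Sum>i<n. (c i + (if i = j then a else 0)) *s f i) = (\<Sum>i<n. c i *s f i) + (\<Sum>i<n. if i = j then a *s f i else 0)"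
      unfolding sum.distrib[symmetric] by (rule sum.cong) (auto simp: scale_left_distrib)
    also have "\<dots> = a *s x + y"
      using j c by simp
    finally show ?case by (intro exI) (rule sym)
  qed
  with n that show ?thesis by blast
qed

text \<open>An operator satisfies a polynomial that is a product of linear factors; peeling off these
  factors one at a time is the following induction principle.\<close>

lemma endo_induct:
  assumes A: "endo A" and "Q 0" and step: "\<And>a x. Q (A x - a *s x) \<Longrightarrow> Q x"
  shows "Q v"
proof -
  \<comment> \<open>\<open>ev p v\<close> is p(A) v. The linear factor is peeled off next to v,
    because the induction step passes from (A - a) v to v.\<close>
  define ev where "ev p v = (\<Sum>i\<le>degree p. coeff p i *s (A ^^ i) v)" for p v
  have ev_bound: "ev p v = (\<Sum>i\<le>N. coeff p i *s (A ^^ i) v)" if "degree p \<le> N" for p v N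
    unfolding ev_def by (rule sum.mono_neutral_left) (use that in \<open>auto simp: coeff_eq_0\<close>)
  have factor: "ev ([:-a, 1:] * q) v = ev q (A v - a *s v)" for a q v
  proof -
    let ?N = "Suc (degree q)"
    have d: "degree ([:-a, 1:] * q) \<le> ?N"
      using degree_mult_le[of "[:-a, 1:]" q] by simp
    have eq: "[:-a, 1:] * q = pCons 0 q - smult a q" by simp
    have "ev ([:-a, 1:] * q) v = (\<Sum>i\<le>?N. coeff (pCons 0 q) i *s (A ^^ i) v) - (\<Sum>i\<le>?N. coeff (smult a q) i *s (A ^^ i) v)"
      using ev_bound[OF d, of v] unfolding eq by (simp only: coeff_diff scale_left_diff_distrib sum_subtractf)
    also have "(\<Sum>i\<le>?N. coeff (pCons 0 q) i *s (A ^^ i) v) = (\<Sum>i\<le>degree q. coeff q i *s (A ^^ Suc i) v)"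
      by (simp only: sum.atMost_Suc_shift coeff_pCons_0 coeff_pCons_Suc) simp
    also have "(\<Sum>i\<le>?N. coeff (smult a q) i *s (A ^^ i) v) = (\<Sum>i\<le>degree q. coeff q i *s (a *s (A ^^ i) v))"
      by (simp add: coeff_eq_0 mult.commute)
    also have "(\<Sum>i\<le>degree q. coeff q i *s (A ^^ Suc i) v) - \<dots> = ev q (A v - a *s v)"
      unfolding ev_def sum_subtractf[symmetric]
      by (rule sum.cong) (simp_all add: endo_diff[OF endo_funpow[OF A]] endo_scale[OF endo_funpow[OF A]]
          funpow_swap1 scale_right_diff_distrib)
    finally show ?thesis .
  qed
  have main: "Q v" if "p \<noteq> 0" "ev p v = 0" for p v using that
  proof (induction "degree p" arbitrary: p v)
    case 0
    then obtain c where "p = [:c:]" "c \<noteq> 0" by (metis degree_eq_zeroE pCons_0_0)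
    with 0 have "v = 0" by (simp add: ev_def)
    with \<open>Q 0\<close> show ?case by simp
  next
    case (Suc n)
    then obtain a where "poly p a = 0" using alg_closed_imp_poly_has_root[of p] by auto
    then obtain q where q: "p = [:-a, 1:] * q" by (auto simp: poly_eq_0_iff_dvd)
    with Suc have "q \<noteq> 0" by auto
    then have "degree p = Suc (degree q)" unfolding q by (subst degree_mult_eq) auto
    then have "Q (A v - a *s v)"
      using Suc.hyps Suc.prems \<open>q \<noteq> 0\<close> unfolding q factor by (metis nat.inject)
    then show ?case by (rule step)
  qed
  obtain n c where nc: "(A ^^ n) v = (\<Sum>i<n. c i *s (A ^^ i) v)" by (rule iterate_dependent)
  define p where "p = monom 1 n - (\<Sum>i<n. monom (c i) i)"
  have cp: "coeff p i = (if i < n then - c i else if i = n then 1 else 0)" for i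
    by (simp add: p_def coeff_sum)
  have "p \<noteq> 0" using cp[of n] by auto
  moreover have "degree p \<le> n" by (rule degree_le) (simp add: cp)
  then have "ev p v = (\<Sum>i\<le>n. coeff p i *s (A ^^ i) v)" by (rule ev_bound)
  then have "ev p v = 0"
    by (simp add: lessThan_Suc_atMost[symmetric] cp nc sum_negf)
  ultimately show ?thesis by (rule main)
qed

text \<open>Representatives take the place of cosets. If no such x existed,
  \<open>endo_induct\<close> would prove \<open>x \<in> U \<longrightarrow> x \<in> U'\<close> for
  every x.\<close>

lemma quotient_eigenvector:
  assumes "endo A" "subspace U" "subspace U'" "\<And>x. x \<in> U \<Longrightarrow> A x \<in> U" "\<not> U \<subseteq> U'"
  obtains x c where "x \<in> U" "x \<notin> U'" "A x - c *s x \<in> U'"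
proof (rule ccontr)
  assume no: "\<not> thesis"
  have "x \<in> U \<longrightarrow> x \<in> U'" for x
  proof (rule endo_induct[OF assms(1)])
    show "0 \<in> U \<longrightarrow> 0 \<in> U'" using assms by (simp add: subspace_0)
    fix a x assume "A x - a *s x \<in> U \<longrightarrow> A x - a *s x \<in> U'"
    moreover have "A x - a *s x \<in> U" if "x \<in> U" using that assms by (simp add: subspace_diff subspace_scale)
    ultimately show "x \<in> U \<longrightarrow> x \<in> U'" using no that by blast
  qed
  with assms(5) show False by blast
qed

text \<open>By \<open>endo_induct\<close> it is enough to lift membership in the sum S from (A - a)
  x to x. Each summand at c \<noteq> a lies in the image of A - a, so (A - a) x = (A - a) u + g with
  u in S and g in the summand at a; then x - u lies in that summand too.\<close>

lemma gen_eigenspace_decomposition: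
  assumes A: "endo A" and U: "subspace U" "\<And>x. x \<in> U \<Longrightarrow> A x \<in> U" and "v \<in> U"
  shows "v \<in> span (\<Union>c. gen_eigenspace A c \<inter> U)"
proof -
  define S where "S = span (\<Union>c. gen_eigenspace A c \<inter> U)"
  have S: "subspace S" by (simp add: S_def)
  have SU: "S \<subseteq> U" unfolding S_def by (rule span_minimal) (use U in auto)
  have solve: "\<exists>u\<in>S. \<exists>g\<in>gen_eigenspace A a \<inter> U. A u - a *s u = w - g" if "w \<in> S" for w a
    using that unfolding S_def
  proof (induction rule: span_induct_alt)
    case base
    show ?case using A U subspace_gen_eigenspace[OF A]
      by (intro bexI[of _ 0]) (auto simp: endo_zero span_zero subspace_0)
  next
    case (step k x y)
    then obtain u g where ug: "u \<in> S" "g \<in> gen_eigenspace A a \<inter> U" "A u - a *s u = y - g"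
      by (auto simp: S_def)
    from step obtain c where x: "x \<in> gen_eigenspace A c \<inter> U" by blast
    have "\<exists>u\<in>S. \<exists>g\<in>gen_eigenspace A a \<inter> U. A u - a *s u = x - g"
    proof (cases "c = a")
      case True
      then show ?thesis using x S A by (intro bexI[of _ 0] bexI[of _ x]) (auto simp: endo_zero subspace_0)
    next
      case False
      from gen_eigenspace_surj[OF A this U x]
      obtain u where "u \<in> gen_eigenspace A c \<inter> U" "A u - a *s u = x" by blast
      then show ?thesis using U subspace_gen_eigenspace[OF A]
        by (intro bexI[of _ u] bexI[of _ 0]) (auto simp: S_def subspace_0 intro!: span_base)
    qed
    then obtain u' g' where "u' \<in> S" "g' \<in> gen_eigenspace A a \<inter> U" "A u' - a *s u' = x - g'" by blast
    then have x: "u' \<in> S" "g' \<in> gen_eigenspace A a \<inter> U" "A u' - a *s u' = x - g'" .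
    have "k *s u' + u \<in> S" "k *s g' + g \<in> gen_eigenspace A a \<inter> U"
      using ug x S U subspace_gen_eigenspace[OF A, of a] by (simp_all add: subspace_add subspace_scale)
    moreover have "A (k *s u' + u) - a *s (k *s u' + u) = k *s (A u' - a *s u') + (A u - a *s u)"
      by (simp add: endo_add[OF A] endo_scale[OF A] algebra_simps)
    then have "A (k *s u' + u) - a *s (k *s u' + u) = (k *s x + y) - (k *s g' + g)"
      unfolding ug x by (simp add: algebra_simps)
    ultimately have "\<exists>u\<in>S. \<exists>g\<in>gen_eigenspace A a \<inter> U. A u - a *s u = k *s x + y - g" by blast
    then show ?case unfolding S_def[symmetric] by blast
  qed
  have "v \<in> U \<longrightarrow> v \<in> S" for v
  proof (rule endo_induct[OF A])
    show "0 \<in> U \<longrightarrow> 0 \<in> S" using S by (simp add: subspace_0)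
    fix a x assume IH: "A x - a *s x \<in> U \<longrightarrow> A x - a *s x \<in> S"
    show "x \<in> U \<longrightarrow> x \<in> S"
    proof
      assume "x \<in> U"
      with IH U have "A x - a *s x \<in> S" by (simp add: subspace_diff subspace_scale)
      from solve[OF this, of a] obtain u g where
        ug: "u \<in> S" "g \<in> gen_eigenspace A a \<inter> U" "A u - a *s u = A x - a *s x - g" by blast
      then have "A (x - u) - a *s (x - u) = g"
        by (simp add: endo_diff[OF A] algebra_simps)
      with ug have "x - u \<in> gen_eigenspace A a" using gen_eigenspace_step_iff[OF A] by force
      moreover have "x - u \<in> U" using \<open>x \<in> U\<close> ug SU U by (auto intro: subspace_diff)
      ultimately have "x - u \<in> S" unfolding S_def by (auto intro: span_base)
      with ug S have "(x - u) + u \<in> S" by (blast intro: subspace_add)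
      then show "x \<in> S" by simp
    qed
  qed
  with \<open>v \<in> U\<close> show ?thesis unfolding S_def by blast
qed

end

section \<open>Traces\<close>

context alg_closed_vector_space
begin

text \<open>Modulo U the operator (A - c)^N acts on x as (d - c)^N, yet it kills x for large
  N.\<close>

lemma gen_eigenspace_mod:
  assumes A: "endo A" and U: "subspace U" "\<And>x. x \<in> U \<Longrightarrow> A x \<in> U"
    and x: "x \<in> gen_eigenspace A c" "x \<notin> U" "A x - d *s x \<in> U"
  shows "d = c"
proof (rule ccontr)
  assume "d \<noteq> c"
  let ?B = "\<lambda>y. A y - c *s y"
  have BU: "?B y \<in> U" if "y \<in> U" for y using that U by (simp add: subspace_diff subspace_scale)
  have "(?B ^^ N) x - (d - c) ^ N *s x \<in> U" for N
  proof (induction N)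
    case 0
    show ?case using U by (simp add: subspace_0)
  next
    case (Suc N)
    let ?y = "(?B ^^ N) x" and ?e = "(d - c) ^ N"
    have "?B (?y - ?e *s x) + ?e *s (A x - d *s x) \<in> U"
      using U x(3) by (intro subspace_add[OF U(1)] BU Suc subspace_scale)
    also have "?B (?y - ?e *s x) + ?e *s (A x - d *s x) = ?B ?y - ((d - c) * ?e) *s x"
      by (simp add: endo_diff[OF A] endo_scale[OF A] algebra_simps)
    finally show ?case by simp
  qed
  moreover obtain N where "(?B ^^ N) x = 0" using x by (auto simp: gen_eigenspace_def)
  ultimately have "- ((d - c) ^ N *s x) \<in> U" by (metis diff_0)
  then have "(d - c) ^ N *s x \<in> U" using subspace_neg[OF U(1)] by fastforce
  then have "(1 / (d - c) ^ N) *s (d - c) ^ N *s x \<in> U" by (rule subspace_scale[OF U(1)])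
  with \<open>d \<noteq> c\<close> x(2) show False by simp
qed

text \<open>The basis is an argument because traces on many subspaces are compared: if
  \<open>B\<close> is independent and \<open>A\<close> preserves its span, this is the trace of the
  restriction.\<close>

definition trace :: "'v set \<Rightarrow> ('v \<Rightarrow> 'v) \<Rightarrow> 'f" where
  "trace B A = (\<Sum>b\<in>B. representation B (A b) b)"

text \<open>Both sides are the same double sum of matrix entries. Two bases are allowed so that one
  statement serves twice: with \<open>C\<close> the identity it is independence of the basis, with
  equal bases it is the cyclic property.\<close>

lemma trace_cyclic:
  assumes B: "independent B" "independent B'" and A: "endo A" "endo C"
    and AB: "\<And>b. b \<in> B \<Longrightarrow> A b \<in> span B'" and CB: "\<And>b. b \<in> B' \<Longrightarrow> C b \<in> span B"
  shows "(\<Sum>b\<in>B. representation B (C (A b)) b) = (\<Sum>b\<in>B'. representation B' (A (C b)) b)"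
proof -
  have expand: "representation B (C (A b)) b = (\<Sum>c\<in>B'. representation B' (A b) c * representation B (C c) b)"
    if B: "independent B" "independent B'" and A: "endo A" "endo C"
      and AB: "A b \<in> span B'" and CB: "\<And>b. b \<in> B' \<Longrightarrow> C b \<in> span B"
    for B B' A C b
  proof -
    have "A b = (\<Sum>c\<in>B'. representation B' (A b) c *s c)"
      using sum_representation_eq[OF B(2) AB finiteI_independent[OF B(2)]] by simp
    then have "C (A b) = (\<Sum>c\<in>B'. representation B' (A b) c *s C c)"
      by (metis (no_types, lifting) endo_sum[OF A(2)] endo_scale[OF A(2)] sum.cong)
    then show ?thesis
      by (simp add: representation_sum[OF B(1)] representation_scale[OF B(1)] span_scale CB)
  qed
  have "(\<Sum>b\<in>B. representation B (C (A b)) b) =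
      (\<Sum>b\<in>B. \<Sum>c\<in>B'. representation B' (A b) c * representation B (C c) b)"
    by (rule sum.cong[OF refl expand[OF B A AB CB]])
  also have "\<dots> = (\<Sum>c\<in>B'. \<Sum>b\<in>B. representation B (C c) b * representation B' (A b) c)"
    by (subst sum.swap) (simp add: mult.commute)
  also have "\<dots> = (\<Sum>b\<in>B'. representation B' (A (C b)) b)"
    by (rule sum.cong[OF refl expand[OF B(2,1) A(2,1) CB AB, symmetric]])
  finally show ?thesis .
qed

lemma trace_change_basis:
  assumes "independent B" "independent B'" "span B = span B'" "endo A" "\<And>b. b \<in> B \<Longrightarrow> A b \<in> span B"
  shows "trace B A = trace B' A"
  using trace_cyclic[OF assms(1,2,4) linear_ident] assms
  by (simp add: trace_def) (metis span_base)

lemma trace_commute: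
  assumes "independent B" "endo A" "endo C"
    and "\<And>b. b \<in> B \<Longrightarrow> A b \<in> span B" "\<And>b. b \<in> B \<Longrightarrow> C b \<in> span B"
  shows "trace B (\<lambda>x. A (C x)) = trace B (\<lambda>x. C (A x))"
  unfolding trace_def by (rule trace_cyclic[OF assms(1,1,3,2,5,4)])

lemma trace_add:
  assumes "independent B" "\<And>b. b \<in> B \<Longrightarrow> A b \<in> span B" "\<And>b. b \<in> B \<Longrightarrow> C b \<in> span B"
  shows "trace B (\<lambda>x. A x + C x) = trace B A + trace B C"
  unfolding trace_def sum.distrib[symmetric]
  by (rule sum.cong) (simp_all add: representation_add assms)

lemma trace_diff:
  assumes "independent B" "\<And>b. b \<in> B \<Longrightarrow> A b \<in> span B" "\<And>b. b \<in> B \<Longrightarrow> C b \<in> span B"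
  shows "trace B (\<lambda>x. A x - C x) = trace B A - trace B C"
  unfolding trace_def sum_subtractf[symmetric]
  by (rule sum.cong) (simp_all add: representation_diff assms)

lemma trace_scale:
  assumes "independent B" "\<And>b. b \<in> B \<Longrightarrow> A b \<in> span B"
  shows "trace B (\<lambda>x. c *s A x) = c * trace B A"
  unfolding trace_def sum_distrib_left
  by (rule sum.cong) (simp_all add: representation_scale assms)

lemma trace_commutator:
  assumes "independent B" "endo A" "endo C"
    and "\<And>b. b \<in> B \<Longrightarrow> A b \<in> span B" "\<And>b. b \<in> B \<Longrightarrow> C b \<in> span B"
  shows "trace B (\<lambda>x. A (C x) - C (A x)) = 0"
proof -
  have "A (C b) \<in> span B" "C (A b) \<in> span B" if "b \<in> B" for b
    using endo_span_mono[OF assms(2) assms(4)] endo_span_mono[OF assms(3) assms(5)]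
      assms(4,5) that by blast+
  then show ?thesis using assms by (simp add: trace_diff trace_commute)
qed

text \<open>\<open>A\<close> is block triangular for \<open>B\<close> and \<open>C - B\<close>, and
  its block on the quotient is the scalar \<open>d\<close>.\<close>

lemma trace_extend:
  assumes C: "independent C" "B \<subseteq> C" and B: "\<And>b. b \<in> B \<Longrightarrow> A b \<in> span B"
    and d: "\<And>b. b \<in> C - B \<Longrightarrow> A b - d *s b \<in> span B"
  shows "trace C A = trace B A + d * of_nat (card (C - B))"
proof -
  have "representation C (A b) b = representation B (A b) b" if "b \<in> B" for b
    by (simp add: representation_extend[OF C(1) B[OF that] C(2)])
  moreover have "representation C (A b) b = d" if b: "b \<in> C - B" for b
  proof -
    have sub: "span B \<subseteq> span C" by (rule span_mono[OF C(2)])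
    have "representation C (A b) b = representation C ((A b - d *s b) + d *s b) b" by simp
    also have "\<dots> = representation C (A b - d *s b) b + representation C (d *s b) b"
      using b d[OF b] sub C by (subst representation_add) (auto intro: span_scale span_base)
    also have "representation C (A b - d *s b) b = 0"
      using b by (subst representation_extend[OF C(1) d[OF b] C(2)]) (auto dest: representation_ne_zero)
    also have "representation C (d *s b) b = d"
      using b C by (simp add: representation_scale span_base representation_basis)
    finally show ?thesis by simp
  qed
  ultimately show ?thesis
    unfolding trace_def using finiteI_independent[OF C(1)]
    by (simp add: sum.subset_diff[OF C(2), of "\<lambda>b. representation C (A b) b"])
qed

text \<open>A largest invariant subspace satisfying the formula is everything: otherwise an
  eigenvector on the quotient enlarges it, and by \<open>gen_eigenspace_mod\<close> its eigenvalue
  is again c.\<close>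

lemma trace_gen_eigenspace:
  assumes B: "independent B" and A: "endo A" and AB: "\<And>b. b \<in> B \<Longrightarrow> A b \<in> span B"
    and c: "B \<subseteq> gen_eigenspace A c"
  shows "trace B A = c * of_nat (card B)"
proof -
  define P where "P C \<longleftrightarrow> independent C \<and> C \<subseteq> span B \<and> (\<forall>b\<in>C. A b \<in> span C) \<and> trace C A = c * of_nat (card C)" for C
  have inv: "A x \<in> span C" if "\<forall>b\<in>C. A b \<in> span C" "x \<in> span C" for x C
    using that endo_span_mono[OF A, of C "span C" x] by auto
  have "P {}" by (simp add: P_def trace_def independent_empty)
  moreover have "\<forall>C. P C \<longrightarrow> card C \<le> dim (span B)"
    by (auto simp: P_def intro!: independent_card_le_dim simp del: dim_span)
  ultimately obtain C where C: "P C" and max: "\<And>D. P D \<Longrightarrow> card D \<le> card C"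
    using ex_has_greatest_nat[of P "{}" card "Suc (dim (span B))"] by (metis le_imp_less_Suc)
  have "span B \<subseteq> span C"
  proof (rule ccontr)
    assume "\<not> ?thesis"
    then obtain x d where x: "x \<in> span B" "x \<notin> span C" "A x - d *s x \<in> span C"
      using quotient_eigenvector[OF A, of "span B" "span C"] inv AB by auto
    have "span B \<subseteq> gen_eigenspace A c" by (rule span_minimal[OF c subspace_gen_eigenspace[OF A]])
    then have "d = c"
      using gen_eigenspace_mod[OF A subspace_span, of C x c d] x C inv[of C] by (auto simp: P_def)
    have "x \<notin> C" using x span_base by metis
    then have D: "insert x C - C = {x}" by auto
    have ind: "independent (insert x C)" using x C by (auto simp: P_def independent_insertI)
    have "trace (insert x C) A = trace C A + c * of_nat (card (insert x C - C))"
      by (rule trace_extend[OF ind]) (use C x D \<open>d = c\<close> in \<open>auto simp: P_def\<close>)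
    moreover have "span C \<subseteq> span (insert x C)" by (rule span_mono) auto
    moreover have "(A x - d *s x) + d *s x \<in> span (insert x C)"
      by (rule span_add[OF subsetD[OF calculation(2) x(3)] span_scale[OF span_base]]) simp
    then have "A x \<in> span (insert x C)" by simp
    ultimately have "P (insert x C)"
      using C x ind \<open>x \<notin> C\<close> finiteI_independent[of C] D by (auto simp: P_def algebra_simps)
    from max[OF this] show False using \<open>x \<notin> C\<close> finiteI_independent[of C] C by (simp add: P_def)
  qed
  then have eq: "span B = span C" using C by (auto simp: P_def intro: span_minimal[THEN subsetD])
  moreover from this have "card B = card C"
    using dim_span_eq_card_independent[OF B] dim_span_eq_card_independent[of C] C by (simp add: P_def)
  ultimately show ?thesis
    using C trace_change_basis[OF B _ eq A AB] by (simp add: P_def)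
qed

text \<open>The blocks are indexed by all scalars, or by all integers up to 1, so the sum has to be
  cut down to the nonempty blocks, of which independence leaves finitely many.\<close>

lemma trace_UNION:
  assumes ind: "independent (\<Union>i\<in>I. B i)" and disj: "disjoint_family_on B I"
    and A: "\<And>i b. i \<in> I \<Longrightarrow> b \<in> B i \<Longrightarrow> A b \<in> span (B i)"
  shows "trace (\<Union>i\<in>I. B i) A = (\<Sum>i | i \<in> I \<and> B i \<noteq> {}. trace (B i) A)"
    and "finite {i \<in> I. B i \<noteq> {}}"
proof -
  let ?J = "{i \<in> I. B i \<noteq> {}}"
  have fin: "finite (\<Union>i\<in>I. B i)" by (rule finiteI_independent[OF ind])
  have eq: "(\<Union>i\<in>I. B i) = (\<Union>i\<in>?J. B i)" by auto
  have "disjoint_family_on B ?J" using disj by (auto simp: disjoint_family_on_def)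
  then show J: "finite ?J"
    using infinite_disjoint_family_imp_infinite_UNION[of ?J B] fin unfolding eq by blast
  have "trace (\<Union>i\<in>I. B i) A = (\<Sum>b\<in>(\<Union>i\<in>?J. B i). representation (\<Union>i\<in>I. B i) (A b) b)"
    unfolding trace_def by (rule sum.cong[OF eq refl])
  also have "\<dots> = (\<Sum>i\<in>?J. \<Sum>b\<in>B i. representation (\<Union>i\<in>I. B i) (A b) b)"
  proof (rule sum.UNION_disjoint[OF J])
    show "\<forall>i\<in>?J. finite (B i)" using fin by (auto intro: finite_subset)
    show "\<forall>i\<in>?J. \<forall>j\<in>?J. i \<noteq> j \<longrightarrow> B i \<inter> B j = {}"
      using disj by (auto simp: disjoint_family_on_def)
  qed
  also have "\<dots> = (\<Sum>i\<in>?J. trace (B i) A)"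
    unfolding trace_def
  proof (intro sum.cong refl)
    fix i b assume "i \<in> ?J" "b \<in> B i"
    then show "representation (\<Union>i\<in>I. B i) (A b) b = representation (B i) (A b) b"
      by (intro fun_cong[OF representation_extend[OF ind A]]) auto
  qed
  finally show "trace (\<Union>i\<in>I. B i) A = (\<Sum>i\<in>?J. trace (B i) A)" .
qed

section \<open>Bases adapted to generalized eigenspaces\<close>

lemma gen_eigenspace_bases_disjoint:
  assumes A: "endo A" and inj: "inj_on g I" and ind: "\<And>i. i \<in> I \<Longrightarrow> independent (B i)"
    and sub: "\<And>i. i \<in> I \<Longrightarrow> B i \<subseteq> gen_eigenspace A (g i)"
  shows "disjoint_family_on B I"
  unfolding disjoint_family_on_def
proof (intro ballI impI, rule ccontr)
  fix i j assume ij: "i \<in> I" "j \<in> I" "i \<noteq> j" "B i \<inter> B j \<noteq> {}"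
  then obtain b where b: "b \<in> B i" "b \<in> B j" by auto
  moreover have "g i \<noteq> g j" using ij inj by (auto simp: inj_on_def)
  ultimately have "b = 0" using gen_eigenspace_Int[OF A, of "g i" "g j" b] sub ij by auto
  with b ind[OF ij(1)] show False by (metis dependent_zero)
qed

lemma gen_eigenspace_bases_independent:
  assumes A: "endo A" and inj: "inj_on g I" and ind: "\<And>i. i \<in> I \<Longrightarrow> independent (B i)"
    and sub: "\<And>i. i \<in> I \<Longrightarrow> B i \<subseteq> gen_eigenspace A (g i)"
  shows "independent (\<Union>i\<in>I. B i)"
  unfolding independent_explicit_module
proof (intro allI impI)
  fix t u v assume t: "finite t" "t \<subseteq> (\<Union>i\<in>I. B i)" "(\<Sum>v\<in>t. u v *s v) = 0" "v \<in> t"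
  have disj: "disjoint_family_on B I" by (rule gen_eigenspace_bases_disjoint[OF assms])
  from t(2) have "\<forall>v\<in>t. \<exists>i\<in>I. v \<in> B i" by auto
  then obtain idx where idx: "\<And>v. v \<in> t \<Longrightarrow> idx v \<in> I \<and> v \<in> B (idx v)" by metis
  define J where "J = idx ` t"
  have J: "finite J" "J \<subseteq> I" using t idx by (auto simp: J_def)
  have "inj_on g J" using inj J by (meson inj_on_subset)
  \<comment> \<open>The relation is regrouped by eigenvalue, the index used in
    \<open>gen_eigenspace_independent\<close>; injectivity of \<open>g\<close> gives one group per
    block.\<close>
  define x where "x c = (\<Sum>v\<in>t \<inter> B (the_inv_into J g c). u v *s v)" for c
  have xg: "x (g j) = (\<Sum>v\<in>t \<inter> B j. u v *s v)" if "j \<in> J" for j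
    by (simp add: x_def the_inv_into_f_f[OF \<open>inj_on g J\<close> that])
  have tJ: "t = (\<Union>j\<in>J. t \<inter> B j)" using idx by (auto simp: J_def)
  have "(\<Sum>c\<in>g ` J. x c) = (\<Sum>j\<in>J. \<Sum>v\<in>t \<inter> B j. u v *s v)"
    by (simp add: sum.reindex[OF \<open>inj_on g J\<close>] xg)
  also have "\<dots> = (\<Sum>v\<in>(\<Union>j\<in>J. t \<inter> B j). u v *s v)"
    by (rule sum.UNION_disjoint[symmetric])
      (use J t disjoint_family_onD[OF disj] in \<open>blast+\<close>)
  also have "\<dots> = 0" using t(3) tJ by simp
  finally have sum0: "(\<Sum>c\<in>g ` J. x c) = 0" .
  have mem: "x c \<in> gen_eigenspace A c" if "c \<in> g ` J" for c
  proof -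
    from that obtain j where j: "j \<in> J" "c = g j" by auto
    then have "t \<inter> B j \<subseteq> gen_eigenspace A (g j)" using sub J by blast
    then show ?thesis using j
      by (auto simp: xg intro!: subspace_sum subspace_scale subspace_gen_eigenspace[OF A])
  qed
  have "idx v \<in> J" using t(4) by (simp add: J_def)
  then have "x (g (idx v)) = 0"
    using gen_eigenspace_independent[OF A _ mem sum0] J by blast
  then have "(\<Sum>w\<in>t \<inter> B (idx v). u w *s w) = 0" using xg \<open>idx v \<in> J\<close> by simp
  then show "u v = 0"
    using independentD[OF ind[of "idx v"], of "t \<inter> B (idx v)" u v] idx[OF t(4)] t by blast
qed

lemma gen_eigenspace_basis:
  assumes A: "endo A"
  obtains B where "\<And>c. independent (B c)" "\<And>c. span (B c) = gen_eigenspace A c"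
    "independent (\<Union>c. B c)" "span (\<Union>c. B c) = UNIV" "disjoint_family B"
proof -
  have "\<forall>c. \<exists>B. independent B \<and> span B = gen_eigenspace A c"
    using basis_subspace_exists[OF subspace_gen_eigenspace[OF A]] by metis
  then obtain B where B: "\<And>c. independent (B c)" "\<And>c. span (B c) = gen_eigenspace A c" by metis
  have sub: "B c \<subseteq> gen_eigenspace A c" for c using B(2)[of c] span_superset by blast
  have "gen_eigenspace A c \<subseteq> span (\<Union>c. B c)" for c
    unfolding B(2)[symmetric] by (rule span_mono) auto
  then have "span (\<Union>c. gen_eigenspace A c \<inter> UNIV) \<subseteq> span (\<Union>c. B c)"
    by (intro span_minimal) auto
  then have "span (\<Union>c. B c) = UNIV"
    using gen_eigenspace_decomposition[OF A subspace_UNIV] by blast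
  moreover have "independent (\<Union>c. B c)" "disjoint_family B"
    by (rule gen_eigenspace_bases_independent[OF A inj_on_id] gen_eigenspace_bases_disjoint[OF A inj_on_id];
        use B sub in simp)+
  ultimately show ?thesis using B that by blast
qed

text \<open>In a basis adapted to the generalized eigenspaces of T all diagonal entries of A
  vanish.\<close>

lemma trace_shift_eq_0:
  assumes T: "endo T" and A: "endo A" and "d \<noteq> 0"
    and shift: "\<And>c x. x \<in> gen_eigenspace T c \<Longrightarrow> A x \<in> gen_eigenspace T (c + d)"
  shows "trace Basis A = 0"
proof -
  obtain B where B: "\<And>c. independent (B c)" "\<And>c. span (B c) = gen_eigenspace T c"
    "independent (\<Union>c. B c)" "span (\<Union>c. B c) = UNIV" "disjoint_family B"
    by (rule gen_eigenspace_basis[OF T]) blast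
  have "trace Basis A = trace (\<Union>c. B c) A"
    by (rule trace_change_basis) (auto simp: independent_Basis span_Basis B A)
  also have "\<dots> = 0"
    unfolding trace_def
  proof (rule sum.neutral, intro ballI)
    fix b assume "b \<in> (\<Union>c. B c)"
    then obtain c where c: "b \<in> B c" by auto
    have "b \<notin> B (c + d)" using B(5) c \<open>d \<noteq> 0\<close> unfolding disjoint_family_on_def by (metis IntI UNIV_I add_cancel_left_right empty_iff)
    moreover have "A b \<in> span (B (c + d))" using shift[of b c] B(2) span_base[OF c] by simp
    then have "representation (\<Union>c. B c) (A b) = representation (B (c + d)) (A b)"
      by (rule representation_extend[OF B(3)]) auto
    ultimately show "representation (\<Union>c. B c) (A b) b = 0"
      using representation_ne_zero by metis
  qed
  finally show ?thesis .
qed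

lemma in_gen_eigenspace_0:
  assumes A: "endo A" and "\<And>c. c \<noteq> 0 \<Longrightarrow> gen_eigenspace A c \<subseteq> {0}"
  shows "x \<in> gen_eigenspace A 0"
proof -
  note sub = subspace_gen_eigenspace[OF A, of 0]
  have "gen_eigenspace A c \<inter> UNIV \<subseteq> gen_eigenspace A 0" for c
    using assms(2)[of c] subspace_0[OF sub] by (cases "c = 0") auto
  then have "span (\<Union>c. gen_eigenspace A c \<inter> UNIV) \<subseteq> gen_eigenspace A 0"
    by (intro span_minimal sub) auto
  then show ?thesis using gen_eigenspace_decomposition[OF A subspace_UNIV] by blast
qed

end

section \<open>Weights of a Cartan subalgebra\<close>

context lie_algebra
begin

lemma lie_minus_left: "lie (- x) y = - lie x y"
  using lie_add_left[of "- x" x y] by (simp add: eq_neg_iff_add_eq_0)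

lemma lie_minus_right: "lie x (- y) = - lie x y"
  using lie_add_right[of x "- y" y] by (simp add: eq_neg_iff_add_eq_0)

lemma lie_diff_right: "lie x (y - z) = lie x y - lie x z"
  using lie_add_right[of x y "- z"] by (simp add: lie_minus_right)

lemma lie_diff_left: "lie (x - y) z = lie x z - lie y z"
  using lie_add_left[of x "- y" z] by (simp add: lie_minus_left)

lemma lie_anticomm: "lie x y = - lie y x"
proof -
  have "lie (x + y) (x + y) = 0" by (rule lie_self)
  then have "lie x y + lie y x = 0"
    unfolding lie_add_left lie_add_right by (simp add: lie_self add.commute)
  then show ?thesis by (simp add: eq_neg_iff_add_eq_0)
qed

lemma lie_lie_left: "lie (lie x y) z = lie x (lie y z) - lie y (lie x z)"
  using jacobi[of x y z] lie_anticomm[of z "lie x y"] lie_anticomm[of z x]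
  by (simp add: lie_minus_right algebra_simps eq_neg_iff_add_eq_0)

lemma derivation_lie: "lie h (lie x y) = lie (lie h x) y + lie x (lie h y)"
  by (simp add: lie_lie_left)

lemma nilpotent_imp_subspace: "nilpotent_subalgebra K \<Longrightarrow> subspace K"
  by (simp add: nilpotent_subalgebra_def lie_subalgebra_def)

lemma nilpotent_imp_lie_closed: "nilpotent_subalgebra K \<Longrightarrow> x \<in> K \<Longrightarrow> y \<in> K \<Longrightarrow> lie x y \<in> K"
  by (simp add: nilpotent_subalgebra_def lie_subalgebra_def)

lemma lower_central_subset:
  assumes "nilpotent_subalgebra K"
  shows "lower_central K j \<subseteq> K"
proof (induction j)
  case (Suc j)
  show ?case unfolding lower_central.simps
    by (rule span_minimal)
      (use Suc assms in \<open>auto intro: nilpotent_imp_lie_closed nilpotent_imp_subspace\<close>)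
qed simp

lemma lie_lower_central: "x \<in> K \<Longrightarrow> y \<in> lower_central K j \<Longrightarrow> lie x y \<in> lower_central K (Suc j)"
  by (auto intro: span_base)

end

section \<open>Adjoint operators and weights of nilpotent subalgebras\<close>

context simple_lie_algebra
begin

definition lie_basis :: "'g set" where
  "lie_basis = (SOME B. finite B \<and> independent B \<and> span B = UNIV)"

lemma lie_basis: "finite lie_basis \<and> independent lie_basis \<and> span lie_basis = UNIV"
  unfolding lie_basis_def
proof (rule someI_ex)
  obtain S where S: "finite S" "span S = UNIV" using finite_dim by auto
  obtain B where B: "B \<subseteq> S" "independent B" "S \<subseteq> span B"
    by (rule maximal_independent_subset)
  then have "span B = UNIV" using S span_minimal[OF B(3) subspace_span] by auto
  with B S show "\<exists>B. finite B \<and> independent B \<and> span B = UNIV" by (auto intro: finite_subset)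
qed

sublocale alg_closed_vector_space scale lie_basis
  by unfold_locales (use lie_basis in auto)

lemma endo_lie: "endo (lie h)"
  by (rule endoI) (simp_all add: lie_add_right lie_scale_right)

text \<open>By the Leibniz rule ad h - (c + d) sends [x, y] to [(ad h - c) x, y] +
  [x, (ad h - d) y], and in both terms the total exponent has dropped.\<close>

lemma lie_gen_eigenspace:
  assumes "x \<in> gen_eigenspace (lie h) c" "y \<in> gen_eigenspace (lie h) d"
  shows "lie x y \<in> gen_eigenspace (lie h) (c + d)"
proof -
  note sub = subspace_gen_eigenspace[OF endo_lie, of h "c + d"]
  have "lie x y \<in> gen_eigenspace (lie h) (c + d)"
    if "N + M = k" "((\<lambda>y. lie h y - c *s y) ^^ N) x = 0" "((\<lambda>y. lie h y - d *s y) ^^ M) y = 0" for N M k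
    using that
  proof (induction k arbitrary: x y N M)
    case 0
    then show ?case using subspace_0[OF sub] by simp
  next
    case (Suc k)
    show ?case
    proof (cases "N = 0 \<or> M = 0")
      case True
      then show ?thesis using Suc.prems subspace_0[OF sub] by auto
    next
      case False
      then obtain N' M' where NM: "N = Suc N'" "M = Suc M'" by (metis not0_implies_Suc)
      have "lie (lie h x - c *s x) y \<in> gen_eigenspace (lie h) (c + d)"
        using Suc.IH[of N' M "lie h x - c *s x" y] Suc.prems NM
        by (simp add: funpow_Suc_right del: funpow.simps)
      moreover have "lie x (lie h y - d *s y) \<in> gen_eigenspace (lie h) (c + d)"
        using Suc.IH[of N M' x "lie h y - d *s y"] Suc.prems NM
        by (simp add: funpow_Suc_right del: funpow.simps)
      ultimately have "lie (lie h x - c *s x) y + lie x (lie h y - d *s y) \<in> gen_eigenspace (lie h) (c + d)"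
        by (rule subspace_add[OF sub])
      also have "lie (lie h x - c *s x) y + lie x (lie h y - d *s y) = lie h (lie x y) - (c + d) *s lie x y"
        by (simp add: derivation_lie[of h x y] lie_diff_left lie_diff_right lie_scale_left lie_scale_right
            scale_left_distrib)
      finally show ?thesis using gen_eigenspace_step_iff[OF endo_lie] by blast
    qed
  qed
  with assms show ?thesis by (auto simp: gen_eigenspace_def)
qed

lemma nilpotent_gen_eigenspace:
  assumes "nilpotent_subalgebra K" "h \<in> K" "x \<in> K"
  shows "x \<in> gen_eigenspace (lie h) 0"
proof -
  have "(lie h ^^ N) x \<in> lower_central K N" for N
    by (induction N) (use assms lie_lower_central in auto)
  moreover obtain N where "lower_central K N = {0}" using assms by (auto simp: nilpotent_subalgebra_def)
  ultimately have "(lie h ^^ N) x = 0" by blast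
  then show ?thesis by (intro gen_eigenspaceI[where N = N]) simp
qed

text \<open>Lie's theorem for a nilpotent algebra acting on the quotient \<open>U / U'\<close>: on a minimal
  invariant subspace strictly above \<open>U'\<close> every term of the lower central series acts by scalars
  modulo \<open>U'\<close>, by descending induction, since a commutator acting by a scalar has trace zero.\<close>

lemma nilpotent_weight_vector:
  assumes K: "nilpotent_subalgebra K" and U: "subspace U" "subspace U'" "U' \<subseteq> U" "U \<noteq> U'"
    and KU: "\<And>h x. h \<in> K \<Longrightarrow> x \<in> U \<Longrightarrow> lie h x \<in> U"
    and KU': "\<And>h x. h \<in> K \<Longrightarrow> x \<in> U' \<Longrightarrow> lie h x \<in> U'"
  obtains x \<beta> where "x \<in> U" "x \<notin> U'" "\<beta> \<in> dual_space K" "\<And>h. h \<in> K \<Longrightarrow> lie h x - \<beta> h *s x \<in> U'"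
proof -
  define P where "P V \<longleftrightarrow> subspace V \<and> U' \<subset> V \<and> V \<subseteq> U \<and> (\<forall>h\<in>K. \<forall>x\<in>V. lie h x \<in> V)" for V
  have "P U" using U KU by (auto simp: P_def)
  then obtain V where V: "P V" and least: "\<And>E. P E \<Longrightarrow> dim V \<le> dim E"
    using ex_has_least_nat[of P U dim] by blast
  have sV: "subspace V" and KV: "\<And>h x. h \<in> K \<Longrightarrow> x \<in> V \<Longrightarrow> lie h x \<in> V" and U'V: "U' \<subset> V"
    using V by (auto simp: P_def)
  \<comment> \<open>A basis of U' extended to one of V: the trace on the quotient is the difference
    of the traces on the two spans.\<close>
  obtain B' where B': "independent B'" "span B' = U'" by (rule basis_subspace_exists[OF U(2)])
  have "B' \<subseteq> V" using B' span_superset U'V by blast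
  then obtain B where B: "B' \<subseteq> B" "independent B" "B \<subseteq> V" "V \<subseteq> span B"
    using maximal_independent_subset_extend B'(1) by metis
  have spB: "span B = V" using B sV span_minimal by blast
  have "B \<noteq> B'" using spB B' U'V by auto
  then have new: "card (B - B') \<noteq> 0"
    using B finiteI_independent[OF B(2)] by auto
  obtain N where N: "lower_central K N = {0}" using K by (auto simp: nilpotent_subalgebra_def)
  have "\<forall>y\<in>lower_central K j. \<exists>c. \<forall>x\<in>V. lie y x - c *s x \<in> U'" if "j \<le> N" for j
    using that
  proof (induction rule: inc_induct)
    case base
    show ?case unfolding N using U(2) by (auto intro!: exI[of _ 0] simp: subspace_0)
  next
    case (step j)
    show ?case
    proof
      fix y assume y: "y \<in> lower_central K j"
      then have yK: "y \<in> K" using lower_central_subset[OF K] by blast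
      \<comment> \<open>[h, y] lies in the next term of the series, so it acts on V / U' by a scalar
        c. Its traces on V and U' vanish, hence c times the dimension of V / U' is 0.\<close>
      have comm: "lie (lie h y) x \<in> U'" if h: "h \<in> K" and x: "x \<in> V" for h x
      proof -
        from step.IH lie_lower_central[OF h y] obtain c where
          c: "\<And>x. x \<in> V \<Longrightarrow> lie (lie h y) x - c *s x \<in> U'" by blast
        have "trace B (lie (lie h y)) = 0" "trace B' (lie (lie h y)) = 0"
          unfolding lie_lie_left
          by (rule trace_commutator; use B B' spB KV KU' h yK span_superset endo_lie in blast)+
        moreover have "trace B (lie (lie h y)) = trace B' (lie (lie h y)) + c * of_nat (card (B - B'))"
        proof (rule trace_extend[OF B(2,1)])
          show "lie (lie h y) b \<in> span B'" if "b \<in> B'" for b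
            using that B' KU' nilpotent_imp_lie_closed[OF K h yK] span_superset by blast
          show "lie (lie h y) b - c *s b \<in> span B'" if "b \<in> B - B'" for b
            using that B B' c by blast
        qed
        ultimately have "c = 0" using new by simp
        with c[OF x] show ?thesis by simp
      qed
      obtain x0 c where x0: "x0 \<in> V" "x0 \<notin> U'" "lie y x0 - c *s x0 \<in> U'"
        using quotient_eigenvector[OF endo_lie sV U(2), of y] KV[OF yK] U'V by blast
      \<comment> \<open>An eigenspace of y modulo U'. It is stable under K because [h, y] kills V /
        U', so minimality of V makes it all of V.\<close>
      define E where "E = {x \<in> V. lie y x - c *s x \<in> U'}"
      have "subspace E" unfolding E_def
      proof (rule subspaceI)
        fix a b assume "a \<in> {x \<in> V. lie y x - c *s x \<in> U'}" "b \<in> {x \<in> V. lie y x - c *s x \<in> U'}"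
        then have "a + b \<in> V" "(lie y a - c *s a) + (lie y b - c *s b) \<in> U'"
          using sV U(2) by (auto intro: subspace_add)
        then show "a + b \<in> {x \<in> V. lie y x - c *s x \<in> U'}"
          by (simp add: lie_add_right algebra_simps)
      next
        fix d a assume "a \<in> {x \<in> V. lie y x - c *s x \<in> U'}"
        then have "d *s a \<in> V" "d *s (lie y a - c *s a) \<in> U'"
          using sV U(2) by (auto intro: subspace_scale)
        then show "d *s a \<in> {x \<in> V. lie y x - c *s x \<in> U'}"
          by (simp add: lie_scale_right algebra_simps)
      qed (use sV U(2) in \<open>auto simp: subspace_0\<close>)
      moreover have "U' \<subseteq> E" using U'V KU'[OF yK] U(2) by (auto simp: E_def subspace_diff subspace_scale)
      moreover have "lie h x \<in> E" if h: "h \<in> K" and x: "x \<in> E" for h x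
      proof -
        have "lie h (lie y x - c *s x) - lie (lie h y) x \<in> U'"
          using KU'[OF h] comm[OF h] x U(2) by (intro subspace_diff) (auto simp: E_def)
        also have "lie h (lie y x - c *s x) - lie (lie h y) x = lie y (lie h x) - c *s lie h x"
          by (simp add: lie_lie_left lie_diff_right lie_scale_right)
        finally show ?thesis using KV[OF h] x by (auto simp: E_def)
      qed
      ultimately have "P E" using x0 V by (auto simp: P_def E_def)
      from least[OF this] have "E = V"
        using subspace_dim_equal[OF \<open>subspace E\<close> sV] by (auto simp: E_def)
      then show "\<exists>c. \<forall>x\<in>V. lie y x - c *s x \<in> U'" by (auto simp: E_def)
    qed
  qed
  from this[of 0] have "\<forall>y\<in>K. \<exists>c. \<forall>x\<in>V. lie y x - c *s x \<in> U'" by simp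
  then obtain b where b: "\<And>y x. y \<in> K \<Longrightarrow> x \<in> V \<Longrightarrow> lie y x - b y *s x \<in> U'" by metis
  obtain x where x: "x \<in> V" "x \<notin> U'" using U'V by blast
  \<comment> \<open>A vector outside U' pins down the scalar; additivity and homogeneity of the
    weight follow.\<close>
  have unique: "c = d" if "y - c *s x \<in> U'" "y - d *s x \<in> U'" for y c d
  proof (rule ccontr)
    assume "c \<noteq> d"
    have "(1 / (d - c)) *s ((y - c *s x) - (y - d *s x)) \<in> U'"
      by (rule subspace_scale[OF U(2) subspace_diff[OF U(2) that]])
    also have "(y - c *s x) - (y - d *s x) = (d - c) *s x" by (simp add: algebra_simps)
    finally show False using x(2) \<open>c \<noteq> d\<close> by simp
  qed
  have sK: "subspace K" by (rule nilpotent_imp_subspace[OF K])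
  define \<beta> where "\<beta> h = (if h \<in> K then b h else 0)" for h
  have "\<beta> (y + z) = \<beta> y + \<beta> z" if yz: "y \<in> K" "z \<in> K" for y z
  proof (rule unique)
    show "lie (y + z) x - \<beta> (y + z) *s x \<in> U'"
      using b[of "y + z" x] yz x sK by (simp add: \<beta>_def subspace_add)
    have "(lie y x - b y *s x) + (lie z x - b z *s x) \<in> U'"
      using b yz x U(2) by (intro subspace_add) auto
    then show "lie (y + z) x - (\<beta> y + \<beta> z) *s x \<in> U'"
      using yz by (simp add: \<beta>_def lie_add_left algebra_simps)
  qed
  moreover have "\<beta> (c *s y) = c * \<beta> y" if y: "y \<in> K" for c y
  proof (rule unique)
    show "lie (c *s y) x - \<beta> (c *s y) *s x \<in> U'"
      using b[of "c *s y" x] y x sK by (simp add: \<beta>_def subspace_scale)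
    have "c *s (lie y x - b y *s x) \<in> U'"
      using b y x U(2) by (intro subspace_scale) auto
    then show "lie (c *s y) x - (c * \<beta> y) *s x \<in> U'"
      using y by (simp add: \<beta>_def lie_scale_left algebra_simps)
  qed
  ultimately have "\<beta> \<in> dual_space K" by (auto simp: dual_space_def \<beta>_def)
  with x V b show ?thesis by (intro that[of x \<beta>]) (auto simp: P_def \<beta>_def)
qed

end


section \<open>Separating elements and generalized root spaces\<close>

context simple_lie_algebra_with_roots
begin

abbreviation weights :: "('g \<Rightarrow> 'f) set" where
  "weights \<equiv> insert (\<lambda>_. 0) (roots H)"

lemma nilpotent_H: "nilpotent_subalgebra H"
  using cartan by (simp add: cartan_subalgebra_def)

lemma subspace_H: "subspace H"
  by (rule nilpotent_imp_subspace[OF nilpotent_H])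

lemma lie_closed_H: "x \<in> H \<Longrightarrow> y \<in> H \<Longrightarrow> lie x y \<in> H"
  by (rule nilpotent_imp_lie_closed[OF nilpotent_H])

lemma weight_in_dual_space: "\<beta> \<in> weights \<Longrightarrow> \<beta> \<in> dual_space H"
  by (auto simp: roots_def dual_space_def)

lemma dual_space_sum:
  assumes "\<beta> \<in> dual_space H" "finite S" "\<And>i. i \<in> S \<Longrightarrow> x i \<in> H"
  shows "\<beta> (\<Sum>i\<in>S. x i) = (\<Sum>i\<in>S. \<beta> (x i))"
  using assms(2,3)
proof (induction S rule: finite_induct)
  case empty
  have "\<beta> (0 *s 0) = 0 * \<beta> 0"
    using assms(1) subspace_0[OF subspace_H] unfolding dual_space_def by blast
  then show ?case by simp
next
  case (insert i S)
  then show ?case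
    using assms(1) subspace_sum[OF subspace_H, of S x] by (simp add: dual_space_def)
qed

lemma weight_vector:
  assumes U: "subspace U" "U \<noteq> {0}" "\<And>h x. h \<in> H \<Longrightarrow> x \<in> U \<Longrightarrow> lie h x \<in> U"
  obtains x \<beta> where "x \<in> U" "x \<noteq> 0" "\<beta> \<in> weights" "x \<in> root_space H \<beta>"
proof -
  have "{0} \<subseteq> U" using U subspace_0 by auto
  then obtain x \<beta> where x: "x \<in> U" "x \<notin> {0}" "\<beta> \<in> dual_space H"
      "\<And>h. h \<in> H \<Longrightarrow> lie h x - \<beta> h *s x \<in> {0}"
    using nilpotent_weight_vector[OF nilpotent_H U(1) subspace_single_0 _ U(2) U(3)] by auto
  then have "x \<in> root_space H \<beta>" by (simp add: root_space_def)
  moreover from this x have "\<beta> \<in> weights" by (auto simp: roots_def)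
  ultimately show ?thesis using x that by auto
qed

lemma stable_gen_eigenspace: "h \<in> H \<Longrightarrow> h' \<in> H \<Longrightarrow> x \<in> gen_eigenspace (lie h) c \<Longrightarrow> lie h' x \<in> gen_eigenspace (lie h) c"
  using lie_gen_eigenspace[OF nilpotent_gen_eigenspace[OF nilpotent_H], of h h' x c] by simp

lemma simple_root: "j \<in> {1..n} \<Longrightarrow> \<alpha> j \<in> roots H"
  using simple by (simp add: simple_roots_def)

lemma simple_independent: "(\<And>x. (\<Sum>j=1..n. c j * \<alpha> j x) = 0) \<Longrightarrow> j \<in> {1..n} \<Longrightarrow> c j = 0"
  using simple unfolding simple_roots_def by blast

lemma coefficient_le:
  assumes "(\<lambda>x. \<Sum>j=1..n. of_nat (c j) * \<alpha> j x) \<in> roots H" "j \<in> {1..n}"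
  shows "c j \<le> k j"
proof -
  obtain d :: "nat \<Rightarrow> nat" where d: "\<And>x. (\<Sum>j=1..n. of_nat (k j) * \<alpha> j x) - (\<Sum>j=1..n. of_nat (c j) * \<alpha> j x) = (\<Sum>j=1..n. of_nat (d j) * \<alpha> j x)"
    using bspec[OF conjunct2[OF maximal[unfolded maximal_root_def]] assms(1)] by metis
  have "(\<Sum>j=1..n. (of_nat (k j) - of_nat (c j) - of_nat (d j)) * \<alpha> j x) = 0" for x
    using d[of x] by (simp add: left_diff_distrib sum_subtractf)
  from simple_independent[OF this assms(2)] have "(of_nat (k j) :: 'f) = of_nat (c j + d j)"
    by (simp add: algebra_simps)
  then have "k j = c j + d j" by (simp only: of_nat_eq_iff)
  then show ?thesis by simp
qed

text \<open>\<open>\<alpha> j\<close> is itself a root, with coefficient 1 at j. This makes the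
  denominators in \<open>hh_eq\<close> nonzero.\<close>

lemma k_pos: assumes "j \<in> {1..n}" shows "k j \<ge> 1"
proof -
  have "(\<lambda>x. \<Sum>i=1..n. of_nat (if i = j then 1 else 0) * \<alpha> i x) = \<alpha> j"
  proof
    fix x
    have "(\<Sum>i=1..n. of_nat (if i = j then 1 else 0) * \<alpha> i x) = (\<Sum>i=1..n. if i = j then \<alpha> i x else 0)"
      by (rule sum.cong) auto
    then show "(\<Sum>i=1..n. of_nat (if i = j then 1 else 0) * \<alpha> i x) = \<alpha> j x" using assms by simp
  qed
  then show ?thesis using coefficient_le[of "\<lambda>i. if i = j then 1 else 0" j] simple_root[OF assms] assms by simp
qed

lemma weight_coordinates:
  assumes "\<beta> \<in> weights"
  obtains c :: "nat \<Rightarrow> int" where "\<beta> = (\<lambda>x. \<Sum>j=1..n. of_int (c j) * \<alpha> j x)"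
proof (cases "\<beta> = (\<lambda>_. 0)")
  case True
  then show ?thesis by (intro that[of "\<lambda>_. 0"]) simp
next
  case False
  with assms have "\<beta> \<in> roots H" by simp
  then obtain c :: "nat \<Rightarrow> nat" where "\<beta> = (\<lambda>x. \<Sum>j=1..n. of_nat (c j) * \<alpha> j x) \<or>
      \<beta> = (\<lambda>x. - (\<Sum>j=1..n. of_nat (c j) * \<alpha> j x))"
    using simple unfolding simple_roots_def by blast
  then show ?thesis
  proof
    assume "\<beta> = (\<lambda>x. \<Sum>j=1..n. of_nat (c j) * \<alpha> j x)"
    then show ?thesis by (intro that[of "\<lambda>j. int (c j)"]) simp
  next
    assume "\<beta> = (\<lambda>x. - (\<Sum>j=1..n. of_nat (c j) * \<alpha> j x))"
    then show ?thesis by (intro that[of "\<lambda>j. - int (c j)"]) (simp add: sum_negf)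
  qed
qed

text \<open>Stated for finite sets, since finiteness of the set of roots is deduced from it.\<close>

lemma separating_element_finite:
  assumes "finite S" "S \<subseteq> weights"
  obtains h where "h \<in> H" "inj_on (\<lambda>\<beta>. \<beta> h) S" "\<And>\<beta>. \<beta> \<in> weights \<Longrightarrow> \<beta> h \<in> \<int>"
proof -
  \<comment> \<open>As \<open>of_nat (k i) *s hh i\<close> is dual to the simple roots,
    \<open>\<alpha> j\<close> takes the value M^j at \<open>h M\<close>. A weight then becomes a
    polynomial in M with integer coefficients, and a natural number M gives an integer.\<close>
  define h where "h M = (\<Sum>i=1..n. M ^ i *s of_nat (k i) *s hh i)" for M :: 'f
  have hi: "M ^ i *s of_nat (k i) *s hh i \<in> H" if "i \<in> {1..n}" for M i
    using hh_in[OF that] subspace_H by (intro subspace_scale)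
  then have hH: "h M \<in> H" for M unfolding h_def by (intro subspace_sum subspace_H)
  have eval: "\<alpha> j (h M) = M ^ j" if j: "j \<in> {1..n}" for j M
  proof -
    have dual: "\<alpha> j \<in> dual_space H" using simple_root[OF j] weight_in_dual_space by blast
    have "\<alpha> j (h M) = (\<Sum>i=1..n. \<alpha> j (M ^ i *s of_nat (k i) *s hh i))"
      unfolding h_def using hi by (intro dual_space_sum dual) auto
    also have "\<dots> = (\<Sum>i=1..n. if i = j then M ^ j else 0)"
    proof (rule sum.cong)
      fix i assume i: "i \<in> {1..n}"
      have knz: "of_nat (k i) \<noteq> (0 :: 'f)" using k_pos[OF i] by simp
      have "\<alpha> j (M ^ i *s of_nat (k i) *s hh i) = M ^ i * (of_nat (k i) * \<alpha> j (hh i))"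
        using dual hh_in[OF i] subspace_scale[OF subspace_H hh_in[OF i]] unfolding dual_space_def
        by simp
      then show "\<alpha> j (M ^ i *s of_nat (k i) *s hh i) = (if i = j then M ^ j else 0)"
        using hh_eq[OF i j] k_pos[OF i] knz by (cases "i = j") simp_all
    qed simp
    finally show ?thesis using j by simp
  qed
  have ints: "\<beta> (h (of_nat M)) \<in> \<int>" if "\<beta> \<in> weights" for \<beta> M
  proof -
    from that obtain c :: "nat \<Rightarrow> int" where "\<beta> = (\<lambda>x. \<Sum>j=1..n. of_int (c j) * \<alpha> j x)"
      by (rule weight_coordinates)
    then have "\<beta> (h (of_nat M)) = (\<Sum>j=1..n. of_int (c j) * of_nat M ^ j)"
      by (simp add: eval)
    then show ?thesis by (auto intro!: Ints_sum Ints_mult Ints_power)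
  qed
  define bad where "bad \<beta> \<gamma> = {M. \<beta> (h M) = \<gamma> (h M)}" for \<beta> \<gamma> :: "'g \<Rightarrow> 'f"
  have fin: "finite (bad \<beta> \<gamma>)" if "\<beta> \<in> weights" "\<gamma> \<in> weights" "\<beta> \<noteq> \<gamma>" for \<beta> \<gamma>
  proof -
    from that(1) obtain c :: "nat \<Rightarrow> int" where c: "\<beta> = (\<lambda>x. \<Sum>j=1..n. of_int (c j) * \<alpha> j x)"
      by (rule weight_coordinates)
    from that(2) obtain d :: "nat \<Rightarrow> int" where d: "\<gamma> = (\<lambda>x. \<Sum>j=1..n. of_int (d j) * \<alpha> j x)"
      by (rule weight_coordinates)
    \<comment> \<open>The difference of the two weights as a polynomial in M. It is nonzero because
      their coordinates differ, so they agree at finitely many M only.\<close>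
    define p :: "'f poly" where "p = (\<Sum>j=1..n. monom (of_int (c j - d j)) j)"
    have "\<exists>j\<in>{1..n}. c j \<noteq> d j" using that(3) unfolding c d by fastforce
    then obtain j where j: "j \<in> {1..n}" "c j \<noteq> d j" ..
    have "coeff p j = (\<Sum>i=1..n. if i = j then of_int (c i - d i) else 0)"
      by (simp add: p_def coeff_sum)
    also have "\<dots> = of_int (c j - d j)" using j by simp
    finally have "coeff p j \<noteq> 0" using j by simp
    then have p: "p \<noteq> 0" by auto
    have "bad \<beta> \<gamma> \<subseteq> {M. poly p M = 0}"
      by (auto simp: bad_def c d eval p_def poly_sum poly_monom left_diff_distrib sum_subtractf)
    then show ?thesis by (rule finite_subset[OF _ poly_roots_finite[OF p]])
  qed
  have "finite (\<Union>\<beta>\<in>S. \<Union>\<gamma>\<in>S - {\<beta>}. bad \<beta> \<gamma>)"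
  proof (intro finite_UN_I)
    fix \<beta> \<gamma> assume "\<beta> \<in> S" "\<gamma> \<in> S - {\<beta>}"
    then show "finite (bad \<beta> \<gamma>)" using assms(2) by (intro fin) auto
  qed (use assms in auto)
  moreover have "infinite (range (of_nat :: nat \<Rightarrow> 'f))"
    by (rule range_inj_infinite) (simp add: inj_of_nat)
  ultimately obtain M where M: "of_nat M \<notin> (\<Union>\<beta>\<in>S. \<Union>\<gamma>\<in>S - {\<beta>}. bad \<beta> \<gamma>)"
    by (meson finite_subset image_subsetI)
  have "inj_on (\<lambda>\<beta>. \<beta> (h (of_nat M))) S"
    using M by (auto simp: inj_on_def bad_def)
  with hH ints that show ?thesis by blast
qed

text \<open>Root vectors for finitely many roots are eigenvectors of one separating element with
  distinct eigenvalues, so the dimension bounds their number.\<close>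

lemma finite_roots: "finite (roots H)"
proof (rule ccontr)
  assume "infinite (roots H)"
  then obtain S where S: "finite S" "card S = Suc dimension" "S \<subseteq> roots H"
    using infinite_arbitrarily_large by blast
  then obtain h where h: "h \<in> H" "inj_on (\<lambda>\<beta>. \<beta> h) S"
    using separating_element_finite[of S] by blast
  have "\<forall>\<beta>\<in>S. \<exists>x. x \<noteq> 0 \<and> x \<in> root_space H \<beta>"
  proof
    fix \<beta> assume "\<beta> \<in> S"
    then have "root_space H \<beta> \<noteq> {0}" using S by (auto simp: roots_def)
    moreover have "0 \<in> root_space H \<beta>" by (simp add: root_space_def)
    ultimately show "\<exists>x. x \<noteq> 0 \<and> x \<in> root_space H \<beta>" by auto
  qed
  then obtain x where x: "\<And>\<beta>. \<beta> \<in> S \<Longrightarrow> x \<beta> \<noteq> 0 \<and> x \<beta> \<in> root_space H \<beta>" by metis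
  have sub: "{x \<beta>} \<subseteq> gen_eigenspace (lie h) (\<beta> h)" if "\<beta> \<in> S" for \<beta>
    using x[OF that] h by (auto simp: root_space_def intro: eigenvector_in_gen_eigenspace)
  have "independent (\<Union>\<beta>\<in>S. {x \<beta>})"
    by (rule gen_eigenspace_bases_independent[OF endo_lie[of h] h(2)]) (use x sub in auto)
  moreover have "disjoint_family_on (\<lambda>\<beta>. {x \<beta>}) S"
    by (rule gen_eigenspace_bases_disjoint[OF endo_lie[of h] h(2)]) (use x sub in auto)
  then have "card (\<Union>\<beta>\<in>S. {x \<beta>}) = (\<Sum>\<beta>\<in>S. card {x \<beta>})"
    using S by (intro card_UN_disjoint) (auto simp: disjoint_family_on_def)
  ultimately show False
    using S independent_card_le_dim[OF subset_UNIV, of "\<Union>\<beta>\<in>S. {x \<beta>}"] by (simp add: dimension_def)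
qed

definition sep :: 'g where
  "sep = (SOME h. h \<in> H \<and> inj_on (\<lambda>\<beta>. \<beta> h) weights \<and> (\<forall>\<beta>\<in>weights. \<beta> h \<in> \<int>))"

lemma sep: "sep \<in> H" "inj_on (\<lambda>\<beta>. \<beta> sep) weights" "\<beta> \<in> weights \<Longrightarrow> \<beta> sep \<in> \<int>"
proof -
  have "\<exists>h. h \<in> H \<and> inj_on (\<lambda>\<beta>. \<beta> h) weights \<and> (\<forall>\<beta>\<in>weights. \<beta> h \<in> \<int>)"
    using separating_element_finite[of weights] finite_roots by (metis finite_insert order_refl)
  note * = someI_ex[OF this, folded sep_def]
  show "sep \<in> H" "inj_on (\<lambda>\<beta>. \<beta> sep) weights" using * by blast+
  show "\<beta> sep \<in> \<int>" if "\<beta> \<in> weights"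
    by (rule bspec[OF conjunct2[OF conjunct2[OF *]] that])
qed

text \<open>Generalized eigenspaces, because the action of \<open>H\<close> is not yet known to be
  diagonalizable; for weights they turn out to equal the root spaces.\<close>

definition gen_root_space :: "('g \<Rightarrow> 'f) \<Rightarrow> 'g set" where
  "gen_root_space \<beta> = {x. \<forall>h\<in>H. x \<in> gen_eigenspace (lie h) (\<beta> h)}"

lemma gen_root_spaceD: "x \<in> gen_root_space \<beta> \<Longrightarrow> h \<in> H \<Longrightarrow> x \<in> gen_eigenspace (lie h) (\<beta> h)"
  by (simp add: gen_root_space_def)

lemma root_space_subset: "root_space H \<beta> \<subseteq> gen_root_space \<beta>"
  by (auto simp: root_space_def gen_root_space_def intro: eigenvector_in_gen_eigenspace)

lemma subspace_gen_root_space: "subspace (gen_root_space \<beta>)"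
proof -
  have "gen_root_space \<beta> = (\<Inter>h\<in>H. gen_eigenspace (lie h) (\<beta> h))" by (auto simp: gen_root_space_def)
  then show ?thesis by (simp add: subspace_Int subspace_gen_eigenspace[OF endo_lie])
qed

lemma lie_gen_root_space:
  "x \<in> gen_root_space \<beta> \<Longrightarrow> y \<in> gen_root_space \<gamma> \<Longrightarrow> lie x y \<in> gen_root_space (\<lambda>h. \<beta> h + \<gamma> h)"
  by (simp add: gen_root_space_def lie_gen_eigenspace)

text \<open>The space is stable under \<open>H\<close>, and every weight vector in it has the one
  weight that takes the value c at \<open>sep\<close>. For h in \<open>H\<close> each nonzero
  generalized eigenspace of ad h in it contains a weight vector, so ad h has a single eigenvalue
  there.\<close>

lemma gen_eigenspace_sep:
  assumes "gen_eigenspace (lie sep) c \<noteq> {0}"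
  obtains \<beta> where "\<beta> \<in> weights" "\<beta> sep = c" "gen_eigenspace (lie sep) c = gen_root_space \<beta>"
proof -
  let ?V = "gen_eigenspace (lie sep) c"
  have V: "subspace ?V" "\<And>h x. h \<in> H \<Longrightarrow> x \<in> ?V \<Longrightarrow> lie h x \<in> ?V"
    using sep(1) by (auto intro: stable_gen_eigenspace subspace_gen_eigenspace endo_lie)
  have weight_eq: "\<gamma> sep = c" if "x \<in> ?V" "x \<noteq> 0" "x \<in> root_space H \<gamma>" for x \<gamma>
    using gen_eigenspace_inj[OF endo_lie _ that(1), of "\<gamma> sep"] that sep(1) by (auto simp: root_space_def)
  obtain x \<beta> where x: "x \<in> ?V" "x \<noteq> 0" "\<beta> \<in> weights" "x \<in> root_space H \<beta>"
    by (rule weight_vector[OF V(1) assms V(2)])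
  have "?V \<subseteq> gen_eigenspace (lie h) (\<beta> h)" if h: "h \<in> H" for h
  proof -
    have "gen_eigenspace (lie h) d \<inter> ?V \<subseteq> gen_eigenspace (lie h) (\<beta> h)" for d
    proof (cases "gen_eigenspace (lie h) d \<inter> ?V = {0}")
      case True
      then show ?thesis using subspace_0[OF subspace_gen_eigenspace[OF endo_lie]] by auto
    next
      case False
      have "subspace (gen_eigenspace (lie h) d \<inter> ?V)"
        by (intro subspace_inter subspace_gen_eigenspace endo_lie)
      from weight_vector[OF this False] obtain y \<gamma> where
        y: "y \<in> gen_eigenspace (lie h) d \<inter> ?V" "y \<noteq> 0" "\<gamma> \<in> weights" "y \<in> root_space H \<gamma>"
        using V(2) stable_gen_eigenspace[OF h] by blast
      have "\<gamma> = \<beta>" using inj_onD[OF sep(2), of \<gamma> \<beta>] weight_eq x y by auto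
      moreover have "\<gamma> h = d"
        using gen_eigenspace_inj[OF endo_lie, of d "\<gamma> h" y h] y h by (auto simp: root_space_def)
      ultimately show ?thesis by auto
    qed
    then have "span (\<Union>d. gen_eigenspace (lie h) d \<inter> ?V) \<subseteq> gen_eigenspace (lie h) (\<beta> h)"
      by (intro span_minimal subspace_gen_eigenspace endo_lie) auto
    then show ?thesis using gen_eigenspace_decomposition[OF endo_lie V(1), of h] V(2)[OF h] by blast
  qed
  then have "?V \<subseteq> gen_root_space \<beta>" by (auto simp: gen_root_space_def)
  moreover have "\<beta> sep = c" using weight_eq x by blast
  ultimately show ?thesis using x(3) that sep(1) by (auto simp: gen_root_space_def)
qed

lemma gen_eigenspace_sep_weight:
  assumes "\<beta> \<in> weights"
  shows "gen_eigenspace (lie sep) (\<beta> sep) = gen_root_space \<beta>"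
proof (cases "gen_eigenspace (lie sep) (\<beta> sep) = {0}")
  case True
  moreover have "gen_root_space \<beta> \<subseteq> gen_eigenspace (lie sep) (\<beta> sep)" using sep(1) by (auto simp: gen_root_space_def)
  ultimately show ?thesis using subspace_0[OF subspace_gen_root_space] by auto
next
  case False
  then show ?thesis using gen_eigenspace_sep[OF False] inj_onD[OF sep(2)] assms by metis
qed

text \<open>If the zero weight space were larger than \<open>H\<close>, a weight vector of \<open>H\<close> on the quotient would
  normalize \<open>H\<close>.\<close>

lemma gen_root_space_0: "gen_root_space (\<lambda>_. 0) = H"
proof (rule ccontr)
  let ?K = "gen_root_space (\<lambda>_. 0)"
  assume "?K \<noteq> H"
  moreover have HK: "H \<subseteq> ?K"
    using nilpotent_gen_eigenspace[OF nilpotent_H] by (auto simp: gen_root_space_def)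
  moreover have "lie h x \<in> ?K" if "h \<in> H" "x \<in> ?K" for h x
    using lie_gen_root_space[of h "\<lambda>_. 0" x "\<lambda>_. 0"] HK that by auto
  ultimately obtain x \<beta> where x: "x \<in> ?K" "x \<notin> H" "\<And>h. h \<in> H \<Longrightarrow> lie h x - \<beta> h *s x \<in> H"
    using nilpotent_weight_vector[OF nilpotent_H subspace_gen_root_space subspace_H, of "\<lambda>_. 0"] lie_closed_H
    by metis
  have "lie x h \<in> H" if h: "h \<in> H" for h
  proof -
    have "\<beta> h = 0"
      using gen_eigenspace_mod[OF endo_lie subspace_H, of h x 0 "\<beta> h"] x h lie_closed_H
      by (auto simp: gen_root_space_def)
    then have "- lie h x \<in> H" using x(3)[OF h] subspace_neg[OF subspace_H] by auto
    then show ?thesis by (simp add: lie_anticomm[of x h])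
  qed
  then have "x \<in> normalizer H" by (simp add: normalizer_def)
  with x(2) cartan show False by (simp add: cartan_subalgebra_def)
qed

lemma gen_eigenspace_sep_0: "gen_eigenspace (lie sep) 0 = H"
  using gen_eigenspace_sep_weight[of "\<lambda>_. 0"] gen_root_space_0 by simp

end

section \<open>The Killing form and the root space decomposition\<close>

context simple_lie_algebra
begin

definition killing :: "'g \<Rightarrow> 'g \<Rightarrow> 'f" where
  "killing x y = trace lie_basis (\<lambda>z. lie x (lie y z))"

lemma endo_lie_lie: "endo (\<lambda>z. lie x (lie y z))"
  by (rule endo_comp[OF endo_lie endo_lie])

lemma killing_commute: "killing x y = killing y x"
  unfolding killing_def
  by (rule trace_commute) (auto simp: independent_Basis span_Basis endo_lie)

lemma killing_add_left: "killing (x + x') y = killing x y + killing x' y"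
  unfolding killing_def lie_add_left
  by (rule trace_add) (auto simp: independent_Basis span_Basis)

lemma killing_scale_left: "killing (c *s x) y = c * killing x y"
  unfolding killing_def lie_scale_left
  by (rule trace_scale) (auto simp: independent_Basis span_Basis)

lemma killing_add_right: "killing x (y + y') = killing x y + killing x y'"
  using killing_add_left by (simp add: killing_commute[of x])

lemma killing_scale_right: "killing x (c *s y) = c * killing x y"
  using killing_scale_left by (simp add: killing_commute[of x])

lemma killing_0_right: "killing x 0 = 0"
  using killing_scale_right[of x 0 0] by simp

lemma killing_minus_left: "killing (- x) y = - killing x y"
  using killing_scale_left[of "-1" x y] by simp

lemma killing_minus_right: "killing x (- y) = - killing x y"
  using killing_scale_right[of x "-1" y] by simp

lemma killing_lie: "killing (lie x y) z = killing x (lie y z)"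
proof -
  have "trace lie_basis (\<lambda>w. lie y (lie x (lie z w))) = trace lie_basis (\<lambda>w. lie x (lie z (lie y w)))"
    by (rule trace_commute) (auto simp: independent_Basis span_Basis endo_lie endo_lie_lie)
  then show ?thesis
    unfolding killing_def lie_lie_left lie_diff_right
    by (subst (1 2) trace_diff) (auto simp: independent_Basis span_Basis)
qed

lemma killing_gen_eigenspace:
  assumes "x \<in> gen_eigenspace (lie h) c" "y \<in> gen_eigenspace (lie h) d" "c + d \<noteq> 0"
  shows "killing x y = 0"
  unfolding killing_def
proof (rule trace_shift_eq_0[OF endo_lie endo_lie_lie assms(3)])
  fix a z assume "z \<in> gen_eigenspace (lie h) a"
  then have "lie x (lie y z) \<in> gen_eigenspace (lie h) (c + (d + a))"
    using assms by (intro lie_gen_eigenspace)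
  then show "lie x (lie y z) \<in> gen_eigenspace (lie h) (a + (c + d))" by (simp add: algebra_simps)
qed

text \<open>The radical is an ideal, so simplicity lets a single nonzero value take the place of
  Cartan's criterion.\<close>

lemma killing_nondegenerate_if_nonzero:
  assumes "killing a b \<noteq> 0" and "\<And>y. killing x y = 0"
  shows "x = 0"
proof -
  define R where "R = {x. \<forall>y. killing x y = 0}"
  have "killing (lie x y) z = 0" if "y \<in> R" for x y z
    using that killing_lie[of y x z] by (simp add: lie_anticomm[of x y] killing_minus_left R_def)
  then have "lie_ideal R"
    unfolding lie_ideal_def
    by (auto simp: R_def killing_add_left killing_scale_left killing_commute[of 0] killing_0_right intro!: subspaceI)
  from no_proper_ideal[OF this] have "R = {0}" using assms(1) by (auto simp: R_def)
  with assms(2) show ?thesis by (auto simp: R_def)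
qed

text \<open>ad h and ad y commute, so the nilpotency of ad h passes to their product.\<close>

lemma killing_commuting_nilpotent:
  assumes "lie h y = 0" "\<And>z. z \<in> gen_eigenspace (lie h) 0"
  shows "killing h y = 0"
proof -
  have comm: "lie h (lie y z) = lie y (lie h z)" for z
    using lie_lie_left[of h y z] assms(1) by simp
  have comm': "lie h ((lie y ^^ N) z) = (lie y ^^ N) (lie h z)" for N z
    by (induction N) (simp_all add: comm)
  have pow: "((\<lambda>z. lie h (lie y z)) ^^ N) z = (lie y ^^ N) ((lie h ^^ N) z)" for N z
    by (induction N) (simp_all add: comm comm')
  have "z \<in> gen_eigenspace (\<lambda>z. lie h (lie y z)) 0" for z
  proof -
    obtain N where "(lie h ^^ N) z = 0" using assms(2)[of z] by (auto simp: gen_eigenspace_def)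
    then show ?thesis
      using pow[of N z] endo_zero[OF endo_funpow[OF endo_lie]]
      by (intro gen_eigenspaceI[where N = N]) simp
  qed
  then have "trace lie_basis (\<lambda>z. lie h (lie y z)) = 0 * of_nat (card lie_basis)"
    by (intro trace_gen_eigenspace) (auto simp: independent_Basis span_Basis endo_lie_lie)
  then show ?thesis by (simp add: killing_def)
qed

end

section \<open>Nondegeneracy on the Cartan subalgebra and its commutativity\<close>

context simple_lie_algebra_with_roots
begin

text \<open>All weights are integral at \<open>sep\<close>, so this is a sum of squares of integers.\<close>

lemma killing_sep: "killing sep sep \<noteq> 0"
proof -
  let ?T = "lie sep"
  obtain B where B: "\<And>c. independent (B c)" "\<And>c. span (B c) = gen_eigenspace ?T c"
    "independent (\<Union>c. B c)" "span (\<Union>c. B c) = UNIV" "disjoint_family B"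
    by (rule gen_eigenspace_basis[OF endo_lie[of sep]]) blast
  have sub: "B c \<subseteq> gen_eigenspace ?T c" for c using B(2)[of c] span_superset by blast
  have inv: "lie sep (lie sep b) \<in> span (B c)" if "b \<in> B c" for b c
    using that sub[of c] unfolding B(2) by (blast intro: gen_eigenspace_invariant[OF endo_lie])
  have sq: "B c \<subseteq> gen_eigenspace (\<lambda>x. lie sep (lie sep x)) (c * c)" for c
    using sub[of c] by (auto intro: gen_eigenspace_square[OF endo_lie])
  define J where "J = {c. B c \<noteq> {}}"
  have J: "finite J" using trace_UNION(2)[OF B(3,5) inv] by (simp add: J_def)
  have "killing sep sep = trace (\<Union>c. B c) (\<lambda>x. lie sep (lie sep x))"
    unfolding killing_def
    by (rule trace_change_basis) (auto simp: independent_Basis span_Basis B endo_lie_lie)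
  also have "\<dots> = (\<Sum>c\<in>J. trace (B c) (\<lambda>x. lie sep (lie sep x)))"
    using trace_UNION(1)[OF B(3,5) inv] by (simp add: J_def)
  also have "\<dots> = (\<Sum>c\<in>J. c * c * of_nat (card (B c)))"
    by (intro sum.cong refl trace_gen_eigenspace B(1) endo_lie_lie inv sq)
  finally have eq: "killing sep sep = (\<Sum>c\<in>J. c * c * of_nat (card (B c)))" .
  have nz: "gen_eigenspace ?T c \<noteq> {0}" if "c \<in> J" for c
  proof -
    obtain b where "b \<in> B c" using \<open>c \<in> J\<close> by (auto simp: J_def)
    moreover from this have "b \<noteq> 0" using B(1)[of c] dependent_zero by metis
    ultimately show ?thesis using sub[of c] by blast
  qed
  have "\<exists>z::int. c = of_int z" if "c \<in> J" for c
    using gen_eigenspace_sep[OF nz[OF that]] sep(3) by (metis Ints_cases)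
  then obtain z :: "'f \<Rightarrow> int" where z: "\<And>c. c \<in> J \<Longrightarrow> c = of_int (z c)" by metis
  have "(\<Sum>c\<in>J. c * c * of_nat (card (B c))) = (\<Sum>c\<in>J. of_int (z c * z c * int (card (B c))))"
  proof (rule sum.cong)
    fix c assume "c \<in> J"
    from z[OF this] show "c * c * of_nat (card (B c)) = of_int (z c * z c * int (card (B c)))"
      by (metis of_int_mult of_int_of_nat_eq)
  qed simp
  then have eq': "killing sep sep = of_int (\<Sum>c\<in>J. z c * z c * int (card (B c)))"
    using eq by simp
  \<comment> \<open>One strictly positive summand is still missing. Any root supplies it, and the
    maximal root shows that there is one.\<close>
  obtain \<theta> where \<theta>: "\<theta> \<in> roots H" using maximal by (auto simp: maximal_root_def)
  then obtain x where x: "x \<noteq> 0" "x \<in> root_space H \<theta>"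
    by (auto simp: roots_def root_space_def)
  have "\<theta> sep \<noteq> 0"
    using inj_onD[OF sep(2), of \<theta> "\<lambda>_. 0"] \<theta> by (auto simp: roots_def)
  have "x \<in> gen_eigenspace ?T (\<theta> sep)"
    using x sep(1) by (auto simp: root_space_def intro: eigenvector_in_gen_eigenspace)
  then have J\<theta>: "\<theta> sep \<in> J" using x(1) B(2)[of "\<theta> sep"] by (auto simp: J_def)
  have "0 < z (\<theta> sep) * z (\<theta> sep) * int (card (B (\<theta> sep)))"
    using z[OF J\<theta>] J\<theta> \<open>\<theta> sep \<noteq> 0\<close> finiteI_independent[OF B(1)]
    by (auto simp: J_def card_gt_0_iff zero_less_mult_iff linorder_neq_iff)
  then have "0 < (\<Sum>c\<in>J. z c * z c * int (card (B c)))"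
    using J J\<theta> by (intro sum_pos2[of J "\<theta> sep"]) auto
  then show ?thesis unfolding eq' of_int_eq_0_iff by simp
qed

lemma killing_nondegenerate: "(\<And>y. killing x y = 0) \<Longrightarrow> x = 0"
  by (rule killing_nondegenerate_if_nonzero[OF killing_sep])

lemma killing_nonzero_weight:
  assumes "killing x y \<noteq> 0"
  obtains \<beta> z where "\<beta> \<in> weights" "z \<in> gen_root_space \<beta>" "killing x z \<noteq> 0"
proof -
  have "\<exists>c. \<exists>z\<in>gen_eigenspace (lie sep) c. killing x z \<noteq> 0"
  proof (rule ccontr)
    assume no: "\<not> ?thesis"
    have "y \<in> span (\<Union>c. gen_eigenspace (lie sep) c \<inter> UNIV)"
      by (rule gen_eigenspace_decomposition[OF endo_lie]) auto
    then have "killing x y = 0"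
      by (induction rule: span_induct_alt)
        (use no in \<open>auto simp: killing_0_right killing_add_right killing_scale_right\<close>)
    with assms show False by simp
  qed
  then obtain c z where z: "z \<in> gen_eigenspace (lie sep) c" "killing x z \<noteq> 0" by blast
  then have nz: "gen_eigenspace (lie sep) c \<noteq> {0}" using killing_0_right by auto
  obtain \<beta> where "\<beta> \<in> weights" "gen_eigenspace (lie sep) c = gen_root_space \<beta>"
    by (rule gen_eigenspace_sep[OF nz])
  with z that show ?thesis by blast
qed

text \<open>\<open>H\<close> is orthogonal to the generalized root spaces of all nonzero weights, so
  orthogonality to \<open>H\<close> already means orthogonality to everything.\<close>

lemma killing_nondegenerate_H:
  assumes h: "h \<in> H" and zero: "\<And>y. y \<in> H \<Longrightarrow> killing h y = 0"
  shows "h = 0"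
proof (rule killing_nondegenerate, rule ccontr)
  fix y assume "killing h y \<noteq> 0"
  then obtain \<beta> z where z: "\<beta> \<in> weights" "z \<in> gen_root_space \<beta>" "killing h z \<noteq> 0"
    by (rule killing_nonzero_weight)
  then have "\<beta> \<noteq> (\<lambda>_. 0)" using zero gen_root_space_0 by auto
  then have "\<beta> sep \<noteq> 0" using inj_onD[OF sep(2), of \<beta> "\<lambda>_. 0"] z by auto
  then have "killing h z = 0"
    using killing_gen_eigenspace[of h sep 0 z "\<beta> sep"] h z(2) sep(1) gen_eigenspace_sep_0
    by (auto simp: gen_root_space_def)
  with z show False by simp
qed

text \<open>Such an h is orthogonal to \<open>H\<close>. Both \<open>H_abelian\<close> and
  \<open>root_coroot_nonzero\<close> end in this way.\<close>

lemma central_nilpotent_eq_0: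
  assumes "h \<in> H" "\<And>y. y \<in> H \<Longrightarrow> lie h y = 0" "\<And>z. z \<in> gen_eigenspace (lie h) 0"
  shows "h = 0"
  using killing_nondegenerate_H[OF assms(1)] killing_commuting_nilpotent[OF _ assms(3)] assms(2) by blast

text \<open>The last nonzero term of the lower central series of \<open>H\<close> is central in \<open>H\<close>, and consists of
  sums of commutators if \<open>H\<close> is not abelian.\<close>

lemma H_abelian: "x \<in> H \<Longrightarrow> y \<in> H \<Longrightarrow> lie x y = 0"
proof (rule ccontr)
  assume xy: "x \<in> H" "y \<in> H" "lie x y \<noteq> 0"
  define N where "N = (LEAST N. lower_central H N = {0})"
  have N: "lower_central H N = {0}"
    unfolding N_def by (rule LeastI_ex) (use nilpotent_H in \<open>simp add: nilpotent_subalgebra_def\<close>)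
  have "lie x y \<in> lower_central H (Suc 0)"
    by (rule lie_lower_central) (use xy in \<open>simp_all del: lower_central.simps(2)\<close>)
  then have "N \<noteq> Suc 0" using N xy(3) by (metis singletonD)
  moreover have "N \<noteq> 0" using N xy by (metis lie_0_left lower_central.simps(1) singletonD)
  \<comment> \<open>The last nonzero term has index at least 1, and so is spanned by commutators of
    elements of \<open>H\<close>.\<close>
  ultimately obtain M where M: "N = Suc (Suc M)" by (metis not0_implies_Suc)
  have "lower_central H (Suc M) \<noteq> {0}"
    using not_less_Least[of "Suc M" "\<lambda>N. lower_central H N = {0}"] M by (simp add: N_def del: lower_central.simps)
  moreover have "0 \<in> lower_central H (Suc M)" by (simp add: span_zero)
  ultimately obtain z where z: "z \<in> lower_central H (Suc M)" "z \<noteq> 0" by blast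
  have zH: "z \<in> H" using z lower_central_subset[OF nilpotent_H] by blast
  have central: "lie z h = 0" if "h \<in> H" for h
    using lie_lower_central[OF that z(1)] N M by (simp add: lie_anticomm[of z h] del: lower_central.simps)
  \<comment> \<open>Since z is central in \<open>H\<close>, the space is stable under
    \<open>H\<close>. As a sum of commutators z has trace 0 on it, but the trace is also c times its
    dimension.\<close>
  have "gen_eigenspace (lie z) c \<subseteq> {0}" if "c \<noteq> 0" for c
  proof -
    obtain B where B: "independent B" "span B = gen_eigenspace (lie z) c"
      by (rule basis_subspace_exists[OF subspace_gen_eigenspace[OF endo_lie]])
    have sub: "B \<subseteq> gen_eigenspace (lie z) c" using B(2) span_superset by blast
    have HB: "lie h b \<in> span B" if "h \<in> H" "b \<in> B" for h b
      unfolding B(2)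
    proof (rule gen_eigenspace_commuting[OF endo_lie endo_lie])
      show "lie z (lie h x) = lie h (lie z x)" for x
        using lie_lie_left[of z h x] central[OF that(1)] by simp
      show "b \<in> gen_eigenspace (lie z) c" using sub that by blast
    qed
    have "trace B (lie w) = 0 \<and> w \<in> H" if "w \<in> span {lie x y |x y. x \<in> H \<and> y \<in> lower_central H M}" for w
      using that
    proof (induction rule: span_induct_alt)
      case base
      show ?case using subspace_0[OF subspace_H] by (simp add: trace_def representation_zero)
    next
      case (step k a w)
      then obtain x y where a: "a = lie x y" "x \<in> H" "y \<in> H"
        using lower_central_subset[OF nilpotent_H] by blast
      then have aH: "a \<in> H" by (simp add: lie_closed_H)
      have "trace B (lie a) = 0"
        unfolding a(1) lie_lie_left
        by (rule trace_commutator) (use a HB B endo_lie in auto)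
      moreover have "trace B (lie (k *s a + w)) = k * trace B (lie a) + trace B (lie w)"
        unfolding lie_add_left lie_scale_left
        using HB[OF aH] HB[of w] step by (subst trace_add) (auto simp: trace_scale B(1) intro: span_scale)
      ultimately show ?case
        using step a by (auto intro!: subspace_add subspace_scale subspace_H lie_closed_H)
    qed
    then have "trace B (lie z) = 0" using z(1) by simp
    moreover have "trace B (lie z) = c * of_nat (card B)"
      by (rule trace_gen_eigenspace[OF B(1) endo_lie HB[OF zH] sub])
    ultimately have "B = {}" using \<open>c \<noteq> 0\<close> finiteI_independent[OF B(1)] by simp
    then show ?thesis using B(2) by simp
  qed
  then have "w \<in> gen_eigenspace (lie z) 0" for w by (intro in_gen_eigenspace_0 endo_lie)
  from central_nilpotent_eq_0[OF zH central this] z(2) show False by simp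
qed

lemma root_space_0: "root_space H (\<lambda>_. 0) = H"
  using root_space_subset[of "\<lambda>_. 0"] gen_root_space_0 H_abelian by (auto simp: root_space_def)

lemma subspace_root_space: "subspace (root_space H \<beta>)"
  by (rule subspaceI) (auto simp: root_space_def lie_add_right lie_scale_right scale_right_distrib mult.commute)

lemma root_space_nonzero:
  assumes "\<beta> \<in> roots H"
  obtains x where "x \<in> root_space H \<beta>" "x \<noteq> 0"
  using assms by (auto simp: roots_def root_space_def)

lemma weight_minus_cong:
  assumes "\<beta> \<in> dual_space H" "\<gamma> \<in> dual_space H" "\<And>h. h \<in> H \<Longrightarrow> \<beta> h + \<gamma> h = 0"
  shows "\<gamma> = (\<lambda>h. - \<beta> h)"
proof
  show "\<gamma> h = - \<beta> h" for h
    using assms by (cases "h \<in> H") (auto simp: dual_space_def eq_neg_iff_add_eq_0 add.commute)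
qed

text \<open>By nondegeneracy e pairs nontrivially with some generalized root space, and
  \<open>killing_gen_eigenspace\<close> forces its weight to be -\<beta>. At this stage f need not
  be a genuine eigenvector.\<close>

lemma opposite_root:
  assumes \<beta>: "\<beta> \<in> roots H" and e: "e \<in> root_space H \<beta>" "e \<noteq> 0"
  obtains f where "f \<in> gen_root_space (\<lambda>h. - \<beta> h)" "killing e f = 1" "(\<lambda>h. - \<beta> h) \<in> roots H"
proof -
  obtain y where "killing e y \<noteq> 0" using killing_nondegenerate[of e] e(2) by blast
  then obtain \<gamma> z where z: "\<gamma> \<in> weights" "z \<in> gen_root_space \<gamma>" "killing e z \<noteq> 0"
    by (rule killing_nonzero_weight)
  have "\<beta> h + \<gamma> h = 0" if "h \<in> H" for h
    using killing_gen_eigenspace[of e h "\<beta> h" z "\<gamma> h"] gen_root_spaceD[OF _ that] e z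
      root_space_subset[of \<beta>] by blast
  then have \<gamma>: "\<gamma> = (\<lambda>h. - \<beta> h)"
    using weight_minus_cong[of \<beta> \<gamma>] \<beta> z(1) weight_in_dual_space by blast
  have "(\<lambda>h. - \<beta> h) \<noteq> (\<lambda>_. 0)"
  proof
    assume "(\<lambda>h. - \<beta> h) = (\<lambda>_. 0)"
    then have "\<beta> = (\<lambda>_. 0)" by (auto simp: fun_eq_iff)
    with \<beta> show False by (simp add: roots_def)
  qed
  then have "(\<lambda>h. - \<beta> h) \<in> roots H" using z(1) \<gamma> by auto
  moreover have "(1 / killing e z) *s z \<in> gen_root_space (\<lambda>h. - \<beta> h)"
    using subspace_scale[OF subspace_gen_root_space z(2)] unfolding \<gamma> .
  ultimately show ?thesis using z that by (simp add: killing_scale_right)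
qed

section \<open>The coroot and the dimension of a root space\<close>

context
  fixes \<beta> e f
  assumes \<beta>: "\<beta> \<in> roots H" and e: "e \<in> root_space H \<beta>" "e \<noteq> 0"
    and f: "f \<in> gen_root_space (\<lambda>h. - \<beta> h)" "killing e f = 1"
begin

lemma lie_e: "h \<in> H \<Longrightarrow> lie h e = \<beta> h *s e"
  using e by (simp add: root_space_def)

lemma e_gen: "e \<in> gen_root_space \<beta>"
  using e root_space_subset by blast

lemma coroot_in_H: "lie e f \<in> H"
  using lie_gen_root_space[OF e_gen f(1)] gen_root_space_0 by simp

text \<open>By invariance and \<open>killing e f = 1\<close>, the Killing form identifies [e, f]
  with \<beta>; in particular [e, f] = 0 would force \<beta> = 0.\<close>

lemma killing_coroot: "h \<in> H \<Longrightarrow> killing (lie e f) h = \<beta> h"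
proof -
  assume h: "h \<in> H"
  have "killing (lie e f) h = killing e (lie f h)" by (rule killing_lie)
  also have "\<dots> = - killing e (lie h f)" by (simp add: lie_anticomm[of f h] killing_minus_right)
  also have "\<dots> = killing (lie h e) f"
    by (simp add: killing_lie[symmetric] lie_anticomm[of h e] killing_minus_left)
  also have "\<dots> = \<beta> h" using f by (simp add: lie_e[OF h] killing_scale_left)
  finally show ?thesis .
qed

text \<open>Otherwise \<open>[e, f]\<close> commutes with \<open>e\<close>, and up to nilpotents with \<open>f\<close>; being a commutator on
  each of its generalized eigenspaces, it would be nilpotent.\<close>

lemma root_coroot_nonzero: "\<beta> (lie e f) \<noteq> 0"
proof
  let ?t = "lie e f"
  assume 0: "\<beta> ?t = 0"
  have e0: "e \<in> gen_eigenspace (lie ?t) 0" and f0: "f \<in> gen_eigenspace (lie ?t) 0"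
    using gen_root_spaceD[OF e_gen coroot_in_H] gen_root_spaceD[OF f(1) coroot_in_H] 0 by auto
  have "gen_eigenspace (lie ?t) c \<subseteq> {0}" if "c \<noteq> 0" for c
  proof -
    obtain B where B: "independent B" "span B = gen_eigenspace (lie ?t) c"
      by (rule basis_subspace_exists[OF subspace_gen_eigenspace[OF endo_lie]])
    have sub: "B \<subseteq> gen_eigenspace (lie ?t) c" using B(2) span_superset by blast
    have inv: "lie x b \<in> span B" if "x \<in> gen_eigenspace (lie ?t) 0" "b \<in> B" for x b
      using lie_gen_eigenspace[OF that(1), of b c] sub that(2) B(2) by auto
    have "trace B (lie ?t) = 0"
      unfolding lie_lie_left by (rule trace_commutator[OF B(1) endo_lie endo_lie inv[OF e0] inv[OF f0]])
    moreover have "trace B (lie ?t) = c * of_nat (card B)"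
      by (rule trace_gen_eigenspace[OF B(1) endo_lie inv sub])
        (simp add: eigenvector_in_gen_eigenspace lie_self)
    ultimately have "B = {}" using \<open>c \<noteq> 0\<close> finiteI_independent[OF B(1)] by simp
    then show ?thesis using B(2) by simp
  qed
  then have "z \<in> gen_eigenspace (lie ?t) 0" for z by (intro in_gen_eigenspace_0 endo_lie)
  then have "?t = 0" using central_nilpotent_eq_0[OF coroot_in_H] H_abelian[OF coroot_in_H] by blast
  then have "\<beta> h = 0" if "h \<in> H" for h
    using killing_coroot[OF that] killing_0_right[of h] by (simp add: killing_commute)
  moreover have "\<beta> h = 0" if "h \<notin> H" for h using that \<beta> by (simp add: roots_def dual_space_def)
  ultimately have "\<beta> = (\<lambda>_. 0)" by blast
  with \<beta> show False by (simp add: roots_def)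
qed

text \<open>The sum of \<open>Fe\<close>, \<open>H\<close> and the generalized root spaces of \<open>j\<beta>\<close> for \<open>j < 0\<close> is stable under \<open>e\<close> and
  \<open>f\<close>, so \<open>[e, f]\<close> has trace zero on it.\<close>

lemma gen_root_space_opposite: "gen_root_space (\<lambda>h. - \<beta> h) = span {f}"
proof -
  let ?t = "lie e f"
  \<comment> \<open>At \<open>j = 1\<close> only the line through e is taken, not the whole
    generalized root space: then e still maps \<open>G 0\<close>, which is \<open>H\<close>, into
    \<open>G 1\<close>, and kills \<open>G 1\<close>.\<close>
  define G where "G j = (if j = 1 then span {e} else gen_root_space (\<lambda>h. of_int j * \<beta> h))" for j :: int
  have G0: "G 0 = H" using gen_root_space_0 by (simp add: G_def)
  have sG: "subspace (G j)" for j by (simp add: G_def subspace_gen_root_space)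
  have Gsub: "G j \<subseteq> gen_root_space (\<lambda>h. of_int j * \<beta> h)" for j
  proof (cases "j = 1")
    case True
    have "span {e} \<subseteq> gen_root_space \<beta>" by (rule span_minimal) (use e_gen subspace_gen_root_space in auto)
    with True show ?thesis by (simp add: G_def)
  qed (simp add: G_def)
  have eG: "lie e x \<in> G (if j = 1 then 1 else j + 1)" if x: "x \<in> G j" and j: "j \<le> 1" for x j
  proof -
    consider "j = 1" | "j = 0" | "j < 0" using j by linarith
    then show ?thesis
    proof cases
      case 1
      then show ?thesis using x by (auto simp: G_def span_singleton lie_scale_right lie_self span_zero intro: exI[of _ 0])
    next
      case 2
      then have "lie e x = (- \<beta> x) *s e"
        using x G0 by (simp add: lie_anticomm[of e x] lie_e)
      then show ?thesis
        using 2 span_scale[OF span_base[of e "{e}"], of "- \<beta> x"] by (simp add: G_def)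
    next
      case 3
      have "lie e x \<in> gen_root_space (\<lambda>h. \<beta> h + of_int j * \<beta> h)"
        using x Gsub[of j] by (intro lie_gen_root_space[OF e_gen]) auto
      then show ?thesis using 3 by (simp add: G_def algebra_simps)
    qed
  qed
  have fG: "lie f x \<in> G (j - 1)" if x: "x \<in> G j" and j: "j \<le> 1" for x j
  proof -
    have "lie f x \<in> gen_root_space (\<lambda>h. - \<beta> h + of_int j * \<beta> h)"
      using x Gsub[of j] by (intro lie_gen_root_space[OF f(1)]) auto
    then show ?thesis using j by (simp add: G_def algebra_simps)
  qed
  have "\<forall>j. \<exists>B. independent B \<and> span B = G j" using basis_subspace_exists[OF sG] by metis
  then obtain B where B: "\<And>j. independent (B j)" "\<And>j. span (B j) = G j" by metis
  have BG: "B j \<subseteq> G j" for j using B(2)[of j] span_superset by blast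
  let ?g = "\<lambda>j::int. of_int j * \<beta> ?t"
  have inj: "inj_on ?g {..1}" using root_coroot_nonzero by (auto simp: inj_on_def)
  have sub: "B j \<subseteq> gen_eigenspace (lie ?t) (?g j)" for j
    using BG[of j] Gsub[of j] gen_root_spaceD[OF _ coroot_in_H] by blast
  let ?U = "\<Union>j\<in>{..1}. B j"
  have ind: "independent ?U"
    by (rule gen_eigenspace_bases_independent[OF endo_lie[of ?t] inj]) (use B sub in auto)
  have disj: "disjoint_family_on B {..1}"
    by (rule gen_eigenspace_bases_disjoint[OF endo_lie[of ?t] inj]) (use B sub in auto)
  have GU: "G j \<subseteq> span ?U" if "j \<le> 1" for j
    unfolding B(2)[symmetric] by (rule span_mono) (use that in auto)
  have "trace ?U (lie ?t) = 0"
    unfolding lie_lie_left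
  proof (rule trace_commutator[OF ind endo_lie endo_lie])
    fix b assume "b \<in> ?U"
    then obtain j where j: "j \<le> 1" "b \<in> G j" using BG by auto
    have "(if j = 1 then 1 else j + 1) \<le> 1" using j(1) by simp
    from GU[OF this] show "lie e b \<in> span ?U" using eG[OF j(2,1)] by blast
    show "lie f b \<in> span ?U" using fG[OF j(2,1)] GU[of "j - 1"] j(1) by auto
  qed
  have inv: "lie ?t b \<in> span (B j)" if "j \<in> {..1}" "b \<in> B j" for j b
  proof (cases "j = 1")
    case True
    then have "b \<in> span {e}" using BG[of j] that by (auto simp: G_def)
    then show ?thesis
      using True unfolding B(2)
      by (auto simp: G_def span_singleton lie_scale_right lie_e[OF coroot_in_H] intro: rangeI)
  next
    case False
    have "?t \<in> gen_root_space (\<lambda>_. 0)" using coroot_in_H gen_root_space_0 by simp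
    then have "lie ?t b \<in> gen_root_space (\<lambda>h. 0 + of_int j * \<beta> h)"
      using BG[of j] Gsub[of j] that by (intro lie_gen_root_space) auto
    then show ?thesis using False unfolding B(2) by (simp add: G_def)
  qed
  define J where "J = {j \<in> {..1}. B j \<noteq> {}}"
  have J: "finite J" "J \<subseteq> {..1}" using trace_UNION(2)[OF ind disj inv] by (auto simp: J_def)
  have "trace ?U (lie ?t) = (\<Sum>j\<in>J. trace (B j) (lie ?t))"
    using trace_UNION(1)[OF ind disj inv] by (simp add: J_def)
  also have "\<dots> = (\<Sum>j\<in>J. ?g j * of_nat (card (B j)))"
    using inv sub J B(1) by (intro sum.cong refl trace_gen_eigenspace endo_lie) auto
  also have "\<dots> = \<beta> ?t * of_int (\<Sum>j\<in>J. j * int (card (B j)))"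
    by (simp add: sum_distrib_left mult_ac)
  finally have "of_int (\<Sum>j\<in>J. j * int (card (B j))) = (0 :: 'f)"
    using \<open>trace ?U (lie ?t) = 0\<close> root_coroot_nonzero by simp
  then have sum0: "(\<Sum>j\<in>J. j * int (card (B j))) = 0" by (simp only: of_int_eq_0_iff)
  have "f \<noteq> 0" using f(2) killing_0_right by auto
  have fG1: "f \<in> G (-1)" using f by (simp add: G_def)
  then have J1: "-1 \<in> J" using \<open>f \<noteq> 0\<close> B(2)[of "-1"] by (auto simp: J_def)
  have "e \<in> G 1" by (simp add: G_def span_base)
  then have J2: "1 \<in> J" using e(2) B(2)[of 1] by (auto simp: J_def)
  have "card (B 1) = 1"
    using dim_span_eq_card_independent[OF B(1)[of 1]] B(2)[of 1] e(2) by (simp add: G_def)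
  \<comment> \<open>The index 1 contributes 1, the index -1 contributes minus the dimension in
    question, and the others contribute at most 0. As the total is 0, that dimension is at most
    1.\<close>
  have "(\<Sum>j\<in>J. j * int (card (B j))) = (\<Sum>j\<in>J - {1, -1}. j * int (card (B j))) + (\<Sum>j\<in>{1, -1}. j * int (card (B j)))"
    by (rule sum.subset_diff) (use J J1 J2 in auto)
  also have "(\<Sum>j\<in>{1, -1}. j * int (card (B j))) = 1 - int (card (B (-1)))"
    using \<open>card (B 1) = 1\<close> by simp
  also have "(\<Sum>j\<in>J - {1, -1}. j * int (card (B j))) \<le> 0"
    by (rule sum_nonpos) (use J in \<open>auto intro!: mult_nonpos_nonneg\<close>)
  finally have "card (B (-1)) \<le> 1" using sum0 by simp
  moreover have "card (B (-1)) \<noteq> 0" using J1 finiteI_independent[OF B(1)] by (simp add: J_def)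
  ultimately have "card (B (-1)) = 1" by simp
  then obtain b where b: "B (-1) = {b}" by (rule card_1_singletonE)
  then obtain c where c: "f = c *s b" using fG1 B(2)[of "-1"] by (auto simp: span_singleton)
  with \<open>f \<noteq> 0\<close> have "b = (1 / c) *s f" by auto
  then have "b \<in> span {f}" by (metis span_base span_scale singletonI)
  then have "G (-1) \<subseteq> span {f}" using B(2)[of "-1"] b by (auto intro: span_minimal[THEN subsetD])
  moreover have "span {f} \<subseteq> G (-1)" by (rule span_minimal) (use fG1 sG in auto)
  ultimately show ?thesis by (simp add: G_def)
qed

end

text \<open>\<open>gen_root_space_opposite\<close> bounds the space opposite to a given root, so it
  is applied to -\<beta>. The resulting line contains a genuine root vector for \<beta>, hence
  consists of such vectors.\<close>

lemma gen_root_space_root: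
  assumes \<beta>: "\<beta> \<in> roots H"
  obtains e where "e \<noteq> 0" "gen_root_space \<beta> = span {e}" "root_space H \<beta> = span {e}"
proof -
  obtain e where e: "e \<in> root_space H \<beta>" "e \<noteq> 0" by (rule root_space_nonzero[OF \<beta>])
  obtain f where "f \<in> gen_root_space (\<lambda>h. - \<beta> h)" and m: "(\<lambda>h. - \<beta> h) \<in> roots H"
    by (rule opposite_root[OF \<beta> e])
  obtain e' where e': "e' \<in> root_space H (\<lambda>h. - \<beta> h)" "e' \<noteq> 0" by (rule root_space_nonzero[OF m])
  obtain f' where f': "f' \<in> gen_root_space (\<lambda>h. - (- \<beta> h))" "killing e' f' = 1" by (rule opposite_root[OF m e'])
  have gen: "gen_root_space \<beta> = span {f'}" using gen_root_space_opposite[OF m e' f'] by simp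
  then have "e \<in> span {f'}" using e root_space_subset by blast
  then obtain c where "e = c *s f'" by (auto simp: span_singleton)
  with e have "f' = (1 / c) *s e" by auto
  then have "span {f'} \<subseteq> root_space H \<beta>"
    using e subspace_root_space by (intro span_minimal) (auto intro: subspace_scale)
  with gen root_space_subset[of \<beta>] have "root_space H \<beta> = span {f'}" by blast
  moreover have "f' \<noteq> 0" using f'(2) killing_0_right by auto
  ultimately show ?thesis using gen that by blast
qed

text \<open>This is all of the sl2 structure that is used for regular decompositions; the scalar c
  is \<beta> at [e, f] and stays unnormalized.\<close>

lemma root_pair:
  assumes \<beta>: "\<beta> \<in> roots H"
  obtains e f c where "root_space H \<beta> = span {e}" "root_space H (\<lambda>h. - \<beta> h) = span {f}"
    "lie e f \<in> H" "c \<noteq> 0" "e \<noteq> 0" "lie (lie e f) e = c *s e" "(\<lambda>h. - \<beta> h) \<in> roots H"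
proof -
  obtain e where e: "e \<noteq> 0" "root_space H \<beta> = span {e}" by (rule gen_root_space_root[OF \<beta>])
  then have e': "e \<in> root_space H \<beta>" by (simp add: span_base)
  obtain f where f: "f \<in> gen_root_space (\<lambda>h. - \<beta> h)" "killing e f = 1" and m: "(\<lambda>h. - \<beta> h) \<in> roots H"
    by (rule opposite_root[OF \<beta> e' e(1)])
  have "root_space H (\<lambda>h. - \<beta> h) = gen_root_space (\<lambda>h. - \<beta> h)"
    using gen_root_space_root[OF m] by metis
  then have "root_space H (\<lambda>h. - \<beta> h) = span {f}"
    using gen_root_space_opposite[OF \<beta> e' e(1) f] by simp
  with e m show ?thesis
    using coroot_in_H[OF \<beta> e' e(1) f] root_coroot_nonzero[OF \<beta> e' e(1) f] that
      lie_e[OF \<beta> e' e(1) f] by blast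
qed

lemma weight_decomposition: "x \<in> span (\<Union>\<beta>\<in>weights. root_space H \<beta>)"
proof -
  have "gen_eigenspace (lie sep) c \<inter> UNIV \<subseteq> span (\<Union>\<beta>\<in>weights. root_space H \<beta>)" for c
  proof (cases "gen_eigenspace (lie sep) c = {0}")
    case True
    then show ?thesis by (simp add: span_zero)
  next
    case False
    obtain \<beta> where \<beta>: "\<beta> \<in> weights" "gen_eigenspace (lie sep) c = gen_root_space \<beta>"
      by (rule gen_eigenspace_sep[OF False])
    have "gen_root_space \<beta> = root_space H \<beta>"
    proof (cases "\<beta> = (\<lambda>_. 0)")
      case True
      then show ?thesis by (simp add: gen_root_space_0 root_space_0)
    next
      case False
      then have "\<beta> \<in> roots H" using \<beta>(1) by blast
      then show ?thesis using gen_root_space_root[of \<beta>] by metis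
    qed
    then have "gen_eigenspace (lie sep) c \<subseteq> (\<Union>\<beta>\<in>weights. root_space H \<beta>)" using \<beta> by blast
    then show ?thesis using span_superset by blast
  qed
  then have "span (\<Union>c. gen_eigenspace (lie sep) c \<inter> UNIV) \<subseteq> span (\<Union>\<beta>\<in>weights. root_space H \<beta>)"
    by (intro span_minimal) auto
  then show ?thesis using gen_eigenspace_decomposition[OF endo_lie subspace_UNIV] by blast
qed

end

section \<open>Complements and eigenvector components\<close>

context vector_space
begin

lemma subspace_complement:
  assumes S: "subspace S" "S \<subseteq> V" and V: "subspace V"
  obtains C where "subspace C" "C \<subseteq> V" "C \<inter> S = {0}" "\<And>v. v \<in> V \<Longrightarrow> \<exists>c\<in>C. v - c \<in> S"
proof -
  obtain B where B: "B \<subseteq> S" "independent B" "S \<subseteq> span B" by (rule maximal_independent_subset)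
  have "B \<subseteq> V" using B S by blast
  then obtain B' where B': "B \<subseteq> B'" "B' \<subseteq> V" "independent B'" "V \<subseteq> span B'"
    using maximal_independent_subset_extend[OF _ B(2)] by metis
  have spB: "span B = S" using B span_minimal[OF B(1) S(1)] by blast
  have "x = 0" if x: "x \<in> span (B' - B)" "x \<in> S" for x
  proof -
    have "representation B' x = representation (B' - B) x" "representation B' x = representation B x"
      using x spB B' by (auto intro!: representation_extend)
    then have "representation B' x b = 0" for b
      using representation_ne_zero[of B x b] representation_ne_zero[of "B' - B" x b] by auto
    moreover have "x \<in> span B'" using x(1) span_mono[of "B' - B" B'] by blast
    ultimately show ?thesis using sum_nonzero_representation_eq[OF B'(3), of x] by simp
  qed
  then have "span (B' - B) \<inter> S = {0}" using S by (auto simp: span_zero subspace_0)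
  moreover have "span (B' - B) \<subseteq> V" by (rule span_minimal) (use B' V in auto)
  moreover have "\<exists>c\<in>span (B' - B). v - c \<in> S" if "v \<in> V" for v
  proof -
    have "B' = B \<union> (B' - B)" using B' by auto
    then have "v \<in> span (B \<union> (B' - B))" using that B' by auto
    then obtain s c where "v = s + c" "s \<in> span B" "c \<in> span (B' - B)" unfolding span_Un by blast
    then show ?thesis using spB by (intro bexI[of _ c]) auto
  qed
  ultimately show ?thesis using that by blast
qed

text \<open>Applying T - g j to the sum removes the j-th term and multiplies each other term by a
  nonzero scalar. Stated in any vector space, because the pairs of series form an
  infinite-dimensional one.\<close>

lemma eigenvector_components:
  assumes W: "subspace W" "\<And>w. w \<in> W \<Longrightarrow> T w \<in> W"
    and T: "\<And>x y. T (x + y) = T x + T y" "\<And>c x. T (scale c x) = scale c (T x)"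
    and S: "finite S" "inj_on g S" and eig: "\<And>i. i \<in> S \<Longrightarrow> T (w i) = scale (g i) (w i)"
    and sum: "(\<Sum>i\<in>S. w i) \<in> W" and i: "i \<in> S"
  shows "w i \<in> W"
  using S eig sum i
proof (induction S arbitrary: w i rule: finite_induct)
  case (insert j S)
  have Tsum: "T (\<Sum>i\<in>A. w i) = (\<Sum>i\<in>A. T (w i))" if "finite A" for A
    using that T(2)[of 0 0] by (induction A rule: finite_induct) (simp_all add: T(1))
  let ?w = "\<lambda>i. scale (g i - g j) (w i)"
  have "T (\<Sum>i\<in>insert j S. w i) - scale (g j) (\<Sum>i\<in>insert j S. w i) = (\<Sum>i\<in>insert j S. T (w i) - scale (g j) (w i))"
    using insert.hyps by (subst Tsum) (simp_all only: finite_insert scale_sum_right sum_subtractf)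
  also have "\<dots> = (\<Sum>i\<in>insert j S. ?w i)"
    by (rule sum.cong) (simp_all add: insert.prems(2) scale_left_diff_distrib)
  also have "\<dots> = (\<Sum>i\<in>S. ?w i)" using insert.hyps by simp
  finally have sumW: "(\<Sum>i\<in>S. ?w i) \<in> W"
    using insert.prems(3) W by (metis subspace_diff subspace_scale)
  have Tscale: "T (?w i) = scale (g i) (?w i)" if "i \<in> S" for i
    using that insert.prems(2)[of i] by (simp add: T mult.commute)
  have "?w i \<in> W" if "i \<in> S" for i
    by (rule insert.IH) (use insert.prems(1) Tscale sumW that in auto)
  have SW: "w i \<in> W" if "i \<in> S" for i
  proof -
    have "g i \<noteq> g j" using insert.hyps(2) insert.prems(1) that by (auto simp: inj_on_def)
    then have "w i = scale (1 / (g i - g j)) (?w i)" by simp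
    then show ?thesis using subspace_scale[OF W(1) \<open>\<And>i. i \<in> S \<Longrightarrow> ?w i \<in> W\<close>[OF that]] by metis
  qed
  moreover have "w j \<in> W"
  proof -
    have "w j = (\<Sum>i\<in>insert j S. w i) - (\<Sum>i\<in>S. w i)" using insert.hyps by simp
    then show ?thesis using insert.prems(3) SW W by (metis subspace_diff subspace_sum)
  qed
  ultimately show ?case using insert.prems(4) by auto
qed simp

end


section \<open>Pairs of series\<close>

definition fls_map :: "('g::zero \<Rightarrow> 'g) \<Rightarrow> 'g fls \<Rightarrow> 'g fls" where
  "fls_map A a = Abs_fls (\<lambda>d. A (fls_nth a d))"

lemma fls_map_nth: "A 0 = 0 \<Longrightarrow> fls_nth (fls_map A a) d = A (fls_nth a d)"
  unfolding fls_map_def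
  by (rule nth_Abs_fls_lower_bound[of "fls_subdegree a"]) simp

definition fls_mono :: "int \<Rightarrow> 'g::zero \<Rightarrow> 'g fls" where
  "fls_mono j y = fls_shift (- j) (fls_const y)"

lemma fls_mono_nth: "fls_nth (fls_mono j y) d = (if d = j then y else 0)"
  by (simp add: fls_mono_def)

lemma trunc_poly_iff:
  assumes "0 \<in> V"
  shows "b \<in> trunc_poly m V \<longleftrightarrow> (\<forall>i. coeff b i \<in> V) \<and> (\<forall>i\<ge>m. coeff b i = 0)"
proof
  assume "b \<in> trunc_poly m V"
  then show "(\<forall>i. coeff b i \<in> V) \<and> (\<forall>i\<ge>m. coeff b i = 0)"
    using assms by (auto simp: trunc_poly_def coeff_poly_cutoff)
next
  assume b: "(\<forall>i. coeff b i \<in> V) \<and> (\<forall>i\<ge>m. coeff b i = 0)"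
  then have "b = poly_cutoff m b" by (auto simp: poly_eq_iff coeff_poly_cutoff)
  with b show "b \<in> trunc_poly m V" unfolding trunc_poly_def by blast
qed

lemma x_inv_poly_UNIV: "x_inv_poly (UNIV :: 'g::zero set) = {a. \<forall>d>1. fls_nth a d = 0}"
proof (intro set_eqI iffI)
  fix a :: "'g fls" assume "a \<in> {a. \<forall>d>1. fls_nth a d = 0}"
  then have "fls_shift 1 a \<in> inv_poly UNIV" by (auto simp: inv_poly_def)
  moreover have "a = fls_shift (- 1) (fls_shift 1 a)" by (simp add: fls_eq_iff)
  ultimately show "a \<in> x_inv_poly UNIV" unfolding x_inv_poly_def by blast
qed (auto simp: x_inv_poly_def inv_poly_def)

lemma listset_Cons2: "xs \<in> listset [A, B] \<longleftrightarrow> (\<exists>a\<in>A. \<exists>b\<in>B. xs = [a, b])"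
  by (auto simp: set_Cons_def)

lemma listset_Cons3: "xs \<in> listset [A, B, C] \<longleftrightarrow> (\<exists>a\<in>A. \<exists>b\<in>B. \<exists>c\<in>C. xs = [a, b, c])"
  by (auto simp: set_Cons_def)

context lie_algebra
begin

lemma fls_lie_mono_nth: "fls_nth (fls_lie (fls_mono i y) a) d = lie y (fls_nth a (d - i))"
proof (cases "y = 0")
  case True
  then have "fls_mono i y = 0" by (simp add: fls_eq_iff fls_mono_nth)
  with True show ?thesis by (simp add: fls_lie_nth)
next
  case False
  have "fls_subdegree (fls_mono i y) = i"
    by (rule fls_subdegree_eqI) (use False in \<open>auto simp: fls_mono_nth\<close>)
  then have "fls_nth (fls_lie (fls_mono i y) a) d = (\<Sum>j=i..d - fls_subdegree a. if j = i then lie y (fls_nth a (d - i)) else 0)"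
    unfolding fls_lie_nth by (intro sum.cong) (auto simp: fls_mono_nth)
  also have "\<dots> = lie y (fls_nth a (d - i))"
    by auto
  finally show ?thesis .
qed

lemma fls_lie_mono: "fls_lie (fls_mono i y) (fls_mono j z) = fls_mono (i + j) (lie y z)"
  by (auto simp: fls_eq_iff fls_lie_mono_nth fls_mono_nth)

lemma fls_lie_0_left: "fls_lie 0 a = 0"
  by (simp add: fls_eq_iff fls_lie_nth)

lemma poly_lie_const: "coeff (poly_lie [:y:] p) i = lie y (coeff p i)"
proof -
  have "coeff (poly_lie [:y:] p) i = (\<Sum>j\<le>i. if j = 0 then lie y (coeff p i) else 0)"
    unfolding coeff_poly_lie by (intro sum.cong) (auto simp: coeff_pCons split: nat.splits)
  then show ?thesis by simp
qed

lemma poly_lie_0_left: "poly_lie 0 p = 0"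
  by (simp add: poly_eq_iff coeff_poly_lie)

lemma L_scale_Pair: "L_scale c (a, b) = (fls_scale c a, poly_scale c b)"
  by (simp add: L_scale_def)

lemma fls_scale_0: "fls_scale s 0 = 0"
  by (simp add: fls_eq_iff)

lemma poly_scale_0: "poly_scale s 0 = 0"
  by (simp add: poly_eq_iff)

lemma fls_scale_mono: "fls_scale c (fls_mono j y) = fls_mono j (c *s y)"
  by (simp add: fls_eq_iff fls_mono_nth)

definition coeff_map :: "('g \<Rightarrow> 'g) \<Rightarrow> 'g fls \<times> 'g poly \<Rightarrow> 'g fls \<times> 'g poly" where
  "coeff_map A u = (fls_map A (fst u), map_poly A (snd u))"

lemma coeff_map_nth:
  assumes "A 0 = 0"
  shows "fls_nth (fst (coeff_map A u)) d = A (fls_nth (fst u) d)"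
    and "coeff (snd (coeff_map A u)) i = A (coeff (snd u) i)"
  using assms by (simp_all add: coeff_map_def fls_map_nth coeff_map_poly)

lemma L_eq_iff: "u = v \<longleftrightarrow> (\<forall>d. fls_nth (fst u) d = fls_nth (fst v) d) \<and> (\<forall>i. coeff (snd u) i = coeff (snd v) i)"
  by (auto simp: prod_eq_iff fls_eq_iff poly_eq_iff)

lemma sum_fls_nth: "fls_nth (\<Sum>i\<in>S. a i) d = (\<Sum>i\<in>S. fls_nth (a i) d)"
  by (induction S rule: infinite_finite_induct) auto

end

section \<open>Projections onto the weight spaces\<close>

context simple_lie_algebra_with_roots
begin

lemma finite_weights: "finite weights"
  using finite_roots by simp

lemma root_spaces_independent:
  assumes d: "\<And>\<beta>. \<beta> \<in> weights \<Longrightarrow> d \<beta> \<in> root_space H \<beta>" and sum: "(\<Sum>\<beta>\<in>weights. d \<beta>) = 0"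
    and \<gamma>: "\<gamma> \<in> weights"
  shows "d \<gamma> = 0"
proof -
  let ?g = "\<lambda>\<beta>. \<beta> sep"
  let ?x = "\<lambda>c. d (the_inv_into weights ?g c)"
  have inv: "the_inv_into weights ?g (\<beta> sep) = \<beta>" if "\<beta> \<in> weights" for \<beta>
    using the_inv_into_f_f[OF sep(2) that] .
  have "(\<Sum>c\<in>?g ` weights. ?x c) = (\<Sum>\<beta>\<in>weights. d \<beta>)"
    unfolding sum.reindex[OF sep(2)] o_def using inv by (intro sum.cong) auto
  with sum have sum0: "(\<Sum>c\<in>?g ` weights. ?x c) = 0" by simp
  have "?x c \<in> gen_eigenspace (lie sep) c" if c: "c \<in> ?g ` weights" for c
  proof -
    from c obtain \<beta> where \<beta>: "\<beta> \<in> weights" "c = \<beta> sep" by blast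
    then show ?thesis
      using d[OF \<beta>(1)] sep(1) by (auto simp: inv root_space_def intro!: eigenvector_in_gen_eigenspace)
  qed
  then have "?x (\<gamma> sep) = 0"
    by (rule gen_eigenspace_independent[OF endo_lie finite_imageI[OF finite_weights] _ sum0])
      (assumption | rule imageI[OF \<gamma>])+
  then show ?thesis by (simp only: inv[OF \<gamma>])
qed

text \<open>The projection of the root space decomposition. Nothing is known about it when \<beta>
  is not a weight, hence the side conditions below.\<close>

definition component :: "('g \<Rightarrow> 'f) \<Rightarrow> 'g \<Rightarrow> 'g" where
  "component \<beta> x = (SOME d. (\<forall>\<beta>\<in>weights. d \<beta> \<in> root_space H \<beta>) \<and> (\<Sum>\<beta>\<in>weights. d \<beta>) = x) \<beta>"

lemma component_exists: "\<exists>d. (\<forall>\<beta>\<in>weights. d \<beta> \<in> root_space H \<beta>) \<and> (\<Sum>\<beta>\<in>weights. d \<beta>) = x"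
  using weight_decomposition[of x]
proof (induction rule: span_induct_alt)
  case base
  show ?case by (rule exI[of _ "\<lambda>_. 0"]) (simp add: subspace_0 subspace_root_space)
next
  case (step c a y)
  then obtain d where d: "\<And>\<beta>. \<beta> \<in> weights \<Longrightarrow> d \<beta> \<in> root_space H \<beta>" "(\<Sum>\<beta>\<in>weights. d \<beta>) = y" by blast
  from step obtain \<gamma> where \<gamma>: "\<gamma> \<in> weights" "a \<in> root_space H \<gamma>" by blast
  define d' where "d' \<beta> = (if \<beta> = \<gamma> then c *s a else 0) + d \<beta>" for \<beta>
  have "(\<Sum>\<beta>\<in>weights. d' \<beta>) = (\<Sum>\<beta>\<in>weights. if \<beta> = \<gamma> then c *s a else 0) + y"
    unfolding d'_def sum.distrib d(2) ..
  also have "\<dots> = c *s a + y" using \<gamma>(1) finite_weights by (simp only: sum.delta if_True)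
  finally have "(\<Sum>\<beta>\<in>weights. d' \<beta>) = c *s a + y" .
  moreover have "d' \<beta> \<in> root_space H \<beta>" if "\<beta> \<in> weights" for \<beta>
    using d(1)[OF that] \<gamma>(2) by (auto simp: d'_def intro!: subspace_add subspace_scale subspace_root_space)
  ultimately show ?case by blast
qed

lemma component_in: "\<beta> \<in> weights \<Longrightarrow> component \<beta> x \<in> root_space H \<beta>"
  and sum_component: "(\<Sum>\<beta>\<in>weights. component \<beta> x) = x"
  using someI_ex[OF component_exists, of x] unfolding component_def by blast+

lemma component_eqI:
  assumes d: "\<And>\<beta>. \<beta> \<in> weights \<Longrightarrow> d \<beta> \<in> root_space H \<beta>" and sum: "(\<Sum>\<beta>\<in>weights. d \<beta>) = x"
    and \<gamma>: "\<gamma> \<in> weights"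
  shows "component \<gamma> x = d \<gamma>"
proof -
  have "component \<gamma> x - d \<gamma> = 0"
  proof (rule root_spaces_independent[OF _ _ \<gamma>])
    show "component \<beta> x - d \<beta> \<in> root_space H \<beta>" if "\<beta> \<in> weights" for \<beta>
      using component_in[OF that] d[OF that] by (rule subspace_diff[OF subspace_root_space])
    show "(\<Sum>\<beta>\<in>weights. component \<beta> x - d \<beta>) = 0" unfolding sum_subtractf sum_component sum by simp
  qed
  then show ?thesis by simp
qed

lemma component_add: "\<beta> \<in> weights \<Longrightarrow> component \<beta> (x + y) = component \<beta> x + component \<beta> y"
  by (rule component_eqI)
    (auto simp only: sum.distrib sum_component intro: subspace_add[OF subspace_root_space component_in component_in])

lemma component_root_space:
  assumes "\<beta> \<in> weights" "\<gamma> \<in> weights" "x \<in> root_space H \<gamma>"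
  shows "component \<beta> x = (if \<beta> = \<gamma> then x else 0)"
proof (rule component_eqI[OF _ _ assms(1)])
  show "(if \<beta> = \<gamma> then x else 0) \<in> root_space H \<beta>" for \<beta>
    using assms(3) subspace_0[OF subspace_root_space] by auto
  show "(\<Sum>\<beta>\<in>weights. if \<beta> = \<gamma> then x else 0) = x"
    using assms(2) finite_weights by (simp only: sum.delta if_True)
qed

lemma component_0: "\<beta> \<in> weights \<Longrightarrow> component \<beta> 0 = 0"
  using component_root_space[of \<beta> \<beta> 0] subspace_0[OF subspace_root_space] by simp

lemma component_diff: "\<beta> \<in> weights \<Longrightarrow> component \<beta> (x - y) = component \<beta> x - component \<beta> y"
  using component_add[of \<beta> "x - y" y] by simp

end

section \<open>Regular decompositions\<close>

context simple_lie_algebra_with_roots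
begin

text \<open>In g[x^-1], the case \<open>i = 0\<close>, every component has degree at most 0; the
  value 0 lets this case be treated like the others.\<close>

definition root_floor :: "nat \<Rightarrow> ('g \<Rightarrow> 'f) \<Rightarrow> int" where
  "root_floor i \<beta> = (if i = 0 then 0 else rat_floor (\<beta> (hh i)))"

text \<open>A root is \<open>c / k\<^sub>i\<close> at \<open>h\<^sub>i\<close>, where \<open>c\<close> is its coefficient at \<open>\<alpha>\<^sub>i\<close>, so \<open>\<bar>c\<bar> \<le> k\<^sub>i\<close>.\<close>

lemma root_at_hh:
  assumes \<beta>: "\<beta> \<in> roots H" and i: "i \<in> {1..n}"
  obtains q :: rat where "\<beta> (hh i) = of_rat q" "q \<le> 1"
proof -
  have eval: "(\<Sum>j=1..n. of_nat (c j) * \<alpha> j (hh i)) = of_rat (of_nat (c i) / of_nat (k i))" for c :: "nat \<Rightarrow> nat"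
  proof -
    have "(\<Sum>j=1..n. of_nat (c j) * \<alpha> j (hh i)) = (\<Sum>j=1..n. if j = i then of_nat (c i) / of_nat (k i) else 0)"
      using hh_eq[OF i] by (intro sum.cong) auto
    then show ?thesis using i by (simp add: of_rat_divide)
  qed
  obtain c :: "nat \<Rightarrow> nat" where "\<beta> = (\<lambda>x. \<Sum>j=1..n. of_nat (c j) * \<alpha> j x) \<or>
      \<beta> = (\<lambda>x. - (\<Sum>j=1..n. of_nat (c j) * \<alpha> j x))"
    using simple \<beta> unfolding simple_roots_def by blast
  then show ?thesis
  proof
    assume c: "\<beta> = (\<lambda>x. \<Sum>j=1..n. of_nat (c j) * \<alpha> j x)"
    then have "c i \<le> k i" using coefficient_le \<beta> i by simp
    then have "(of_nat (c i) / of_nat (k i) :: rat) \<le> 1" using k_pos[OF i] by (simp add: divide_le_eq)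
    with that show ?thesis unfolding c eval by blast
  next
    assume c: "\<beta> = (\<lambda>x. - (\<Sum>j=1..n. of_nat (c j) * \<alpha> j x))"
    have "- (of_nat (c i) / of_nat (k i) :: rat) \<le> 1" by (rule order_trans[of _ 0]) simp_all
    with that show ?thesis unfolding c eval of_rat_minus[symmetric] by blast
  qed
qed

text \<open>Besides the degree bounds of \<open>component_P_space\<close>, these two inequalities
  are all that is used of the spaces P_i later on.\<close>

lemma root_floor_le:
  assumes \<beta>: "\<beta> \<in> roots H" and i: "i \<le> n"
  shows "root_floor i \<beta> \<le> 1" "root_floor i \<beta> + root_floor i (\<lambda>h. - \<beta> h) \<le> 0"
proof -
  have "root_floor i \<beta> \<le> 1 \<and> root_floor i \<beta> + root_floor i (\<lambda>h. - \<beta> h) \<le> 0"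
  proof (cases "i = 0")
    case False
    then have "i \<in> {1..n}" using i by simp
    then obtain q :: rat where q: "\<beta> (hh i) = of_rat q" "q \<le> 1" by (rule root_at_hh[OF \<beta>])
    have "rat_floor (- (of_rat q :: 'f)) = \<lfloor>- q\<rfloor>" unfolding of_rat_minus[symmetric] by simp
    moreover have "\<lfloor>q\<rfloor> + \<lfloor>- q\<rfloor> \<le> 0" "\<lfloor>q\<rfloor> \<le> 1" using q(2) by linarith+
    ultimately show ?thesis using False by (simp add: root_floor_def q(1))
  qed (simp add: root_floor_def)
  then show "root_floor i \<beta> \<le> 1" "root_floor i \<beta> + root_floor i (\<lambda>h. - \<beta> h) \<le> 0" by auto
qed

lemma zero_not_root: "(\<lambda>_. 0) \<notin> roots H"
  by (simp add: roots_def)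

lemma component_P_space:
  assumes a: "a \<in> P_space i"
  shows "d > 0 \<Longrightarrow> component (\<lambda>_. 0) (fls_nth a d) = 0"
    and "\<beta> \<in> roots H \<Longrightarrow> d > root_floor i \<beta> \<Longrightarrow> component \<beta> (fls_nth a d) = 0"
proof -
  have "(d > 0 \<longrightarrow> component (\<lambda>_. 0) (fls_nth a d) = 0) \<and>
      (\<beta> \<in> roots H \<longrightarrow> d > root_floor i \<beta> \<longrightarrow> component \<beta> (fls_nth a d) = 0)"
  proof (cases "i = 0")
    case True
    then show ?thesis using a by (auto simp: P_space_def inv_poly_def root_floor_def component_0)
  next
    case False
    then obtain a0 b where ab: "a = a0 + (\<Sum>\<phi>\<in>roots H. fls_shift (- rat_floor (\<phi> (hh i))) (b \<phi>))"
      "a0 \<in> inv_poly H" "\<And>\<phi>. \<phi> \<in> roots H \<Longrightarrow> b \<phi> \<in> inv_poly (root_space H \<phi>)"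
      using a by (auto simp: P_space_def)
    \<comment> \<open>In each degree the sum defining \<open>P_space\<close> is already a weight
      decomposition, so its terms are the components.\<close>
    define c where "c \<phi> = (if \<phi> = (\<lambda>_. 0) then fls_nth a0 d else fls_nth (b \<phi>) (d - root_floor i \<phi>))" for \<phi>
    have sum: "(\<Sum>\<phi>\<in>weights. c \<phi>) = fls_nth a d"
    proof -
      have "(\<Sum>\<phi>\<in>roots H. c \<phi>) = (\<Sum>\<phi>\<in>roots H. fls_nth (b \<phi>) (d - root_floor i \<phi>))"
        using zero_not_root by (intro sum.cong) (auto simp: c_def)
      then show ?thesis
        using zero_not_root finite_roots False
        by (simp add: ab(1) sum_fls_nth c_def root_floor_def)
    qed
    have "c \<phi> \<in> root_space H \<phi>" if "\<phi> \<in> weights" for \<phi>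
      using that ab(2) ab(3)[of \<phi>] by (auto simp: c_def inv_poly_def root_space_0)
    from component_eqI[OF this sum] have "component \<phi> (fls_nth a d) = c \<phi>" if "\<phi> \<in> weights" for \<phi>
      using that by simp
    then show ?thesis
      using ab(2) ab(3)[of \<beta>] zero_not_root by (auto simp: c_def inv_poly_def)
  qed
  then show "d > 0 \<Longrightarrow> component (\<lambda>_. 0) (fls_nth a d) = 0"
    and "\<beta> \<in> roots H \<Longrightarrow> d > root_floor i \<beta> \<Longrightarrow> component \<beta> (fls_nth a d) = 0" by auto
qed

end

section \<open>Weight components of \<open>W\<close> modulo the diagonal\<close>

locale regular_decomposition_data = simple_lie_algebra_with_roots scale lie H n \<alpha> k hh
  for scale :: "'f::{alg_closed_field, field_char_0} \<Rightarrow> 'g::ab_group_add \<Rightarrow> 'g" (infixr "*s" 75)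
    and lie :: "'g \<Rightarrow> 'g \<Rightarrow> 'g" and H n \<alpha> k hh +
  fixes m :: nat and W :: "('g fls \<times> 'g poly) set"
  assumes m_pos: "m > 0" and regular: "regular_decomposition m W"
begin

lemma W_subset: "W \<subseteq> L_space m"
  and subspace_W: "L.subspace W"
  and W_lie: "u \<in> W \<Longrightarrow> v \<in> W \<Longrightarrow> L_lie m u v \<in> W"
  and W_direct_sum: "direct_sum (L_space m) [diag m, W]"
  and W_H: "h \<in> H \<Longrightarrow> w \<in> W \<Longrightarrow> L_lie m (fls_const h, poly_cutoff m [:h:]) w \<in> W"
  using regular unfolding regular_decomposition_def by blast+

lemma W_coeff: "(a, b) \<in> W \<Longrightarrow> i \<ge> m \<Longrightarrow> coeff b i = 0"
  using subsetD[OF W_subset] by (fastforce simp: L_space_def trunc_poly_iff)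

lemma W_shift: "(a, b) \<in> W \<Longrightarrow> (fls_shift 1 a, 0) \<in> W"
  and W_pCons: "(a, b) \<in> W \<Longrightarrow> (0, poly_cutoff m (pCons 0 b)) \<in> W"
  using regular by (auto simp: regular_decomposition_def)

lemma W_floor:
  obtains i where "i \<le> n" "\<And>a b d. (a, b) \<in> W \<Longrightarrow> d > 0 \<Longrightarrow> component (\<lambda>_. 0) (fls_nth a d) = 0"
    "\<And>a b d \<beta>. (a, b) \<in> W \<Longrightarrow> \<beta> \<in> roots H \<Longrightarrow> d > root_floor i \<beta> \<Longrightarrow> component \<beta> (fls_nth a d) = 0"
proof -
  obtain i where i: "i \<le> n" "W \<subseteq> P_space i \<times> trunc_poly m UNIV"
    using regular by (auto simp: regular_decomposition_def)
  then have "a \<in> P_space i" if "(a, b) \<in> W" for a b using that by blast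
  with i(1) that component_P_space show ?thesis by metis
qed

lemma W_add: "(a, b) \<in> W \<Longrightarrow> (a', b') \<in> W \<Longrightarrow> (a + a', b + b') \<in> W"
  using L.subspace_add[OF subspace_W, of "(a, b)" "(a', b')"] by simp

lemma W_diff: "(a, b) \<in> W \<Longrightarrow> (a', b') \<in> W \<Longrightarrow> (a - a', b - b') \<in> W"
  using L.subspace_diff[OF subspace_W, of "(a, b)" "(a', b')"] by simp

lemma W_scale: "(a, b) \<in> W \<Longrightarrow> (fls_scale c a, poly_scale c b) \<in> W"
  using L.subspace_scale[OF subspace_W, of "(a, b)" c] by (simp add: L_scale_Pair)

lemma W_0: "(0, 0) \<in> W"
  using L.subspace_0[OF subspace_W] by (simp add: zero_prod_def)

lemma diag_0: "0 \<in> diag m"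
proof -
  have "(fps_to_fls 0, fps_class m (0 :: 'g fps)) \<in> diag m" unfolding diag_def by blast
  then show ?thesis by (simp add: fps_class_def zero_prod_def)
qed

lemma W_diag_Int:
  assumes "w \<in> W" "w \<in> diag m"
  shows "w = 0"
proof -
  have inj: "inj_on sum_list (listset [diag m, W])"
    using W_direct_sum by (simp add: direct_sum_def bij_betw_def)
  \<comment> \<open>Both lists have sum w, and summation is injective on such lists.\<close>
  have "[w, 0] \<in> listset [diag m, W]" "[0, w] \<in> listset [diag m, W]"
    using assms diag_0 L.subspace_0[OF subspace_W] unfolding listset_Cons2 by blast+
  then have "[w, 0] = [0, w]" by (intro inj_onD[OF inj]) auto
  then show ?thesis by simp
qed

lemma W_diag_sum:
  assumes "u \<in> L_space m"
  obtains f where "u - (fps_to_fls f, fps_class m f) \<in> W"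
proof -
  have "u \<in> sum_list ` listset [diag m, W]"
    using W_direct_sum assms unfolding direct_sum_def bij_betw_def by blast
  then obtain xs where xs: "xs \<in> listset [diag m, W]" "u = sum_list xs" by blast
  then obtain v w where vw: "v \<in> diag m" "w \<in> W" "xs = [v, w]" unfolding listset_Cons2 by blast
  then obtain f where "v = (fps_to_fls f, fps_class m f)" by (auto simp: diag_def)
  with vw xs(2) show ?thesis by (intro that[of f]) (simp add: algebra_simps)
qed

text \<open>The constant term survives truncation because m > 0.\<close>

lemma L_lie_H:
  assumes "(a, b) \<in> W"
  shows "L_lie m (fls_const h, poly_cutoff m [:h:]) (a, b) = coeff_map (lie h) (a, b)"
proof -
  have "fls_const h = fls_mono 0 h" by (simp add: fls_eq_iff fls_mono_nth)
  moreover have "poly_cutoff m [:h:] = [:h:]"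
    using m_pos by (auto simp: poly_eq_iff coeff_poly_cutoff coeff_pCons split: nat.splits)
  ultimately show ?thesis
    using W_coeff[OF assms]
    by (auto simp: L_eq_iff L_lie_def coeff_map_nth fls_lie_mono_nth coeff_poly_cutoff poly_lie_const)
qed

lemma sum_coeff_map_component: "(\<Sum>\<beta>\<in>weights. coeff_map (component \<beta>) w) = w"
proof -
  have "fls_nth (fst (\<Sum>\<beta>\<in>weights. coeff_map (component \<beta>) w)) d = fls_nth (fst w) d" for d
  proof -
    have "fls_nth (fst (\<Sum>\<beta>\<in>weights. coeff_map (component \<beta>) w)) d = (\<Sum>\<beta>\<in>weights. component \<beta> (fls_nth (fst w) d))"
      unfolding fst_sum sum_fls_nth by (intro sum.cong refl coeff_map_nth component_0)
    then show ?thesis by (simp only: sum_component)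
  qed
  moreover have "coeff (snd (\<Sum>\<beta>\<in>weights. coeff_map (component \<beta>) w)) i = coeff (snd w) i" for i
  proof -
    have "coeff (snd (\<Sum>\<beta>\<in>weights. coeff_map (component \<beta>) w)) i = (\<Sum>\<beta>\<in>weights. component \<beta> (coeff (snd w) i))"
      unfolding snd_sum coeff_sum by (intro sum.cong refl coeff_map_nth component_0)
    then show ?thesis by (simp only: sum_component)
  qed
  ultimately show ?thesis by (simp only: L_eq_iff) blast
qed

text \<open>Stability under the single element \<open>sep\<close> is enough, as it acts on the
  components with distinct eigenvalues.\<close>

lemma coeff_map_component:
  assumes w: "w \<in> W" and \<gamma>: "\<gamma> \<in> weights"
  shows "coeff_map (component \<gamma>) w \<in> W"
proof (rule L.eigenvector_components[where T = "coeff_map (lie sep)" and g = "\<lambda>\<beta>. \<beta> sep" and S = weights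
      and w = "\<lambda>\<beta>. coeff_map (component \<beta>) w"])
  show "coeff_map (lie sep) u \<in> W" if "u \<in> W" for u
    using W_H[OF sep(1) that] L_lie_H[of "fst u" "snd u" sep] that by simp
  show "coeff_map (lie sep) (u + v) = coeff_map (lie sep) u + coeff_map (lie sep) v" for u v
    by (auto simp: L_eq_iff coeff_map_nth lie_add_right)
  show "coeff_map (lie sep) (L_scale c u) = L_scale c (coeff_map (lie sep) u)" for c u
    by (auto simp: L_eq_iff coeff_map_nth lie_scale_right L_scale_def)
  show "coeff_map (lie sep) (coeff_map (component \<beta>) w) = L_scale (\<beta> sep) (coeff_map (component \<beta>) w)"
    if "\<beta> \<in> weights" for \<beta>
    using component_in[OF that] component_0[OF that] sep(1)
    by (auto simp: L_eq_iff coeff_map_nth L_scale_def root_space_def)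
  show "(\<Sum>\<beta>\<in>weights. coeff_map (component \<beta>) w) \<in> W" using w by (simp only: sum_coeff_map_component)
qed (use subspace_W finite_weights sep(2) \<gamma> in auto)

text \<open>The source of all elements of \<open>W\<close> constructed below: a pair of weight
  \<gamma> is corrected by the diagonal and projected back to \<gamma>. The same series g is
  subtracted from both entries, up to truncation in the second.\<close>

lemma W_diag_root:
  assumes \<gamma>: "\<gamma> \<in> weights" and p: "\<And>d. fls_nth p d \<in> root_space H \<gamma>"
    and q: "\<And>i. coeff q i \<in> root_space H \<gamma>" "\<And>i. i \<ge> m \<Longrightarrow> coeff q i = 0"
  obtains a b g where "(a, b) \<in> W" "\<And>d. fls_nth a d \<in> root_space H \<gamma>" "\<And>i. coeff b i \<in> root_space H \<gamma>"
    "\<And>i. g i \<in> root_space H \<gamma>" "\<And>d. d < 0 \<Longrightarrow> fls_nth a d = fls_nth p d"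
    "\<And>i. fls_nth a (int i) = fls_nth p (int i) - g i" "\<And>i. i < m \<Longrightarrow> coeff b i = coeff q i - g i"
proof -
  have "(p, q) \<in> L_space m" using q(2) by (simp add: L_space_def trunc_poly_iff)
  then obtain f where f: "(p, q) - (fps_to_fls f, fps_class m f) \<in> W" by (rule W_diag_sum)
  define u where "u = coeff_map (component \<gamma>) ((p, q) - (fps_to_fls f, fps_class m f))"
  have uW: "u \<in> W" unfolding u_def by (rule coeff_map_component[OF f \<gamma>])
  have cc: "component \<gamma> x = x" if "x \<in> root_space H \<gamma>" for x using component_root_space[OF \<gamma> \<gamma> that] by simp
  have u: "fls_nth (fst u) d = fls_nth p d - (if d < 0 then 0 else component \<gamma> (fps_nth f (nat d)))"
    "coeff (snd u) i = coeff q i - (if i < m then component \<gamma> (fps_nth f i) else 0)" for d i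
    using cc[OF p[of d]] cc[OF q(1)[of i]]
    by (auto simp: u_def coeff_map_nth component_0[OF \<gamma>] component_diff[OF \<gamma>] coeff_fps_class)
  show ?thesis
  proof (rule that[of "fst u" "snd u" "\<lambda>i. component \<gamma> (fps_nth f i)"])
    show "fls_nth (fst u) d \<in> root_space H \<gamma>" for d
      by (simp add: u_def coeff_map_nth component_0[OF \<gamma>] component_in[OF \<gamma>])
    show "coeff (snd u) i \<in> root_space H \<gamma>" for i
      by (simp add: u_def coeff_map_nth component_0[OF \<gamma>] component_in[OF \<gamma>])
  qed (use uW in \<open>simp_all add: u component_in[OF \<gamma>]\<close>)
qed

lemma W_shift_funpow: "(fls_mono j u, 0) \<in> W \<Longrightarrow> (fls_mono (j - int l) u, 0) \<in> W"
proof (induction l)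
  case (Suc l)
  then have "(fls_shift 1 (fls_mono (j - int l) u), 0) \<in> W" using W_shift by blast
  moreover have "fls_shift 1 (fls_mono (j - int l) u) = fls_mono (j - int (Suc l)) u"
    by (auto simp: fls_eq_iff fls_mono_nth)
  ultimately show ?case by simp
qed simp

lemma L_lie_zero_const: "L_lie m (0, [:y:]) (a, b) = (0, poly_cutoff m (poly_lie [:y:] b))"
  by (simp add: L_lie_def fls_lie_0_left)

lemma L_lie_mono:
  "L_lie m (fls_mono i y, 0) (fls_mono j z, b) = (fls_mono (i + j) (lie y z), 0)"
  by (simp add: L_lie_def fls_lie_mono poly_lie_0_left)

lemma L_lie_const:
  "L_lie m (fls_mono 0 y, [:y':]) (fls_mono 0 z, [:z':]) = (fls_mono 0 (lie y z), [:lie y' z':])"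
proof -
  have "poly_cutoff m (poly_lie [:y':] [:z':]) = [:lie y' z':]"
    using m_pos by (auto simp: poly_eq_iff coeff_poly_cutoff poly_lie_const coeff_pCons split: nat.splits)
  then show ?thesis by (simp add: L_lie_def fls_lie_mono)
qed

section \<open>A root component that does not split\<close>

context
  fixes \<beta> a0 b0
  assumes \<beta>: "\<beta> \<in> roots H" and ab0: "(a0, b0) \<in> W"
    and R0: "\<And>d. fls_nth a0 d \<in> root_space H \<beta>" "\<And>i. coeff b0 i \<in> root_space H \<beta>"
    and nonsplit: "(a0, 0) \<notin> W"
begin

lemma nonsplit': "(0, b0) \<notin> W"
  using W_diff[OF ab0, of 0 b0] nonsplit by auto

lemma root_space_multiple:
  assumes "v \<in> root_space H \<beta>" "v \<noteq> 0" "u \<in> root_space H \<beta>"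
  obtains s where "u = s *s v"
proof -
  obtain e where "root_space H \<beta> = span {e}" using root_pair[OF \<beta>] by metis
  then obtain c d where "v = c *s e" "u = d *s e" using assms by (auto simp: span_singleton)
  with assms(2) show ?thesis by (intro that[of "d / c"]) auto
qed

text \<open>As the root space is a line, the second entries of \<open>W\<close> at \<beta> amount to
  an ideal of F[x]/x^m, which is generated by a power of x. This is the exponent.\<close>

definition min_order :: nat where
  "min_order = (LEAST i. \<exists>a b. (a, b) \<in> W \<and> (\<forall>d. fls_nth a d \<in> root_space H \<beta>) \<and>
     (\<forall>i. coeff b i \<in> root_space H \<beta>) \<and> coeff b i \<noteq> 0)"

lemma min_order_attained:
  obtains a b where "(a, b) \<in> W" "\<And>i. coeff b i \<in> root_space H \<beta>" "coeff b min_order \<noteq> 0"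
proof -
  have "b0 \<noteq> 0" using nonsplit ab0 by auto
  then obtain i where "coeff b0 i \<noteq> 0" by (auto simp: poly_eq_iff)
  then have "\<exists>i. \<exists>a b. (a, b) \<in> W \<and> (\<forall>d. fls_nth a d \<in> root_space H \<beta>) \<and>
     (\<forall>i. coeff b i \<in> root_space H \<beta>) \<and> coeff b i \<noteq> 0" using ab0 R0 by blast
  from LeastI_ex[OF this] that show ?thesis unfolding min_order_def[symmetric] by blast
qed

lemma below_min_order:
  assumes "(a, b) \<in> W" "\<And>d. fls_nth a d \<in> root_space H \<beta>" "\<And>i. coeff b i \<in> root_space H \<beta>" "i < min_order"
  shows "coeff b i = 0"
  using not_less_Least[OF assms(4)[unfolded min_order_def]] assms(1-3) by blast

lemma min_order_less: "min_order < m"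
proof -
  obtain a b where "(a, b) \<in> W" "coeff b min_order \<noteq> 0" by (rule min_order_attained)
  then show ?thesis using W_coeff[of a b min_order] by force
qed

text \<open>Multiplying an element of minimal order by [x] replaces its first entry by 0. The
  resulting pairs have all orders from \<open>min_order + 1\<close> to m - 1 and eliminate the
  coefficients of b one by one.\<close>

lemma above_min_order:
  assumes R: "\<And>i. coeff b i \<in> root_space H \<beta>" and m: "\<And>i. i \<ge> m \<Longrightarrow> coeff b i = 0"
    and min_order: "\<And>i. i \<le> min_order \<Longrightarrow> coeff b i = 0"
  shows "(0, b) \<in> W"
proof -
  obtain a1 b1 where 1: "(a1, b1) \<in> W" "\<And>i. coeff b1 i \<in> root_space H \<beta>" "coeff b1 min_order \<noteq> 0"
    by (rule min_order_attained) blast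
  have low1: "coeff b1 i = 0" if "i < min_order" for i
  proof -
    have "(coeff_map (component \<beta>) (a1, b1)) \<in> W" using coeff_map_component[OF 1(1)] \<beta> by simp
    moreover have "component \<beta> (coeff b1 i) = coeff b1 i" for i using component_root_space[of \<beta> \<beta>] \<beta> 1(2) by simp
    ultimately show ?thesis
      using below_min_order[of "fst (coeff_map (component \<beta>) (a1, b1))" "snd (coeff_map (component \<beta>) (a1, b1))" i] that \<beta> 1(2)
      by (simp add: coeff_map_nth component_0 component_in)
  qed
  define sh where "sh l = ((\<lambda>b. poly_cutoff m (pCons 0 b)) ^^ l) b1" for l
  have sh: "coeff (sh l) i = (if i < m \<and> l \<le> i then coeff b1 (i - l) else 0)" for l i
  proof (induction l arbitrary: i)
    case 0
    then show ?case using W_coeff[OF 1(1), of i] by (simp add: sh_def)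
  next
    case (Suc l)
    have "sh (Suc l) = poly_cutoff m (pCons 0 (sh l))" by (simp add: sh_def)
    then show ?case using Suc.IH[of "i - 1"] by (auto simp: coeff_poly_cutoff coeff_pCons split: nat.splits)
  qed
  have shW: "(0, sh (Suc l)) \<in> W" for l
  proof (induction l)
    case 0
    then show ?case using W_pCons[OF 1(1)] by (simp add: sh_def)
  next
    case (Suc l)
    then show ?case using W_pCons[OF Suc] by (simp add: sh_def)
  qed
  have "(0, b) \<in> W" if "j \<le> m" "min_order < j" "\<And>i. coeff b i \<in> root_space H \<beta>" "\<And>i. i \<ge> m \<Longrightarrow> coeff b i = 0"
    "\<And>i. i < j \<Longrightarrow> coeff b i = 0" for j b
    using that
  proof (induction arbitrary: b rule: inc_induct)
    case base
    then have "b = 0" by (metis coeff_0 leI poly_eqI)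
    then show ?case using W_0 by simp
  next
    case (step j)
    obtain s where s: "coeff b j = s *s coeff b1 min_order"
      using root_space_multiple[OF 1(2) 1(3) step.prems(2)] .
    define b' where "b' = b - poly_scale s (sh (j - min_order))"
    have b': "coeff b' i = coeff b i - s *s (if i < m \<and> j - min_order \<le> i then coeff b1 (i - (j - min_order)) else 0)" for i
      by (simp add: b'_def sh)
    have "(0, b') \<in> W"
    proof (rule step.IH)
      show "coeff b' i \<in> root_space H \<beta>" for i
        unfolding b' using step.prems(2) 1(2) subspace_root_space
        by (auto intro!: subspace_diff subspace_scale subspace_0)
      show "coeff b' i = 0" if "i < Suc j" for i
      proof (cases "i = j")
        case True
        then show ?thesis using s step.prems(1) step.hyps by (simp add: b')
      next
        case False
        then have "i < j" using that by simp
        moreover from this have "j - min_order \<le> i \<Longrightarrow> i - (j - min_order) < min_order" using step.prems(1) by linarith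
        ultimately show ?thesis using step.prems(4) low1 by (simp add: b')
      qed
    qed (use step.prems in \<open>auto simp: b'\<close>)
    \<comment> \<open>At least one shift is made because \<open>min_order < j\<close>; only then is
      the first entry 0.\<close>
    moreover have "(0, sh (j - min_order)) \<in> W" using shW[of "j - min_order - 1"] step.prems(1) by (simp add: Suc_diff_Suc)
    then have "(0, poly_scale s (sh (j - min_order))) \<in> W"
      using W_scale[of 0 _ s] by (metis fls_eqI fls_scale_nth fls_zero_nth scale_zero_right)
    ultimately have "(0 + 0, b' + poly_scale s (sh (j - min_order))) \<in> W" by (rule W_add)
    then show ?case by (simp add: b'_def)
  qed
  from this[of "Suc min_order" b] show ?thesis using assms min_order_less by simp
qed

lemma coeff_b0_min_order: "coeff b0 min_order \<noteq> 0"
proof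
  assume "coeff b0 min_order = 0"
  then have "coeff b0 i = 0" if "i \<le> min_order" for i
    using below_min_order[OF ab0 R0, of i] that by (cases "i = min_order") auto
  then have "(0, b0) \<in> W" using R0(2) W_coeff[OF ab0] by (intro above_min_order)
  with nonsplit' show False ..
qed

text \<open>Otherwise a multiple of b cancels the lowest coefficient of \<open>b0\<close>, the rest
  is covered by \<open>above_min_order\<close>, and \<open>(0, b0)\<close> would lie in
  \<open>W\<close>.\<close>

lemma min_order_coeff_eq_0:
  assumes b: "(0, b) \<in> W" "\<And>i. coeff b i \<in> root_space H \<beta>"
  shows "coeff b min_order = 0"
proof (rule ccontr)
  assume nz: "coeff b min_order \<noteq> 0"
  obtain s where s: "coeff b0 min_order = s *s coeff b min_order" by (rule root_space_multiple[OF b(2) nz R0(2)])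
  have zero: "fls_nth (0 :: 'g fls) d \<in> root_space H \<beta>" for d by (simp add: subspace_0[OF subspace_root_space])
  have "(0, b0 - poly_scale s b) \<in> W"
  proof (rule above_min_order)
    show "coeff (b0 - poly_scale s b) i \<in> root_space H \<beta>" for i
      using R0(2) b(2) by (auto intro!: subspace_diff subspace_scale subspace_root_space)
    show "coeff (b0 - poly_scale s b) i = 0" if "i \<ge> m" for i
      using that W_coeff[OF ab0] W_coeff[OF b(1)] by simp
    show "coeff (b0 - poly_scale s b) i = 0" if "i \<le> min_order" for i
      using that s below_min_order[OF ab0 R0, of i] below_min_order[OF b(1) zero b(2), of i] by (cases "i = min_order") auto
  qed
  from W_add[OF this W_scale[OF b(1), of s]] have "(0, b0) \<in> W" by (simp add: fls_scale_0)
  with nonsplit' show False ..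
qed

text \<open>Stability under x^-1 would give all monomials of degree up to j at \<beta>, and
  \<open>a0\<close> is a sum of such.\<close>

lemma fls_mono_notin_W:
  assumes top: "\<And>d. d > F \<Longrightarrow> fls_nth a0 d = 0" and "F \<le> j"
    and u: "u \<in> root_space H \<beta>" "u \<noteq> 0"
  shows "(fls_mono j u, 0) \<notin> W"
proof
  assume W: "(fls_mono j u, 0) \<in> W"
  have mono: "(fls_mono d (fls_nth a0 d), 0) \<in> W" for d
  proof (cases "d \<le> j")
    case True
    obtain s where s: "fls_nth a0 d = s *s u" by (rule root_space_multiple[OF u R0(1)])
    have "(fls_mono d u, 0) \<in> W" using W_shift_funpow[OF W, of "nat (j - d)"] True by simp
    then show ?thesis using W_scale[of "fls_mono d u" 0 s] by (simp add: fls_scale_mono s poly_scale_0)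
  next
    case False
    then have "fls_nth a0 d = 0" using top \<open>F \<le> j\<close> by simp
    then have "fls_mono d (fls_nth a0 d) = 0" by (simp add: fls_eq_iff fls_mono_nth)
    then show ?thesis using W_0 by simp
  qed
  let ?S = "{fls_subdegree a0..F}"
  have "(\<Sum>d\<in>?S. (fls_mono d (fls_nth a0 d), 0)) \<in> W"
    using mono by (rule L.subspace_sum[OF subspace_W])
  moreover have "(\<Sum>d\<in>?S. fls_mono d (fls_nth a0 d)) = a0"
  proof (rule fls_eqI)
    fix d
    have "fls_nth (\<Sum>d\<in>?S. fls_mono d (fls_nth a0 d)) d = (\<Sum>i\<in>?S. if i = d then fls_nth a0 d else 0)"
      unfolding sum_fls_nth by (intro sum.cong) (auto simp: fls_mono_nth)
    also have "\<dots> = fls_nth a0 d" using top by (auto simp: not_le)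
    finally show "fls_nth (\<Sum>d\<in>?S. fls_mono d (fls_nth a0 d)) d = fls_nth a0 d" .
  qed
  ultimately have "(a0, 0) \<in> W" by (simp add: sum_prod)
  with nonsplit show False ..
qed

end

text \<open>If \<open>(a0, b0) \<in> W\<close> with \<open>(a0, 0) \<notin> W\<close>, then, as the root space is a line, \<open>W\<close> contains
  \<open>(0, b)\<close> in this root space only for \<open>b\<close> of order above \<open>min_order\<close>. Complementarity to the
  diagonal bounds \<open>min_order\<close> by the floor of the root, which is at most 1, and supplies elements of
  \<open>W\<close> in the opposite root space. Bracketing twice with the latter gives a contradiction.\<close>

lemma W_root_split:
  assumes \<beta>: "\<beta> \<in> roots H" and ab0: "(a0, b0) \<in> W"
    and R0: "\<And>d. fls_nth a0 d \<in> root_space H \<beta>" "\<And>i. coeff b0 i \<in> root_space H \<beta>"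
  shows "(a0, 0) \<in> W"
proof (rule ccontr)
  assume non: "(a0, 0) \<notin> W"
  note ctx = \<beta> ab0 R0 non
  obtain e f \<tau> where e: "root_space H \<beta> = span {e}" "root_space H (\<lambda>h. - \<beta> h) = span {f}"
    "lie e f \<in> H" "\<tau> \<noteq> 0" "e \<noteq> 0" "lie (lie e f) e = \<tau> *s e" "(\<lambda>h. - \<beta> h) \<in> roots H"
    by (rule root_pair[OF \<beta>])
  have eR: "e \<in> root_space H \<beta>" and fR: "f \<in> root_space H (\<lambda>h. - \<beta> h)" by (auto simp: e span_base)
  have zR: "0 \<in> root_space H \<gamma>" for \<gamma> by (rule subspace_0[OF subspace_root_space])
  have \<beta>w: "\<beta> \<in> weights" and \<beta>w': "(\<lambda>h. - \<beta> h) \<in> weights" using \<beta> e by auto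
  \<comment> \<open>For multiples of e the double bracket is again a multiple of e, by minus the
    product of both factors and \<tau>. So it stays on the line and does not vanish for equal
    nonzero arguments.\<close>
  have fef: "lie (lie f u) v \<in> root_space H \<beta>" "u \<noteq> 0 \<Longrightarrow> lie (lie f u) u \<noteq> 0"
    if uv: "u \<in> root_space H \<beta>" "v \<in> root_space H \<beta>" for u v
  proof -
    obtain s r where s: "u = s *s e" and r: "v = r *s e" using uv e(1) by (auto simp: span_singleton)
    have *: "lie (lie f (s *s e)) (r *s e) = (- (s * r * \<tau>)) *s e" for s r
      by (simp add: lie_scale_left lie_scale_right lie_anticomm[of f e] lie_minus_left e(6) mult_ac)
    show "lie (lie f u) v \<in> root_space H \<beta>"
      unfolding s r * by (intro subspace_scale[OF subspace_root_space] eR)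
    show "lie (lie f u) u \<noteq> 0" if "u \<noteq> 0"
      using that e(4,5) unfolding s * by simp
  qed
  obtain N where N: "N \<le> n" and floor: "\<And>a b d \<gamma>. (a, b) \<in> W \<Longrightarrow> \<gamma> \<in> roots H \<Longrightarrow> d > root_floor N \<gamma> \<Longrightarrow> component \<gamma> (fls_nth a d) = 0"
    by (rule W_floor) blast
  have top: "fls_nth a d = 0"
    if "(a, b) \<in> W" "\<gamma> \<in> roots H" "fls_nth a d \<in> root_space H \<gamma>" "d > root_floor N \<gamma>" for a b d \<gamma>
    using floor[OF that(1,2,4)] component_root_space[OF _ _ that(3), of \<gamma>] that(2) by simp
  define F where "F = root_floor N \<beta>"
  define F' where "F' = root_floor N (\<lambda>h. - \<beta> h)"
  have F: "F \<le> 1" "F + F' \<le> 0" using root_floor_le[OF \<beta> N] by (simp_all add: F_def F'_def)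
  note top\<beta> = top[OF _ \<beta>, folded F_def] and top\<beta>' = top[OF _ e(7), folded F'_def]
  let ?d = "min_order \<beta>"
  have min_order_m: "?d < m" by (rule min_order_less[OF ctx])
  have no1: "(fls_mono j u, 0) \<notin> W" if "F \<le> j" "u \<in> root_space H \<beta>" "u \<noteq> 0" for j u
    by (rule fls_mono_notin_W[OF ctx top\<beta>[OF ab0 R0(1)] that])
  note no2 = min_order_coeff_eq_0[OF ctx]
  \<comment> \<open>From (0, e x^d), with d the minimal order, this yields a polynomial a in x and b
    = e x^d + [a]. Since b has order at least d, so has a; and a = 0 would contradict
    \<open>no2\<close>. Hence d is at most the top degree \<open>F\<close>.\<close>
  obtain a b g where ab: "(a, b) \<in> W" "\<And>d. fls_nth a d \<in> root_space H \<beta>" "\<And>i. coeff b i \<in> root_space H \<beta>"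
    and g: "\<And>i. g i \<in> root_space H \<beta>" "\<And>d. d < 0 \<Longrightarrow> fls_nth a d = fls_nth 0 d"
    "\<And>i. fls_nth a (int i) = fls_nth 0 (int i) - g i" "\<And>i. i < m \<Longrightarrow> coeff b i = coeff (monom e ?d) i - g i"
  proof (rule W_diag_root[OF \<beta>w, of 0 "monom e ?d"])
    show "coeff (monom e ?d) i = 0" if "i \<ge> m" for i using that min_order_m by simp
  qed (use eR zR in \<open>auto\<close>)
  have low: "fls_nth a (int i) = 0" if "i < ?d" for i
    using below_min_order[OF ctx ab that] g(3,4)[of i] that min_order_m by simp
  have "a \<noteq> 0"
  proof
    assume "a = 0"
    then have "coeff b ?d = e" using g(3,4)[of ?d] min_order_m by simp
    moreover have "(0, b) \<in> W" using ab(1) \<open>a = 0\<close> by simp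
    ultimately show False using no2[OF _ ab(3)] e(5) by simp
  qed
  then obtain l where l: "fls_nth a l \<noteq> 0" by (auto simp: fls_eq_iff)
  have "l \<ge> int ?d"
  proof (rule ccontr)
    assume "\<not> ?thesis"
    then have "fls_nth a l = 0" using low[of "nat l"] g(2)[of l] by (cases "l < 0") auto
    with l show False ..
  qed
  moreover have "l \<le> F" using top\<beta>[OF ab(1,2), of l] l by (meson not_le)
  ultimately have dF: "int ?d \<le> F" by simp
  show False
  proof (cases "F' < 0")
    case True
    \<comment> \<open>First entries of \<open>W\<close> at -\<beta> have only negative degrees,
      which the diagonal cannot change, so the correction g is 0. Thus \<open>W\<close> contains
      every pair at -\<beta> whose first entry has negative degrees only.\<close>
    have dual: "(p, q) \<in> W"
      if p: "\<And>d. fls_nth p d \<in> root_space H (\<lambda>h. - \<beta> h)" "\<And>d. d \<ge> 0 \<Longrightarrow> fls_nth p d = 0"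
        and q: "\<And>i. coeff q i \<in> root_space H (\<lambda>h. - \<beta> h)" "\<And>i. i \<ge> m \<Longrightarrow> coeff q i = 0" for p q
    proof -
      obtain a b g where ab: "(a, b) \<in> W" "\<And>d. fls_nth a d \<in> root_space H (\<lambda>h. - \<beta> h)"
        and g: "\<And>d. d < 0 \<Longrightarrow> fls_nth a d = fls_nth p d"
        "\<And>i. fls_nth a (int i) = fls_nth p (int i) - g i" "\<And>i. i < m \<Longrightarrow> coeff b i = coeff q i - g i"
        by (rule W_diag_root[OF \<beta>w' p(1) q]) auto
      have a0: "fls_nth a d = 0" if "d \<ge> 0" for d using top\<beta>'[OF ab(1,2)] that True by simp
      then have "g i = 0" for i using g(2)[of i] p(2)[of "int i"] by simp
      then have "coeff b i = coeff q i" for i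
        using g(3)[of i] q(2)[of i] W_coeff[OF ab(1), of i] by (cases "i < m") auto
      moreover have "fls_nth a d = fls_nth p d" for d
        using g(1)[of d] a0[of d] p(2)[of d] by (cases "d < 0") auto
      ultimately have "a = p" "b = q" by (auto simp: fls_eq_iff poly_eq_iff)
      with ab(1) show ?thesis by simp
    qed
    show False
    proof (cases "?d = 0")
      case d0: True
      \<comment> \<open>Two brackets leave first entry 0 and a second entry with constant term
        [[f, u], u], where u is the nonzero constant term of \<open>b0\<close>. This contradicts
        \<open>no2\<close>.\<close>
      have "(0, [:f:]) \<in> W"
        by (rule dual) (use m_pos fR zR in \<open>auto simp: coeff_pCons split: nat.splits\<close>)
      from W_lie[OF this ab0] have "(0, poly_cutoff m (poly_lie [:f:] b0)) \<in> W"
        by (simp add: L_lie_zero_const)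
      from W_lie[OF this ab0] have "(0, poly_cutoff m (poly_lie (poly_cutoff m (poly_lie [:f:] b0)) b0)) \<in> W"
        (is "(0, ?b) \<in> W") by (simp add: L_lie_def fls_lie_0_left)
      moreover have coeff: "coeff ?b i = (if i < m then \<Sum>j\<le>i. lie (lie f (coeff b0 j)) (coeff b0 (i - j)) else 0)" for i
        by (auto simp: coeff_poly_cutoff coeff_poly_lie[of "poly_cutoff m (poly_lie [:f:] b0)"] poly_lie_const
            intro!: sum.cong)
      then have "coeff ?b i \<in> root_space H \<beta>" for i
        using fef(1)[OF R0(2) R0(2)] zR subspace_root_space by (auto intro: subspace_sum)
      ultimately have "coeff ?b ?d = 0" by (rule no2)
      then have "lie (lie f (coeff b0 0)) (coeff b0 0) = 0" using coeff[of 0] d0 m_pos by simp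
      then show False using fef(2)[OF R0(2) R0(2)] coeff_b0_min_order[OF ctx] d0 by metis
    next
      case d1: False
      \<comment> \<open>Here a lies between the degrees d = 1 and \<open>F = 1\<close>, so it is the
        monomial u x. Two brackets, with f x^-1 in between, return to degree 1 with first entry
        [[f, u], u] x and second entry 0, against \<open>no1\<close>.\<close>
      with dF F have F1: "F = 1" "?d = 1" by linarith+
      let ?u = "fls_nth a 1"
      have a: "a = fls_mono 1 ?u"
      proof (rule fls_eqI)
        fix d :: int
        consider "d < 0" | "d = 0" | "d = 1" | "d > 1" by linarith
        then show "fls_nth a d = fls_nth (fls_mono 1 ?u) d"
          by cases (use g(2)[of d] low[of 0] F1 top\<beta>[OF ab(1,2), of d] in \<open>auto simp: fls_mono_nth\<close>)
      qed
      then have u: "?u \<noteq> 0" using \<open>a \<noteq> 0\<close> by (metis fls_eqI fls_mono_nth fls_zero_nth)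
      have "(fls_mono (-1) f, 0) \<in> W"
        by (rule dual) (use fR zR in \<open>auto simp: fls_mono_nth\<close>)
      moreover have abW: "(fls_mono 1 ?u, b) \<in> W" using ab(1) a by metis
      ultimately have "L_lie m (fls_mono (-1) f, 0) (fls_mono 1 ?u, b) \<in> W" by (rule W_lie)
      then have "(fls_mono 0 (lie f ?u), 0) \<in> W" by (simp add: L_lie_mono)
      from W_lie[OF this abW] have "(fls_mono 1 (lie (lie f ?u) ?u), 0) \<in> W" by (simp add: L_lie_mono)
      moreover have "(fls_mono 1 (lie (lie f ?u) ?u), 0) \<notin> W"
        using F fef(1)[OF ab(2) ab(2)] fef(2)[OF ab(2) ab(2) u] by (intro no1) auto
      ultimately show False by simp
    qed
  next
    case False
    \<comment> \<open>Now the pairs obtained from the diagonal are constant: (s e, c e) at \<beta>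
      with c = 1 + s, and at -\<beta>, starting from (f, 0), the pair ((1 - \<gamma>) f, - \<gamma>
      f).\<close>
    with dF F have d0: "F = 0" "?d = 0" "F' = 0" by linarith+
    let ?u = "fls_nth a 0"
    have a: "a = fls_mono 0 ?u"
    proof (rule fls_eqI)
      fix d :: int
      consider "d < 0" | "d = 0" | "d > 0" by linarith
      then show "fls_nth a d = fls_nth (fls_mono 0 ?u) d"
        by cases (use g(2)[of d] d0 top\<beta>[OF ab(1,2), of d] in \<open>auto simp: fls_mono_nth\<close>)
    qed
    have "g i = 0" if "i > 0" for i using g(3)[of i] top\<beta>[OF ab(1,2), of "int i"] that d0 by simp
    then have "coeff b i = coeff [:e + ?u:] i" for i
      using g(4)[of i] g(3)[of 0] W_coeff[OF ab(1), of i] d0 m_pos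
      by (cases "i < m") (auto simp: coeff_pCons split: nat.splits)
    then have b: "b = [:e + ?u:]" by (simp add: poly_eq_iff)
    obtain s where s: "?u = s *s e" using ab(2)[of 0] e(1) by (auto simp: span_singleton)
    define c where "c = 1 + s"
    have c: "e + ?u = c *s e" by (simp add: c_def s scale_left_distrib)
    have W1: "(fls_mono 0 (s *s e), [:c *s e:]) \<in> W" using ab(1) a b c s by metis
    have s0: "s \<noteq> 0" using \<open>a \<noteq> 0\<close> a s by (metis fls_eqI fls_mono_nth fls_zero_nth scale_zero_left)
    have seR: "s *s e \<in> root_space H \<beta>" using ab(2)[of 0] s by simp
    have c0: "c \<noteq> 0"
    proof
      assume "c = 0"
      then have "(fls_mono 0 (s *s e), 0) \<in> W" using W1 by simp
      then show False using no1[of 0 "s *s e"] seR s0 e(5) d0 by simp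
    qed
    have pf: "fls_nth (fls_mono 0 f) d \<in> root_space H (\<lambda>h. - \<beta> h)" for d using fR zR by (simp add: fls_mono_nth)
    obtain a' b' g' where ab': "(a', b') \<in> W" "\<And>d. fls_nth a' d \<in> root_space H (\<lambda>h. - \<beta> h)"
      and g': "\<And>i. g' i \<in> root_space H (\<lambda>h. - \<beta> h)" "\<And>d. d < 0 \<Longrightarrow> fls_nth a' d = fls_nth (fls_mono 0 f) d"
      "\<And>i. fls_nth a' (int i) = fls_nth (fls_mono 0 f) (int i) - g' i" "\<And>i. i < m \<Longrightarrow> coeff b' i = coeff 0 i - g' i"
    proof (rule W_diag_root[OF \<beta>w' pf, of 0])
    qed (use zR in auto)
    obtain \<gamma> where \<gamma>: "g' 0 = \<gamma> *s f" using g'(1)[of 0] e(2) by (auto simp: span_singleton)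
    have a': "a' = fls_mono 0 ((1 - \<gamma>) *s f)"
    proof (rule fls_eqI)
      fix d :: int
      consider "d < 0" | "d = 0" | "d > 0" by linarith
      then show "fls_nth a' d = fls_nth (fls_mono 0 ((1 - \<gamma>) *s f)) d"
        by cases (use g'(2)[of d] g'(3)[of 0] \<gamma> d0 top\<beta>'[OF ab'(1,2), of d] in
            \<open>auto simp: fls_mono_nth scale_left_diff_distrib\<close>)
    qed
    have "g' i = 0" if "i > 0" for i
      using g'(3)[of i] top\<beta>'[OF ab'(1,2), of "int i"] that d0 by (simp add: fls_mono_nth)
    then have "coeff b' i = coeff [:- \<gamma> *s f:] i" for i
      using g'(4)[of i] \<gamma> W_coeff[OF ab'(1), of i] m_pos
      by (cases "i < m") (auto simp: coeff_pCons split: nat.splits)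
    then have b': "b' = [:- \<gamma> *s f:]" by (simp add: poly_eq_iff)
    \<comment> \<open>The bracket of the two pairs is (A t, C t) with t = [e, f]. Bracketing with (s
      e, c e) and subtracting A \<tau> times that pair leaves (0, (C - A) c \<tau> e), so A = C by
      \<open>no2\<close>. Then (A t, C t) is diagonal and vanishes, which forces \<gamma> = 1 and
      \<gamma> = 0, as s and c are nonzero.\<close>
    define A where "A = s * (1 - \<gamma>)"
    define C where "C = - c * \<gamma>"
    have "L_lie m (fls_mono 0 (s *s e), [:c *s e:]) (fls_mono 0 ((1 - \<gamma>) *s f), [:- \<gamma> *s f:]) \<in> W"
      using W1 ab'(1) unfolding a' b' by (rule W_lie)
    then have W2: "(fls_mono 0 (A *s lie e f), [:C *s lie e f:]) \<in> W"
      unfolding L_lie_const by (simp add: lie_scale_left lie_scale_right lie_minus_right A_def C_def mult_ac)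
    have "L_lie m (fls_mono 0 (A *s lie e f), [:C *s lie e f:]) (fls_mono 0 (s *s e), [:c *s e:]) \<in> W"
      using W2 W1 by (rule W_lie)
    then have W3: "(fls_mono 0 ((A * s * \<tau>) *s e), [:(C * c * \<tau>) *s e:]) \<in> W"
      unfolding L_lie_const by (simp add: lie_scale_left lie_scale_right e(6) mult_ac)
    from W_diff[OF W3 W_scale[OF W1, of "A * \<tau>"]]
    have "(0, [:((C - A) * c * \<tau>) *s e:]) \<in> W" (is "(0, ?p) \<in> W")
    proof (rule back_subst[of "\<lambda>u. u \<in> W"])
      show "(fls_mono 0 ((A * s * \<tau>) *s e) - fls_scale (A * \<tau>) (fls_mono 0 (s *s e)),
          [:(C * c * \<tau>) *s e:] - poly_scale (A * \<tau>) [:c *s e:]) = (0, ?p)"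
        by (auto simp: fls_eq_iff fls_mono_nth poly_eq_iff coeff_pCons mult_ac algebra_simps split: nat.splits)
    qed
    moreover have "coeff ?p i \<in> root_space H \<beta>" for i
      using eR zR subspace_scale[OF subspace_root_space eR] by (auto simp: coeff_pCons split: nat.splits)
    ultimately have "coeff ?p ?d = 0" by (rule no2)
    then have AC: "A = C" using c0 e(4,5) d0 by simp
    have "(fls_mono 0 (A *s lie e f), [:C *s lie e f:]) \<in> diag m"
    proof -
      have "fls_mono 0 (A *s lie e f) = fps_to_fls (fps_const (A *s lie e f))"
        by (auto simp: fls_eq_iff fls_mono_nth fps_to_fls_nth)
      moreover have "[:C *s lie e f:] = fps_class m (fps_const (A *s lie e f))"
        using m_pos AC by (auto simp: poly_eq_iff coeff_fps_class coeff_pCons split: nat.splits)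
      ultimately show ?thesis unfolding diag_def by blast
    qed
    with W2 have "(fls_mono 0 (A *s lie e f), [:C *s lie e f:]) = 0" by (rule W_diag_Int)
    then have "C *s lie e f = 0" by (simp add: zero_prod_def)
    moreover have "lie e f \<noteq> 0" using e(4,5,6) by auto
    ultimately have "C = 0" by simp
    then have "\<gamma> = 1" "\<gamma> = 0" using AC s0 c0 by (auto simp: A_def C_def)
    then show False by simp
  qed
qed

section \<open>Assembly of the decomposition\<close>

lemma decomposition:
  assumes mem_plus: "\<And>a. a \<in> I_plus \<longleftrightarrow> a \<in> x_inv_poly UNIV \<and> (a, 0) \<in> W"
    and mem_minus: "\<And>b. b \<in> I_minus \<longleftrightarrow> (0, b) \<in> W"
  obtains W_h where "L.subspace W_h" "W_h \<subseteq> inv_poly H \<times> trunc_poly m H"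
    "direct_sum W [W_h, I_plus \<times> {0}, {0} \<times> I_minus]"
proof -
  define W0 where "W0 = {u \<in> W. (\<forall>d. fls_nth (fst u) d \<in> H) \<and> (\<forall>i. coeff (snd u) i \<in> H)}"
  have sW0: "L.subspace W0"
    by (rule L.subspaceI)
      (auto simp: W0_def L_scale_def subspace_0[OF subspace_H] L.subspace_0[OF subspace_W]
        intro: L.subspace_add[OF subspace_W] L.subspace_scale[OF subspace_W, unfolded L_scale_def]
          subspace_add[OF subspace_H] subspace_scale[OF subspace_H])
  have plus_0: "0 \<in> I_plus" and minus_0: "0 \<in> I_minus"
    using W_0 by (simp_all add: mem_plus mem_minus x_inv_poly_UNIV)
  have plus_add: "a + a' \<in> I_plus" if "a \<in> I_plus" "a' \<in> I_plus" for a a'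
    using that W_add[of a 0 a' 0] by (simp add: mem_plus x_inv_poly_UNIV)
  have plus_diff: "a - a' \<in> I_plus" if "a \<in> I_plus" "a' \<in> I_plus" for a a'
    using that W_diff[of a 0 a' 0] by (simp add: mem_plus x_inv_poly_UNIV)
  have plus_scale: "fls_scale c a \<in> I_plus" if "a \<in> I_plus" for a c
    using that W_scale[of a 0 c] by (simp add: mem_plus x_inv_poly_UNIV poly_scale_0)
  have minus_add: "b + b' \<in> I_minus" if "b \<in> I_minus" "b' \<in> I_minus" for b b'
    using that W_add[of 0 b 0 b'] by (simp add: mem_minus)
  have minus_diff: "b - b' \<in> I_minus" if "b \<in> I_minus" "b' \<in> I_minus" for b b'
    using that W_diff[of 0 b 0 b'] by (simp add: mem_minus)
  have minus_scale: "poly_scale c b \<in> I_minus" if "b \<in> I_minus" for b c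
    using that W_scale[of 0 b c] by (simp add: mem_minus fls_scale_0)
  have sI: "L.subspace (I_plus \<times> I_minus)" "L.subspace (I_plus \<times> {0})" "L.subspace ({0} \<times> I_minus)"
    by (rule L.subspaceI; force simp: L_scale_Pair zero_prod_def plus_0 minus_0 plus_add minus_add plus_scale
        minus_scale fls_scale_0 poly_scale_0)+
  have IW: "I_plus \<times> I_minus \<subseteq> W"
    using W_add[of _ 0 0] by (fastforce simp: mem_plus mem_minus)
  \<comment> \<open>Stability under x^-1 and [x] already puts pairs with entries in \<open>H\<close>
    into the product of \<open>I_plus\<close> and \<open>I_minus\<close>, so \<open>W0\<close>
    itself would not give a direct sum.\<close>
  obtain W_h where Wh: "L.subspace W_h" "W_h \<subseteq> W0" "W_h \<inter> (W0 \<inter> I_plus \<times> I_minus) = {0}"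
    and compl: "\<And>v. v \<in> W0 \<Longrightarrow> \<exists>w\<in>W_h. v - w \<in> W0 \<inter> I_plus \<times> I_minus"
    by (rule L.subspace_complement[OF L.subspace_inter[OF sW0 sI(1)] Int_lower1 sW0]) blast
  obtain N where N: "N \<le> n" and pos: "\<And>a b d. (a, b) \<in> W \<Longrightarrow> d > 0 \<Longrightarrow> component (\<lambda>_. 0) (fls_nth a d) = 0"
    and floor: "\<And>a b d \<gamma>. (a, b) \<in> W \<Longrightarrow> \<gamma> \<in> roots H \<Longrightarrow> d > root_floor N \<gamma> \<Longrightarrow> component \<gamma> (fls_nth a d) = 0"
    by (rule W_floor) blast
  have "W0 \<subseteq> inv_poly H \<times> trunc_poly m H"
  proof
    fix u assume u: "u \<in> W0"
    obtain a b where ab: "u = (a, b)" by force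
    have "fls_nth a d = 0" if "d > 0" for d
      using pos[of a b d] u that component_root_space[of "\<lambda>_. 0" "\<lambda>_. 0" "fls_nth a d"]
      by (simp add: W0_def ab root_space_0)
    then show "u \<in> inv_poly H \<times> trunc_poly m H"
      using u W_coeff[of a b] subspace_0[OF subspace_H] by (auto simp: W0_def ab inv_poly_def trunc_poly_iff)
  qed
  with Wh(2) have "W_h \<subseteq> inv_poly H \<times> trunc_poly m H" by blast
  moreover have "direct_sum W [W_h, I_plus \<times> {0}, {0} \<times> I_minus]"
    unfolding direct_sum_def
  proof
    show "\<forall>U\<in>set [W_h, I_plus \<times> {0}, {0} \<times> I_minus]. L.subspace U" using Wh(1) sI by simp
    show "bij_betw sum_list (listset [W_h, I_plus \<times> {0}, {0} \<times> I_minus]) W"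
      unfolding bij_betw_def
    proof
      show "inj_on sum_list (listset [W_h, I_plus \<times> {0}, {0} \<times> I_minus])"
      proof (rule inj_onI)
        fix xs ys assume "xs \<in> listset [W_h, I_plus \<times> {0}, {0} \<times> I_minus]"
          "ys \<in> listset [W_h, I_plus \<times> {0}, {0} \<times> I_minus]" and eq: "sum_list xs = sum_list ys"
        then obtain w a b w' a' b' where xs: "w \<in> W_h" "a \<in> I_plus" "b \<in> I_minus" "xs = [w, (a, 0), (0, b)]"
          and ys: "w' \<in> W_h" "a' \<in> I_plus" "b' \<in> I_minus" "ys = [w', (a', 0), (0, b')]"
          unfolding listset_Cons3 by blast
        have "w - w' = (a' - a, b' - b)"
          using eq unfolding xs ys by (simp add: prod_eq_iff algebra_simps)
        moreover have "w - w' \<in> W_h" using xs ys L.subspace_diff[OF Wh(1)] by blast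
        moreover have "(a' - a, b' - b) \<in> I_plus \<times> I_minus" using xs ys plus_diff minus_diff by simp
        ultimately have "w - w' \<in> W_h \<inter> (W0 \<inter> I_plus \<times> I_minus)" using Wh(2) by auto
        then have "w - w' = 0" using Wh(3) by auto
        moreover from this have "w = w'" by simp
        moreover have "(a' - a, b' - b) = 0" using \<open>w - w' = 0\<close> \<open>w - w' = (a' - a, b' - b)\<close> by simp
        ultimately show "xs = ys" using xs ys by (simp add: zero_prod_def)
      qed
      show "sum_list ` listset [W_h, I_plus \<times> {0}, {0} \<times> I_minus] = W"
      proof
        have "W_h \<subseteq> W" using Wh(2) by (auto simp: W0_def)
        then have "w + ((a, 0) + (0, b)) \<in> W" if "w \<in> W_h" "a \<in> I_plus" "b \<in> I_minus" for w a b
          using that by (intro L.subspace_add[OF subspace_W]) (auto simp: mem_plus mem_minus)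
        then have "sum_list [w, (a, 0), (0, b)] \<in> W" if "w \<in> W_h" "a \<in> I_plus" "b \<in> I_minus" for w a b
          using that by simp
        then show "sum_list ` listset [W_h, I_plus \<times> {0}, {0} \<times> I_minus] \<subseteq> W"
          unfolding listset_Cons3 image_subset_iff Ball_def by blast
        have image: "u \<in> sum_list ` listset [W_h, I_plus \<times> {0}, {0} \<times> I_minus]"
          if "w \<in> W_h" "u - w \<in> I_plus \<times> I_minus" for u w
        proof -
          obtain a b where ab: "u - w = (a, b)" "a \<in> I_plus" "b \<in> I_minus" using \<open>u - w \<in> _\<close> by auto
          have "sum_list [w, (a, 0), (0, b)] = w + (u - w)" unfolding ab(1) by simp
          then have "u = sum_list [w, (a, 0), (0, b)]" by simp
          moreover have "[w, (a, 0), (0, b)] \<in> listset [W_h, I_plus \<times> {0}, {0} \<times> I_minus]"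
            unfolding listset_Cons3 using \<open>w \<in> W_h\<close> ab by blast
          ultimately show ?thesis by blast
        qed
        show "W \<subseteq> sum_list ` listset [W_h, I_plus \<times> {0}, {0} \<times> I_minus]"
        proof
          fix u assume u: "u \<in> W"
          have root: "coeff_map (component \<beta>) u \<in> I_plus \<times> I_minus" if \<beta>: "\<beta> \<in> roots H" for \<beta>
          proof -
            obtain a b where ab: "coeff_map (component \<beta>) u = (a, b)" by force
            have \<beta>w: "\<beta> \<in> weights" using \<beta> by simp
            have abW: "(a, b) \<in> W" using coeff_map_component[OF u \<beta>w] ab by simp
            have a: "fls_nth a d = component \<beta> (fls_nth (fst u) d)" for d
              using coeff_map_nth(1)[of "component \<beta>" u d] component_0[OF \<beta>w] by (simp add: ab)
            have b: "coeff b i = component \<beta> (coeff (snd u) i)" for i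
              using coeff_map_nth(2)[of "component \<beta>" u i] component_0[OF \<beta>w] by (simp add: ab)
            have aW: "(a, 0) \<in> W"
              by (rule W_root_split[OF \<beta> abW]) (simp_all only: a b component_in[OF \<beta>w])
            then have "(0, b) \<in> W" using W_diff[OF abW] by fastforce
            \<comment> \<open>The floor of a root is at most 1, which is exactly the degree bound in
              \<open>x_inv_poly\<close>.\<close>
            moreover have "fls_nth a d = 0" if "d > 1" for d
              using floor[of "fst u" "snd u" \<beta> d] u \<beta> that root_floor_le(1)[OF \<beta> N] by (simp add: a)
            ultimately show ?thesis using aW by (simp add: ab mem_plus mem_minus x_inv_poly_UNIV)
          qed
          have "coeff_map (component (\<lambda>_. 0)) u \<in> W0"
            using coeff_map_component[OF u, of "\<lambda>_. 0"] component_in[of "\<lambda>_. 0"]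
            by (simp add: W0_def coeff_map_nth component_0 root_space_0)
          from compl[OF this] obtain w where
            w: "w \<in> W_h" "coeff_map (component (\<lambda>_. 0)) u - w \<in> I_plus \<times> I_minus"
            unfolding Int_iff by (elim bexE conjE)
          have "(\<Sum>\<beta>\<in>roots H. coeff_map (component \<beta>) u) \<in> I_plus \<times> I_minus"
            by (rule L.subspace_sum[OF sI(1) root])
          with w(2) have "(coeff_map (component (\<lambda>_. 0)) u - w) + (\<Sum>\<beta>\<in>roots H. coeff_map (component \<beta>) u) \<in> I_plus \<times> I_minus"
            by (rule L.subspace_add[OF sI(1)])
          moreover have "(\<Sum>\<beta>\<in>weights. coeff_map (component \<beta>) u) = coeff_map (component (\<lambda>_. 0)) u + (\<Sum>\<beta>\<in>roots H. coeff_map (component \<beta>) u)"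
            using finite_roots zero_not_root by simp
          ultimately have "u - w \<in> I_plus \<times> I_minus"
            using sum_coeff_map_component[of u] by (simp add: algebra_simps)
          with w(1) show "u \<in> sum_list ` listset [W_h, I_plus \<times> {0}, {0} \<times> I_minus]" by (rule image)
        qed
      qed
    qed
  qed
  ultimately show ?thesis using Wh(1) that by blast
qed

end

theorem theorem4p11:
  fixes scale :: "'f::{alg_closed_field, field_char_0} \<Rightarrow> 'g::ab_group_add \<Rightarrow> 'g"
    and lie :: "'g \<Rightarrow> 'g \<Rightarrow> 'g"
    and H :: "'g set"
    and n :: nat
    and \<alpha> :: "nat \<Rightarrow> 'g \<Rightarrow> 'f"
    and k :: "nat \<Rightarrow> nat"
    and hh :: "nat \<Rightarrow> 'g"
    and m :: nat
    and W :: "('g fls \<times> 'g poly) set"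
    and I_plus :: "'g fls set"
    and I_minus :: "'g poly set"
  assumes "simple_lie_algebra_with_roots scale lie H n \<alpha> k hh"
    and "m > 0"
    and "simple_lie_algebra_with_roots.regular_decomposition scale lie H n hh m W"
    and "I_plus \<subseteq> x_inv_poly UNIV"
    and "I_minus \<subseteq> trunc_poly m UNIV"
    and "I_plus \<times> {0} = W \<inter> (x_inv_poly UNIV \<times> {0})"
    and "{0} \<times> I_minus = W \<inter> ({0} \<times> trunc_poly m UNIV)"
  shows "\<exists>W_h. module.subspace (lie_algebra.L_scale scale) W_h \<and>
               W_h \<subseteq> inv_poly H \<times> trunc_poly m H \<and>
               lie_algebra.direct_sum scale W [W_h, I_plus \<times> {0}, {0} \<times> I_minus]"
proof -
  interpret regular_decomposition_data scale lie H n \<alpha> k hh m W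
    using assms(1-3) by (simp add: regular_decomposition_data_def regular_decomposition_data_axioms_def)
  have "a \<in> I_plus \<longleftrightarrow> a \<in> x_inv_poly UNIV \<and> (a, 0) \<in> W" for a
    using assms(6) by blast
  moreover have "b \<in> I_minus \<longleftrightarrow> (0, b) \<in> W" for b
  proof -
    have "(0, b) \<in> W \<Longrightarrow> b \<in> trunc_poly m UNIV" using W_coeff by (auto simp: trunc_poly_iff)
    then show ?thesis using assms(7) by blast
  qed
  ultimately show ?thesis using decomposition[of I_plus I_minus] by metis
qed

end
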